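(* Let $\Lambda$ be a CSP, let $\mathcal F$ be an unweighted instance of Max-CSP $\Lambda$ on $n$ variables, and let $\varepsilon>0$. There is a randomized algorithm, with running time polynomial in the size of $\mathcal F$ and $\lceil 1/\varepsilon\rceil$, which outputs a regular instance $\mathcal G$ of Max-CSP $\Lambda$ in which every variable has degree $O(-\log(\varepsilon)/\varepsilon^2)$, such that with probability at least $1-O(2^{-n})$ over the random choices of the algorithm both of the following hold: (a) for any assignment $\zeta$ to the variables of $\mathcal G$, there is a polynomial-time algorithm which finds an assignment $\chi$ to the variables of $\mathcal F$ with $\mathrm{Val}_\chi(\mathcal F)\ge \mathrm{Val}_\zeta(\mathcal G)-\varepsilon$; (b) $\mathrm{Opt}(\mathcal F)\le \mathrm{Opt}(\mathcal G)+\varepsilon$.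
   Context: A CSP over the language $\Sigma=[q]$, $q\in\mathbb{N}$, is a finite collection $\Lambda$ of predicates $P:[q]^k\to\{0,1\}$ (with $k=\mathrm{ar}(P)$ varying). An instance of $\Lambda$ consists of variables taking values in $\Sigma$ and constraints $C_1,\dots,C_m$, where $C_r=(P_r,S_r)$ with $P_r\in\Lambda$ and $S_r$ an ordered tuple of $\mathrm{ar}(P_r)$ distinct variables (the scope). An unweighted instance gives each constraint weight $1/m$. The degree of a variable is the number of constraints whose scope contains it; an instance is regular if all variables have the same degree. For an assignment $\chi$, $\mathrm{Val}_\chi(\mathcal F)=\frac1m\sum_r P_r(\chi(S_r))$ (the fraction of satisfied constraints), and for Max-CSP $\mathrm{Opt}(\mathcal F)=\max_\chi \mathrm{Val}_\chi(\mathcal F)$. *)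

theory Defs
  imports
    "HOL-Probability.Probability_Mass_Function"
    "HOL-Library.Landau_Symbols"
    "HOL-Computational_Algebra.Polynomial"
begin

section \<open>Constraint satisfaction problems\<close>

text \<open>
  A predicate takes the list of the values of its scope; only lists of length \<open>arity P\<close> with
  entries in \<open>[q] = {1..q}\<close> are ever relevant. A CSP over \<open>[q]\<close> is a finite list of predicates;
  constraints refer to predicates by their position in that list.
\<close>

record predicate =
  arity :: nat
  holds :: "nat list \<Rightarrow> bool"

type_synonym csp = "predicate list"

text \<open>
  The variables of an instance are \<open>0, \<dots>, nvars - 1\<close>. The constraints form a list, so a
  constraint may occur several times; variables that occur in no constraint are allowed.
\<close>

record csp_instance =
  nvars :: nat
  constraints :: "(nat \<times> nat list) list"

definition is_instance :: "csp \<Rightarrow> csp_instance \<Rightarrow> bool" where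
  "is_instance \<Lambda> F \<longleftrightarrow> constraints F \<noteq> [] \<and>
     (\<forall>(i, S) \<in> set (constraints F).
        i < length \<Lambda> \<and> length S = arity (\<Lambda> ! i) \<and> distinct S \<and> set S \<subseteq> {..<nvars F})"

definition degree_of :: "csp_instance \<Rightarrow> nat \<Rightarrow> nat" where
  "degree_of F v = length (filter (\<lambda>(i, S). v \<in> set S) (constraints F))"

definition regular :: "csp_instance \<Rightarrow> bool" where
  "regular F \<longleftrightarrow> (\<forall>u < nvars F. \<forall>v < nvars F. degree_of F u = degree_of F v)"

definition assignments :: "nat \<Rightarrow> csp_instance \<Rightarrow> (nat \<Rightarrow> nat) set" where
  "assignments q F = ({..<nvars F} \<rightarrow>\<^sub>E {1..q})"

definition Val :: "csp \<Rightarrow> csp_instance \<Rightarrow> (nat \<Rightarrow> nat) \<Rightarrow> real" where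
  "Val \<Lambda> F \<xi> =
     (\<Sum>(i, S) \<leftarrow> constraints F. of_bool (holds (\<Lambda> ! i) (map \<xi> S))) / real (length (constraints F))"

definition Opt :: "nat \<Rightarrow> csp \<Rightarrow> csp_instance \<Rightarrow> real" where
  "Opt q \<Lambda> F = Max (Val \<Lambda> F ` assignments q F)"

text \<open>
  For a fixed CSP the arities are bounded, so this is polynomially related to the length of any
  explicit encoding of the instance.
\<close>

definition inst_size :: "csp_instance \<Rightarrow> nat" where
  "inst_size F = nvars F + length (constraints F)"


section \<open>Randomized algorithms and their running time\<close>

text \<open>
  Programs transform binary trees (LISP data), as in Jones' WHILE language: \<open>Tip\<close> is the empty
  list and the truth value false, \<open>Bin\<close> is the pairing of two trees. Loops are unrestricted, so
  programs may diverge, and \<open>Flip\<close> tosses a fair coin.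
\<close>

datatype btree = Tip | Bin btree btree

datatype prog =
    Copy
  | Empty
  | Head
  | Tail
  | Flip
  | Fork prog prog
  | Seq prog prog
  | Cond prog prog prog
  | While prog prog

fun head :: "btree \<Rightarrow> btree" where
  "head Tip = Tip"
| "head (Bin x y) = x"

fun tail :: "btree \<Rightarrow> btree" where
  "tail Tip = Tip"
| "tail (Bin x y) = y"

fun enc_bool :: "bool \<Rightarrow> btree" where
  "enc_bool False = Tip"
| "enc_bool True = Bin Tip Tip"

text \<open>
  \<open>eval p x \<omega> t y \<omega>'\<close>: on input \<open>x\<close> with the coin tosses \<open>\<omega>\<close> still to come, \<open>p\<close> halts after
  time \<open>t\<close> with output \<open>y\<close>, the tosses \<open>\<omega>'\<close> being left over. An elementary operation on \<open>x\<close> is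
  charged \<open>1 + size x\<close> and not just one unit: otherwise iterating \<open>Fork Copy Copy\<close> would build
  trees of exponential size in linear time. With this charge all intermediate results are no
  larger than the time spent, and the model is polynomially equivalent to (probabilistic)
  Turing machines. There is no rule for \<open>Flip\<close> on an empty list of tosses.
\<close>

inductive eval :: "prog \<Rightarrow> btree \<Rightarrow> bool list \<Rightarrow> nat \<Rightarrow> btree \<Rightarrow> bool list \<Rightarrow> bool" where
  Copy: "eval Copy x \<omega> (1 + size x) x \<omega>"
| Empty: "eval Empty x \<omega> (1 + size x) Tip \<omega>"
| Head: "eval Head x \<omega> (1 + size x) (head x) \<omega>"
| Tail: "eval Tail x \<omega> (1 + size x) (tail x) \<omega>"
| Flip: "eval Flip x (b # \<omega>) (1 + size x) (enc_bool b) \<omega>"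
| Fork: "eval p x \<omega> s y \<omega>' \<Longrightarrow> eval p' x \<omega>' t z \<omega>'' \<Longrightarrow>
         eval (Fork p p') x \<omega> (1 + s + t) (Bin y z) \<omega>''"
| Seq: "eval p x \<omega> s y \<omega>' \<Longrightarrow> eval p' y \<omega>' t z \<omega>'' \<Longrightarrow>
        eval (Seq p p') x \<omega> (1 + s + t) z \<omega>''"
| Cond_True: "eval c x \<omega> s b \<omega>' \<Longrightarrow> b \<noteq> Tip \<Longrightarrow> eval p x \<omega>' t y \<omega>'' \<Longrightarrow>
            eval (Cond c p p') x \<omega> (1 + s + t) y \<omega>''"
| Cond_False: "eval c x \<omega> s Tip \<omega>' \<Longrightarrow> eval p' x \<omega>' t y \<omega>'' \<Longrightarrow>
             eval (Cond c p p') x \<omega> (1 + s + t) y \<omega>''"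
| While_True: "eval c x \<omega> s b \<omega>' \<Longrightarrow> b \<noteq> Tip \<Longrightarrow> eval p x \<omega>' t y \<omega>'' \<Longrightarrow>
               eval (While c p) y \<omega>'' u z \<omega>''' \<Longrightarrow>
               eval (While c p) x \<omega> (1 + s + t + u) z \<omega>'''"
| While_False: "eval c x \<omega> s Tip \<omega>' \<Longrightarrow> eval (While c p) x \<omega> (1 + size x + s) x \<omega>'"

lemma eval_size_le_time: "eval p x \<omega> t y \<omega>' \<Longrightarrow> size y \<le> t"
proof (induction rule: eval.induct)
  case (Head x \<omega>) then show ?case by (cases x) auto
next
  case (Tail x \<omega>) then show ?case by (cases x) auto
next
  case (Flip x b \<omega>) then show ?case by (cases b) auto
qed auto

lemma eval_coins_le_time: "eval p x \<omega> t y \<omega>' \<Longrightarrow> length \<omega> \<le> length \<omega>' + t"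
  by (induction rule: eval.induct) auto

lemma eval_deterministic:
  "eval p x \<omega> t y \<omega>' \<Longrightarrow> eval p x \<omega> u z \<omega>'' \<Longrightarrow> t = u \<and> y = z \<and> \<omega>' = \<omega>''"
proof (induction arbitrary: u z \<omega>'' rule: eval.induct)
  case (Fork p x \<omega> s y \<omega>' p' t z \<omega>'')
  from Fork.prems show ?case by (cases rule: eval.cases) (use Fork.IH in blast)
next
  case (Seq p x \<omega> s y \<omega>' p' t z \<omega>'')
  from Seq.prems show ?case by (cases rule: eval.cases) (use Seq.IH in blast)
next
  case (Cond_True c x \<omega> s b \<omega>' p t y \<omega>'' p')
  from Cond_True.prems show ?case by (cases rule: eval.cases) (use Cond_True.IH Cond_True.hyps in blast)+
next
  case (Cond_False c x \<omega> s \<omega>' p' t y \<omega>'' p)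
  from Cond_False.prems show ?case by (cases rule: eval.cases) (use Cond_False.IH in blast)+
next
  case (While_True c x \<omega> s b \<omega>' p t y \<omega>'' u z \<omega>''')
  from While_True.prems show ?case
    by (cases rule: eval.cases) (use While_True.IH While_True.hyps in blast)+
next
  case (While_False c x \<omega> s \<omega>' p)
  from While_False.prems show ?case by (cases rule: eval.cases) (use While_False.IH in blast)+
qed (auto elim: eval.cases)

definition halts_within :: "nat \<Rightarrow> prog \<Rightarrow> btree \<Rightarrow> bool list \<Rightarrow> btree \<Rightarrow> bool" where
  "halts_within T p x \<omega> y \<longleftrightarrow> (\<exists>t \<le> T. \<exists>\<omega>'. eval p x \<omega> t y \<omega>')"

text \<open>
  A run of time at most \<open>T\<close> tosses at most \<open>T\<close> coins, so the output distribution of a randomized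
  algorithm with running time at most \<open>T\<close> is obtained from uniform \<open>\<omega> \<in> coins T\<close>. An algorithm
  that halts on the empty list of tosses is deterministic on that input.
\<close>

definition coins :: "nat \<Rightarrow> bool list set" where
  "coins T = {\<omega>. length \<omega> = T}"


section \<open>Encodings\<close>

text \<open>
  Numbers are written in unary. All numbers involved are at most the size of the instance, or a
  constant depending on the CSP, or \<open>\<lceil>1/\<epsilon>\<rceil>\<close>, in whose value running times are measured.
\<close>

fun enc_nat :: "nat \<Rightarrow> btree" where
  "enc_nat 0 = Tip"
| "enc_nat (Suc n) = Bin Tip (enc_nat n)"

fun enc_list :: "('a \<Rightarrow> btree) \<Rightarrow> 'a list \<Rightarrow> btree" where
  "enc_list f [] = Tip"
| "enc_list f (x # xs) = Bin (f x) (enc_list f xs)"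

definition enc_instance :: "csp_instance \<Rightarrow> btree" where
  "enc_instance F = Bin (enc_nat (nvars F))
     (enc_list (\<lambda>(i, S). Bin (enc_nat i) (enc_list enc_nat S)) (constraints F))"

definition enc_assignment :: "csp_instance \<Rightarrow> (nat \<Rightarrow> nat) \<Rightarrow> btree" where
  "enc_assignment F \<xi> = enc_list (\<lambda>v. enc_nat (\<xi> v)) [0..<nvars F]"

lemma enc_nat_inject: "enc_nat m = enc_nat n \<Longrightarrow> m = n"
proof (induction m arbitrary: n)
  case 0 then show ?case by (cases n) auto
next
  case (Suc m) then show ?case by (cases n) auto
qed

lemma enc_list_inject:
  "(\<And>x y. f x = f y \<Longrightarrow> x = y) \<Longrightarrow> enc_list f xs = enc_list f ys \<Longrightarrow> xs = ys"
proof (induction xs arbitrary: ys)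
  case Nil then show ?case by (cases ys) auto
next
  case (Cons x xs) then show ?case by (cases ys) auto
qed

lemma enc_instance_inject: "enc_instance F = enc_instance G \<Longrightarrow> F = G"
  unfolding enc_instance_def
  by (auto dest!: enc_nat_inject enc_list_inject[rotated] intro!: csp_instance.equality)

end

theory Submission
  imports Defs "HOL-Probability.Hoeffding"
begin

text \<open>
  Repeat every constraint \<open>n + 1\<close> times and let \<open>w\<close> be the number of slots (occurrences of
  variables). A slot \<open>t\<close> is replaced by the list of the first \<open>L\<close> slots after \<open>t\<close> in the cyclic
  order of the slots of its variable, and a constraint by all tuples from the lists of its scope.
  This yields a regular instance whose variables are the slots; its degree \<open>L ^ K\<close> is a huge power
  of two, and each list is uniform on the slots of the variable up to an error \<open>w / L\<close>.

  The degree is then halved repeatedly: the occurrences of a variable \<open>x\<close> are paired up, and for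
  every pair a coin decides which one becomes \<open>2 * x\<close> and which one \<open>2 * x + 1\<close>. For a fixed
  assignment the expected value is that of independently choosing one of the two values for every
  \<open>x\<close>, and a single coin affects two constraints. The bounded differences inequality and a union bound
  over all assignments show that halving the degree \<open>d\<close> costs \<open>O(1 / sqrt d)\<close>. These
  errors form a geometric series, so one may stop at a degree \<open>O(1 / \<epsilon>\<^sup>2)\<close>.

  An assignment of the final instance thus gives, for every variable of \<open>F\<close>, a list of values such
  that choosing values independently from these lists loses at most \<open>\<epsilon>\<close> in expectation; fixing
  the variables one by one without decreasing the expectation turns the lists into an assignment.
\<close>


section \<open>Programs running in polynomial time\<close>

text \<open>Regularity has to hold for every outcome of the coins, not merely with high probability;
  plain sampling of constraints would not give that, whereas pairing halves even degrees exactly.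
  The \<open>n + 1\<close> copies serve the failure probability: variables in no constraint are
  allowed, so \<open>n\<close> may exceed the number of constraints, while the exponents of the tail
  bounds grow with that number. All levels have the same number of slots while the number of
  variables doubles, so the union bound forces deviations growing like \<open>sqrt 2 ^ k\<close>;
  the last level dominates and determines the final degree. Only one direction is probabilistic:
  copying turns an assignment of F into one of G with exactly the same value, whatever the coins
  are, hence deviations are controlled from above only. Since concrete programs are asked for, all
  coins are tossed in a single loop and both algorithms are composed of folds over lists, so that
  running times follow from closure properties.\<close>

lemma poly_mono_nat: "x \<le> y \<Longrightarrow> poly T x \<le> poly (T :: nat poly) y"
  by (induction T) (auto intro!: add_mono mult_mono)

definition poly_bounded :: "'a set \<Rightarrow> ('a \<Rightarrow> btree) \<Rightarrow> ('a \<Rightarrow> nat) \<Rightarrow> bool" where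
  "poly_bounded D e B \<longleftrightarrow> (\<exists>T. \<forall>a\<in>D. B a \<le> poly T (size (e a)))"

text \<open>Inputs are abstract data \<open>a\<close> in \<open>D\<close>, read through the encoding
  \<open>e\<close>; restricting \<open>D\<close> lets branches and loop bodies be correct only on
  the states that actually occur. The coins \<omega> are arbitrary and returned untouched: such a
  program is deterministic, yet can be run inside a randomized one.\<close>

definition polytime :: "'a set \<Rightarrow> ('a \<Rightarrow> btree) \<Rightarrow> ('a \<Rightarrow> btree) \<Rightarrow> bool" where
  "polytime D e f \<longleftrightarrow>
     (\<exists>p T. \<forall>a\<in>D. \<forall>\<omega>. \<exists>t \<le> poly T (size (e a)). eval p (e a) \<omega> t (f a) \<omega>)"

lemma polytimeI:
  "(\<And>a \<omega>. a \<in> D \<Longrightarrow> \<exists>t \<le> poly T (size (e a)). eval p (e a) \<omega> t (f a) \<omega>) \<Longrightarrow> polytime D e f"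
  unfolding polytime_def by blast

lemma polytime_subset: "polytime D e f \<Longrightarrow> D' \<subseteq> D \<Longrightarrow> polytime D' e f"
  unfolding polytime_def by blast

lemma polytime_cong:
  "polytime D e f \<Longrightarrow> (\<And>a. a \<in> D \<Longrightarrow> f a = g a) \<Longrightarrow> polytime D e g"
  unfolding polytime_def by metis

lemma poly_bounded_mono:
  assumes "poly_bounded D e B" "\<And>a. a \<in> D \<Longrightarrow> C a \<le> B a"
  shows "poly_bounded D e C"
  using assms unfolding poly_bounded_def by (meson order_trans)

lemma poly_bounded_const: "poly_bounded D e (\<lambda>_. n)"
  unfolding poly_bounded_def by (rule exI[of _ "[:n:]"]) simp

lemma poly_bounded_add:
  assumes "poly_bounded D e B" "poly_bounded D e C"
  shows "poly_bounded D e (\<lambda>a. B a + C a)"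
proof -
  from assms obtain T S where "\<forall>a\<in>D. B a \<le> poly T (size (e a))" "\<forall>a\<in>D. C a \<le> poly S (size (e a))"
    unfolding poly_bounded_def by blast
  then show ?thesis
    unfolding poly_bounded_def by (intro exI[of _ "T + S"]) (auto intro: add_mono)
qed

lemma poly_bounded_mult:
  assumes "poly_bounded D e B" "poly_bounded D e C"
  shows "poly_bounded D e (\<lambda>a. B a * C a)"
proof -
  from assms obtain T S where "\<forall>a\<in>D. B a \<le> poly T (size (e a))" "\<forall>a\<in>D. C a \<le> poly S (size (e a))"
    unfolding poly_bounded_def by blast
  then show ?thesis
    unfolding poly_bounded_def by (intro exI[of _ "T * S"]) (auto intro: mult_mono)
qed

lemma poly_bounded_Suc: "poly_bounded D e B \<Longrightarrow> poly_bounded D e (\<lambda>a. Suc (B a))"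
  using poly_bounded_add[OF _ poly_bounded_const[of _ _ 1]] by simp

lemma poly_bounded_power: "poly_bounded D e B \<Longrightarrow> poly_bounded D e (\<lambda>a. B a ^ k)"
  by (induction k) (auto intro: poly_bounded_const poly_bounded_mult)

lemma poly_bounded_size_input: "poly_bounded D e (\<lambda>a. size (e a))"
  unfolding poly_bounded_def by (rule exI[of _ "[:0, 1:]"]) simp

lemma poly_bounded_polytime: "polytime D e f \<Longrightarrow> poly_bounded D e (\<lambda>a. size (f a))"
  unfolding poly_bounded_def
  unfolding polytime_def by (meson eval_size_le_time order_trans)

lemmas poly_bounded_intros =
  poly_bounded_const poly_bounded_add poly_bounded_mult poly_bounded_Suc poly_bounded_power
  poly_bounded_size_input

text \<open>The output of the first program is no larger than its running time, so the second bound
  is applied to a polynomial and the bounds compose. The map \<open>h\<close> reinterprets that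
  output as the encoding \<open>e'\<close> of an element of \<open>D'\<close>.\<close>

lemma polytime_comp:
  assumes f: "polytime D e f" and g: "polytime D' e' g"
    and h: "\<And>a. a \<in> D \<Longrightarrow> h a \<in> D'" "\<And>a. a \<in> D \<Longrightarrow> f a = e' (h a)"
  shows "polytime D e (\<lambda>a. g (h a))"
proof -
  from f obtain p T where p: "\<forall>a\<in>D. \<forall>\<omega>. \<exists>t \<le> poly T (size (e a)). eval p (e a) \<omega> t (f a) \<omega>"
    unfolding polytime_def by blast
  from g obtain r S where r: "\<forall>a\<in>D'. \<forall>\<omega>. \<exists>t \<le> poly S (size (e' a)). eval r (e' a) \<omega> t (g a) \<omega>"
    unfolding polytime_def by blast
  show ?thesis
  proof (rule polytimeI)
    fix a \<omega> assume a: "a \<in> D"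
    from p[rule_format, OF a] obtain t where t: "t \<le> poly T (size (e a))" "eval p (e a) \<omega> t (f a) \<omega>" by blast
    from r[rule_format, OF h(1)[OF a]] obtain u where u: "u \<le> poly S (size (e' (h a)))"
      "eval r (e' (h a)) \<omega> u (g (h a)) \<omega>" by blast
    have "u \<le> poly S (poly T (size (e a)))"
      using u(1) eval_size_le_time[OF t(2)] t(1) h(2)[OF a] poly_mono_nat
      by (metis order_trans)
    then show "\<exists>t \<le> poly ([:1:] + T + S \<circ>\<^sub>p T) (size (e a)). eval (Seq p r) (e a) \<omega> t (g (h a)) \<omega>"
      using t u h(2)[OF a] by (intro exI[of _ "1 + t + u"]) (auto simp: poly_pcompose intro: eval.Seq[simplified])
  qed
qed

lemma polytime_input: "polytime D e e"
  by (rule polytimeI[where p = Copy and T = "[:1, 1:]"]) (auto intro!: exI[of _ "1 + size _"] eval.Copy)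

lemma polytime_Tip: "polytime D e (\<lambda>_. Tip)"
  by (rule polytimeI[where p = Empty and T = "[:1, 1:]"]) (auto intro!: exI[of _ "1 + size _"] eval.Empty)

lemma polytime_head: assumes "polytime D e f" shows "polytime D e (\<lambda>a. head (f a))"
  by (rule polytime_comp[rule_format, OF assms, where D' = UNIV and e' = "\<lambda>x. x"])
    (auto intro!: polytimeI[where p = Head and T = "[:1, 1:]"] exI[of _ "1 + size _"] eval.Head
       simp del: One_nat_def)

lemma polytime_tail: assumes "polytime D e f" shows "polytime D e (\<lambda>a. tail (f a))"
  by (rule polytime_comp[rule_format, OF assms, where D' = UNIV and e' = "\<lambda>x. x"])
    (auto intro!: polytimeI[where p = Tail and T = "[:1, 1:]"] exI[of _ "1 + size _"] eval.Tail
       simp del: One_nat_def)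

lemma polytime_Bin:
  assumes f: "polytime D e f" and g: "polytime D e g"
  shows "polytime D e (\<lambda>a. Bin (f a) (g a))"
proof -
  from f obtain p T where p: "\<forall>a\<in>D. \<forall>\<omega>. \<exists>t \<le> poly T (size (e a)). eval p (e a) \<omega> t (f a) \<omega>"
    unfolding polytime_def by blast
  from g obtain r S where r: "\<forall>a\<in>D. \<forall>\<omega>. \<exists>t \<le> poly S (size (e a)). eval r (e a) \<omega> t (g a) \<omega>"
    unfolding polytime_def by blast
  show ?thesis
  proof (rule polytimeI)
    fix a \<omega> assume a: "a \<in> D"
    from p[rule_format, OF a] obtain t where t: "t \<le> poly T (size (e a))" "eval p (e a) \<omega> t (f a) \<omega>" by blast
    from r[rule_format, OF a] obtain u where u: "u \<le> poly S (size (e a))" "eval r (e a) \<omega> u (g a) \<omega>" by blast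
    show "\<exists>t \<le> poly ([:1:] + T + S) (size (e a)). eval (Fork p r) (e a) \<omega> t (Bin (f a) (g a)) \<omega>"
      using t u by (intro exI[of _ "1 + t + u"]) (auto intro: eval.Fork[simplified])
  qed
qed

lemma polytime_const: "polytime D e (\<lambda>_. c)"
  by (induction c) (auto intro: polytime_Tip polytime_Bin)

lemma polytime_cond:
  assumes c: "polytime D e c" and f: "polytime {a\<in>D. c a \<noteq> Tip} e f" and g: "polytime {a\<in>D. c a = Tip} e g"
  shows "polytime D e (\<lambda>a. if c a \<noteq> Tip then f a else g a)"
proof -
  from c obtain q U where q: "\<forall>a\<in>D. \<forall>\<omega>. \<exists>t \<le> poly U (size (e a)). eval q (e a) \<omega> t (c a) \<omega>"
    unfolding polytime_def by blast
  from f obtain p T where p: "\<forall>a\<in>{a\<in>D. c a \<noteq> Tip}. \<forall>\<omega>. \<exists>t \<le> poly T (size (e a)). eval p (e a) \<omega> t (f a) \<omega>"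
    unfolding polytime_def by blast
  from g obtain r S where r: "\<forall>a\<in>{a\<in>D. c a = Tip}. \<forall>\<omega>. \<exists>t \<le> poly S (size (e a)). eval r (e a) \<omega> t (g a) \<omega>"
    unfolding polytime_def by blast
  show ?thesis
  proof (rule polytimeI)
    fix a \<omega> assume a: "a \<in> D"
    from q[rule_format, OF a] obtain v where v: "v \<le> poly U (size (e a))" "eval q (e a) \<omega> v (c a) \<omega>" by blast
    show "\<exists>t \<le> poly ([:1:] + T + S + U) (size (e a)).
            eval (Cond q p r) (e a) \<omega> t (if c a \<noteq> Tip then f a else g a) \<omega>"
    proof (cases "c a = Tip")
      case True
      then obtain t where t: "t \<le> poly S (size (e a))" "eval r (e a) \<omega> t (g a) \<omega>" using r a by blast
      then show ?thesis using v True
        by (intro exI[of _ "1 + v + t"]) (auto intro: eval.Cond_False[simplified])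
    next
      case False
      then obtain t where t: "t \<le> poly T (size (e a))" "eval p (e a) \<omega> t (f a) \<omega>" using p a by blast
      then show ?thesis using v False
        by (intro exI[of _ "1 + v + t"]) (auto intro: eval.Cond_True[simplified])
    qed
  qed
qed

lemma enc_bool_eq_Tip [simp]: "enc_bool b = Tip \<longleftrightarrow> \<not> b"
  by (cases b) auto

lemma polytime_if:
  assumes "polytime D e (\<lambda>a. enc_bool (c a))" "polytime {a\<in>D. c a} e f" "polytime {a\<in>D. \<not> c a} e g"
  shows "polytime D e (\<lambda>a. if c a then f a else g a)"
  using polytime_cond[OF assms(1), of f g] assms(2,3) by simp

section \<open>While loops and folds\<close>

lemma eval_While_sequence:
  assumes "\<And>i. i < n \<Longrightarrow> \<exists>t \<le> \<tau>. eval c (st i) (ws i) t (b i) (ws i)" "\<And>i. i < n \<Longrightarrow> b i \<noteq> Tip"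
    and "\<And>i. i < n \<Longrightarrow> \<exists>t \<le> \<tau>. eval p (st i) (ws i) t (st (Suc i)) (ws (Suc i))"
    and "\<exists>t \<le> \<tau>. eval c (st n) (ws n) t Tip (ws n)" and "size (st n) \<le> \<tau>"
  shows "\<exists>t \<le> (n + 1) * (1 + 2 * \<tau>). eval (While c p) (st 0) (ws 0) t (st n) (ws n)"
  using assms
proof (induction n arbitrary: st ws b)
  case 0
  then obtain t where "t \<le> \<tau>" "eval c (st 0) (ws 0) t Tip (ws 0)" by blast
  then show ?case using 0 by (intro exI[of _ "1 + size (st 0) + t"]) (auto intro: eval.While_False[simplified])
next
  case (Suc n)
  from Suc.prems(1)[of 0] obtain t where t: "t \<le> \<tau>" "eval c (st 0) (ws 0) t (b 0) (ws 0)" by blast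
  from Suc.prems(3)[of 0] obtain u where u: "u \<le> \<tau>" "eval p (st 0) (ws 0) u (st 1) (ws 1)" by auto
  have "\<exists>t \<le> (n + 1) * (1 + 2 * \<tau>). eval (While c p) (st (Suc 0)) (ws (Suc 0)) t (st (Suc n)) (ws (Suc n))"
    by (rule Suc.IH[of "\<lambda>i. st (Suc i)" "\<lambda>i. ws (Suc i)" "\<lambda>i. b (Suc i)"]) (use Suc.prems in auto)
  then obtain v where v: "v \<le> (n + 1) * (1 + 2 * \<tau>)"
    "eval (While c p) (st 1) (ws 1) v (st (Suc n)) (ws (Suc n))" by auto
  have "eval (While c p) (st 0) (ws 0) (1 + t + u + v) (st (Suc n)) (ws (Suc n))"
    using t(2) Suc.prems(2)[of 0] u(2) v(2) by (intro eval.While_True) auto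
  moreover have "1 + t + u + v \<le> (Suc n + 1) * (1 + 2 * \<tau>)" using t(1) u(1) v(1) by simp
  ultimately show ?case by blast
qed

lemma length_le_size_enc_list: "length xs \<le> size (enc_list f xs)"
  by (induction xs) auto

lemma size_enc_list_drop_le: "size (enc_list f (drop i xs)) \<le> size (enc_list f xs)"
proof (induction xs arbitrary: i)
  case (Cons x xs) then show ?case by (cases i) (auto simp: le_SucI trans_le_add2)
qed auto

text \<open>The loop state consists of the input, the remaining list and the accumulator, so that
  each step can still consult the input. Iterating a polynomial-time step may produce exponential
  growth; hence the separate bound \<open>B\<close> on the accumulator after every prefix of the
  list. The step need only work on states reached after such a prefix.\<close>

lemma polytime_fold:
  assumes xs: "polytime D e (\<lambda>a. enc_list ex (xs a))" and z: "polytime D e (\<lambda>a. ez (z a))"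
    and step: "polytime {y. fst y \<in> D \<and> (\<exists>us vs. xs (fst y) = us @ fst (snd y) # vs \<and>
                     snd (snd y) = fold (g (fst y)) us (z (fst y)))}
                 (\<lambda>y. Bin (e (fst y)) (Bin (ex (fst (snd y))) (ez (snd (snd y)))))
                 (\<lambda>y. ez (g (fst y) (fst (snd y)) (snd (snd y))))"
    and B: "poly_bounded D e B"
      "\<And>a us vs. a \<in> D \<Longrightarrow> xs a = us @ vs \<Longrightarrow> size (ez (fold (g a) us (z a))) \<le> B a"
  shows "polytime D e (\<lambda>a. ez (fold (g a) (xs a) (z a)))"
proof -
  define E where "E = (\<lambda>(a, us, s). Bin (e a) (Bin (enc_list ex us) (ez s)))"
  define DS where "DS = {(a, x # vs, s) | a x vs s us. a \<in> D \<and> xs a = us @ x # vs \<and> s = fold (g a) us (z a)}"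
  define N where "N = (\<lambda>(a, us, s). (a, tl us, g a (hd us) s))"
  have E1: "head (E y) = e (fst y)" "tail (E y) = Bin (enc_list ex (fst (snd y))) (ez (snd (snd y)))" for y
    unfolding E_def by (auto simp: case_prod_beta)
  have PH: "polytime DS E (\<lambda>y. e (fst y))"
    using polytime_head[OF polytime_input[of DS E]] by (simp add: E1)
  have PL: "polytime DS E (\<lambda>y. enc_list ex (fst (snd y)))"
    using polytime_head[OF polytime_tail[OF polytime_input[of DS E]]] by (simp add: E1)
  have PS: "polytime DS E (\<lambda>y. ez (snd (snd y)))"
    using polytime_tail[OF polytime_tail[OF polytime_input[of DS E]]] by (simp add: E1)
  have PX: "polytime DS E (\<lambda>y. ex (hd (fst (snd y))))"
    by (rule polytime_cong[OF polytime_head[OF PL]]) (auto simp: DS_def)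
  have PT: "polytime DS E (\<lambda>y. enc_list ex (tl (fst (snd y))))"
    by (rule polytime_cong[OF polytime_tail[OF PL]]) (auto simp: DS_def)
  have PG: "polytime DS E (\<lambda>y. ez (g (fst y) (hd (fst (snd y))) (snd (snd y))))"
    using polytime_comp[rule_format, OF polytime_Bin[OF PH polytime_Bin[OF PX PS]] step,
        where h = "\<lambda>y. (fst y, hd (fst (snd y)), snd (snd y))"]
    by (fastforce simp: DS_def)
  have "polytime DS E (\<lambda>y. E (N y))"
    using polytime_Bin[OF PH polytime_Bin[OF PT PG]] by (simp add: E_def N_def case_prod_beta)
  then obtain p T where p: "\<forall>y\<in>DS. \<forall>\<omega>. \<exists>t \<le> poly T (size (E y)). eval p (E y) \<omega> t (E (N y)) \<omega>"
    unfolding polytime_def by blast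
  let ?init = "\<lambda>a. (a, xs a, z a)"
  have "polytime D e (\<lambda>a. E (?init a))"
    using polytime_Bin[OF polytime_input polytime_Bin[OF xs z]] by (simp add: E_def)
  then obtain r S where r: "\<forall>a\<in>D. \<forall>\<omega>. \<exists>t \<le> poly S (size (e a)). eval r (e a) \<omega> t (E (?init a)) \<omega>"
    unfolding polytime_def by blast
  have bX: "poly_bounded D e (\<lambda>a. size (enc_list ex (xs a)))"
    using poly_bounded_polytime[OF xs] .
  \<comment> \<open>\<open>M a\<close> bounds every loop state, the \<open>2\<close> being its two
    pairing nodes. A test costs at most \<open>2 * M a + 3\<close> and a round of the body
    \<open>poly T (M a)\<close>; hence \<open>ts\<close>.\<close>
  define M where "M a = size (e a) + size (enc_list ex (xs a)) + B a + 2" for a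
  have bM: "poly_bounded D e M"
    unfolding M_def by (intro poly_bounded_intros bX B(1))
  define ts where "ts a = poly T (M a) + 2 * M a + 3" for a
  have bT: "poly_bounded D e (\<lambda>a. poly T (M a))"
  proof -
    from bM obtain U where U: "\<forall>a\<in>D. M a \<le> poly U (size (e a))" unfolding poly_bounded_def by blast
    then show ?thesis unfolding poly_bounded_def
      by (intro exI[of _ "T \<circ>\<^sub>p U"]) (auto simp: poly_pcompose intro: poly_mono_nat)
  qed
  have "poly_bounded D e (\<lambda>a. (length (xs a) + 1) * (1 + 2 * ts a))"
    unfolding ts_def
    by (intro poly_bounded_intros bT bM poly_bounded_mono[OF bX] length_le_size_enc_list)
  then obtain U where U: "\<And>a. a \<in> D \<Longrightarrow> (length (xs a) + 1) * (1 + 2 * ts a) \<le> poly U (size (e a))"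
    unfolding poly_bounded_def by blast
  obtain V where V: "\<And>a. a \<in> D \<Longrightarrow> M a \<le> poly V (size (e a))"
    using bM unfolding poly_bounded_def by blast
  \<comment> \<open>The second component of the state is the remaining list, and a list is encoded
    by \<open>Tip\<close> only if it is empty; so reading it off serves as the loop
    condition.\<close>
  let ?c = "Seq Tail Head" and ?o = "Seq Tail Tail"
  show ?thesis
  proof (rule polytimeI)
    fix a \<omega> assume a: "a \<in> D"
    define n where "n = length (xs a)"
    define ys where "ys i = (a, drop i (xs a), fold (g a) (take i (xs a)) (z a))" for i
    have ys_size: "size (E (ys i)) \<le> M a" for i
      using size_enc_list_drop_le[of ex i "xs a"] B(2)[OF a append_take_drop_id[symmetric, of "xs a" i]]
      by (simp add: E_def ys_def M_def)
    have ys_DS: "ys i \<in> DS" "N (ys i) = ys (Suc i)" if "i < n" for i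
    proof -
      have d: "drop i (xs a) = xs a ! i # drop (Suc i) (xs a)"
        using that by (simp add: Cons_nth_drop_Suc n_def)
      have "xs a = take i (xs a) @ xs a ! i # drop (Suc i) (xs a)"
        using that by (simp add: id_take_nth_drop n_def)
      then show "ys i \<in> DS" using a d unfolding DS_def ys_def by blast
      show "N (ys i) = ys (Suc i)"
        using that d by (simp add: N_def ys_def n_def take_Suc_conv_app_nth)
    qed
    have tail_size: "size (tail x) \<le> size x" for x by (cases x) auto
    have cond: "\<exists>t \<le> ts a. eval ?c (E (ys i)) \<omega> t (enc_list ex (drop i (xs a))) \<omega>" for i
    proof -
      have "eval ?c (E (ys i)) \<omega> (1 + (1 + size (E (ys i))) + (1 + size (tail (E (ys i))))) (head (tail (E (ys i)))) \<omega>"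
        by (rule eval.Seq[OF eval.Tail eval.Head])
      then show ?thesis
        using ys_size[of i] tail_size[of "E (ys i)"]
        by (intro exI[of _ "1 + (1 + size (E (ys i))) + (1 + size (tail (E (ys i))))"])
          (auto simp: ts_def E1 ys_def)
    qed
    have body: "\<exists>t \<le> ts a. eval p (E (ys i)) \<omega> t (E (ys (Suc i))) \<omega>" if "i < n" for i
    proof -
      have N: "N (ys i) = ys (Suc i)" using ys_DS(2) that .
      from p[rule_format, OF ys_DS(1)[OF that]] obtain t where "t \<le> poly T (size (E (ys i)))"
        "eval p (E (ys i)) \<omega> t (E (ys (Suc i))) \<omega>" by (auto simp: N)
      moreover have "poly T (size (E (ys i))) \<le> poly T (M a)" by (intro poly_mono_nat ys_size)
      ultimately show ?thesis unfolding ts_def by (intro exI[of _ t]) auto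
    qed
    have "\<exists>t \<le> (n + 1) * (1 + 2 * ts a). eval (While ?c p) (E (ys 0)) \<omega> t (E (ys n)) \<omega>"
    proof (rule eval_While_sequence[where st = "\<lambda>i. E (ys i)" and ws = "\<lambda>_. \<omega>" and b = "\<lambda>i. enc_list ex (drop i (xs a))"])
      show "enc_list ex (drop i (xs a)) \<noteq> Tip" if "i < n" for i
        using that by (cases "drop i (xs a)") (auto simp: n_def)
      show "\<exists>t \<le> ts a. eval ?c (E (ys n)) \<omega> t Tip \<omega>" using cond[of n] by (simp add: n_def)
      show "size (E (ys n)) \<le> ts a" using ys_size[of n] by (simp add: ts_def)
    qed (use cond body in auto)
    then obtain t where t: "t \<le> (n + 1) * (1 + 2 * ts a)" "eval (While ?c p) (E (?init a)) \<omega> t (E (ys n)) \<omega>"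
      by (auto simp: ys_def)
    obtain u where u: "u \<le> poly S (size (e a))" "eval r (e a) \<omega> u (E (?init a)) \<omega>" using r[rule_format, OF a] by blast
    let ?v = "1 + (1 + size (E (ys n))) + (1 + size (tail (E (ys n))))"
    have v: "eval ?o (E (ys n)) \<omega> ?v (ez (fold (g a) (xs a) (z a))) \<omega>"
    proof -
      have "eval ?o (E (ys n)) \<omega> ?v (tail (tail (E (ys n)))) \<omega>"
        by (rule eval.Seq[OF eval.Tail eval.Tail])
      then show ?thesis by (simp add: E1 ys_def n_def)
    qed
    have "eval (Seq r (Seq (While ?c p) ?o)) (e a) \<omega> (1 + u + (1 + t + ?v)) (ez (fold (g a) (xs a) (z a))) \<omega>"
      by (rule eval.Seq[OF u(2) eval.Seq[OF t(2) v]])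
    moreover have "1 + u + (1 + t + ?v) \<le> poly (S + U + [:2:] * V + [:5:]) (size (e a))"
      using u(1) t(1) U[OF a] V[OF a] ys_size[of n] tail_size[of "E (ys n)"] by (simp add: n_def)
    ultimately show "\<exists>t \<le> poly (S + U + [:2:] * V + [:5:]) (size (e a)).
        eval (Seq r (Seq (While ?c p) ?o)) (e a) \<omega> t (ez (fold (g a) (xs a) (z a))) \<omega>" by blast
  qed
qed

text \<open>Loop bodies see the outer input paired with local data; programs for the outer input are
  reused by first projecting to it.\<close>

lemma polytime_outer:
  assumes "polytime D e f" "\<And>y. y \<in> D' \<Longrightarrow> fst y \<in> D"
  shows "polytime D' (\<lambda>y. Bin (e (fst y)) (r y)) (\<lambda>y. f (fst y))"
  by (rule polytime_comp[OF polytime_head[OF polytime_input] assms(1)]) (use assms(2) in auto)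

lemma polytime_inner: "polytime D' (\<lambda>y. Bin (l y) (r y)) r"
  using polytime_tail[OF polytime_input, of D' "\<lambda>y. Bin (l y) (r y)"] by simp

lemma polytime_inner1: "polytime D' (\<lambda>y. Bin (l y) (Bin (r y) (s y))) r"
  using polytime_head[OF polytime_inner, of D' l "\<lambda>y. Bin (r y) (s y)"] by simp

lemma polytime_inner2: "polytime D' (\<lambda>y. Bin (l y) (Bin (r y) (s y))) s"
  using polytime_tail[OF polytime_inner, of D' l "\<lambda>y. Bin (r y) (s y)"] by simp

lemma size_enc_list: "size (enc_list f xs) = (\<Sum>x\<leftarrow>xs. size (f x) + 1)"
  by (induction xs) auto

lemma size_enc_nat [simp]: "size (enc_nat n) = n"
  by (induction n) auto

lemma polytime_rev:
  assumes "polytime D e (\<lambda>a. enc_list ex (xs a))"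
  shows "polytime D e (\<lambda>a. enc_list ex (rev (xs a)))"
proof -
  have "polytime D e (\<lambda>a. enc_list ex (fold Cons (xs a) []))"
  proof (rule polytime_fold[OF assms, where B = "\<lambda>a. size (enc_list ex (xs a))"])
    show "poly_bounded D e (\<lambda>a. size (enc_list ex (xs a)))" by (rule poly_bounded_polytime[OF assms])
  qed (auto intro: polytime_Tip polytime_Bin polytime_inner1 polytime_inner2
         simp: fold_Cons_rev size_enc_list rev_map[symmetric] sum_list_rev)
  then show ?thesis by (simp add: fold_Cons_rev)
qed

lemma polytime_foldr:
  assumes xs: "polytime D e (\<lambda>a. enc_list ex (xs a))" and z: "polytime D e (\<lambda>a. ez (z a))"
    and step: "polytime {y. fst y \<in> D \<and> (\<exists>us vs. xs (fst y) = us @ fst (snd y) # vs \<and>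
                     snd (snd y) = foldr (g (fst y)) vs (z (fst y)))}
                 (\<lambda>y. Bin (e (fst y)) (Bin (ex (fst (snd y))) (ez (snd (snd y)))))
                 (\<lambda>y. ez (g (fst y) (fst (snd y)) (snd (snd y))))"
    and B: "poly_bounded D e B"
      "\<And>a us vs. a \<in> D \<Longrightarrow> xs a = us @ vs \<Longrightarrow> size (ez (foldr (g a) vs (z a))) \<le> B a"
  shows "polytime D e (\<lambda>a. ez (foldr (g a) (xs a) (z a)))"
  unfolding foldr_conv_fold
proof (rule polytime_fold[where ex = ex and ez = ez and z = z and xs = "\<lambda>a. rev (xs a)", OF polytime_rev[OF xs] z _ B(1)])
  show "polytime {y. fst y \<in> D \<and> (\<exists>us vs. rev (xs (fst y)) = us @ fst (snd y) # vs \<and>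
                     snd (snd y) = fold (g (fst y)) us (z (fst y)))}
                 (\<lambda>y. Bin (e (fst y)) (Bin (ex (fst (snd y))) (ez (snd (snd y)))))
                 (\<lambda>y. ez (g (fst y) (fst (snd y)) (snd (snd y))))"
  proof (rule polytime_subset[OF step], safe)
    fix a x s us vs assume "rev (xs (fst (a, x, s))) = us @ fst (snd (a, x, s)) # vs"
      "snd (snd (a, x, s)) = fold (g (fst (a, x, s))) us (z (fst (a, x, s)))"
    then have "xs a = rev vs @ x # rev us" "s = foldr (g a) (rev us) (z a)"
      by (simp_all add: rev_swap foldr_conv_fold)
    then show "\<exists>us vs. xs (fst (a, x, s)) = us @ fst (snd (a, x, s)) # vs \<and>
                     snd (snd (a, x, s)) = foldr (g (fst (a, x, s))) vs (z (fst (a, x, s)))" by auto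
  qed
  show "size (ez (fold (g a) us (z a))) \<le> B a" if "a \<in> D" "rev (xs a) = us @ vs" for a us vs
    using B(2)[of a "rev vs" "rev us"] that by (simp add: foldr_conv_fold rev_swap)
qed

section \<open>List operations\<close>

lemma foldr_Cons_append: "foldr Cons xs ys = xs @ ys"
  by (induction xs) auto

lemma polytime_append:
  assumes xs: "polytime D e (\<lambda>a. enc_list ex (xs a))" and ys: "polytime D e (\<lambda>a. enc_list ex (ys a))"
  shows "polytime D e (\<lambda>a. enc_list ex (xs a @ ys a))"
proof -
  have "polytime D e (\<lambda>a. enc_list ex (foldr Cons (xs a) (ys a)))"
  proof (rule polytime_foldr[OF xs, where B = "\<lambda>a. size (enc_list ex (xs a)) + size (enc_list ex (ys a))"])
    show "poly_bounded D e (\<lambda>a. size (enc_list ex (xs a)) + size (enc_list ex (ys a)))"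
      by (intro poly_bounded_add poly_bounded_polytime xs ys)
  qed (auto intro!: polytime_Bin polytime_inner1 polytime_inner2 ys simp: size_enc_list foldr_Cons_append)
  then show ?thesis by (simp add: foldr_Cons_append)
qed

text \<open>No size bound has to be supplied: the image of an entry is no larger than the time spent
  on it, and this bounds the accumulated list.\<close>

lemma polytime_map:
  assumes xs: "polytime D e (\<lambda>a. enc_list ex (xs a))"
    and f: "polytime {y. fst y \<in> D \<and> snd y \<in> set (xs (fst y))}
      (\<lambda>y. Bin (e (fst y)) (ex (snd y))) (\<lambda>y. ey (f (fst y) (snd y)))"
  shows "polytime D e (\<lambda>a. enc_list ey (map (f a) (xs a)))"
proof -
  from poly_bounded_polytime[OF f] obtain T where
    T: "\<And>a x. a \<in> D \<Longrightarrow> x \<in> set (xs a) \<Longrightarrow> size (ey (f a x)) \<le> poly T (size (Bin (e a) (ex x)))"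
    unfolding poly_bounded_def by fastforce
  let ?M = "\<lambda>a. size (e a) + size (enc_list ex (xs a)) + 1"
  have M: "poly_bounded D e ?M" by (intro poly_bounded_intros poly_bounded_polytime xs)
  then obtain U where U: "\<And>a. a \<in> D \<Longrightarrow> ?M a \<le> poly U (size (e a))" unfolding poly_bounded_def by blast
  have T': "size (ey (f a x)) \<le> poly T (?M a)" if "a \<in> D" "x \<in> set (xs a)" for a x
  proof -
    have "size (ex x) \<le> size (enc_list ex (xs a))"
      using that(2) by (induction "xs a" rule: rev_induct)
        (auto simp: size_enc_list intro: trans_le_add1 dest!: split_list)
    then have "poly T (size (Bin (e a) (ex x))) \<le> poly T (?M a)" by (intro poly_mono_nat) auto
    then show ?thesis using T[OF that] by linarith
  qed
  have PM: "poly_bounded D e (\<lambda>a. poly T (?M a))"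
    unfolding poly_bounded_def
    by (rule exI[of _ "T \<circ>\<^sub>p U"]) (use U in \<open>auto simp: poly_pcompose intro: poly_mono_nat\<close>)
  let ?B = "\<lambda>a. length (xs a) * (poly T (?M a) + 1)"
  have "polytime D e (\<lambda>a. enc_list ey (foldr (\<lambda>x s. f a x # s) (xs a) []))"
  proof (rule polytime_foldr[OF xs, where B = ?B])
    show "poly_bounded D e ?B"
      by (intro poly_bounded_mult poly_bounded_add poly_bounded_const PM
            poly_bounded_mono[OF poly_bounded_polytime[OF xs] length_le_size_enc_list])
    show "polytime {y. fst y \<in> D \<and> (\<exists>us vs. xs (fst y) = us @ fst (snd y) # vs \<and>
                snd (snd y) = foldr (\<lambda>x. (#) (f (fst y) x)) vs [])}
           (\<lambda>y. Bin (e (fst y)) (Bin (ex (fst (snd y))) (enc_list ey (snd (snd y)))))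
           (\<lambda>y. enc_list ey (f (fst y) (fst (snd y)) # snd (snd y)))" (is "polytime ?D ?e _")
      unfolding enc_list.simps
    proof (rule polytime_Bin[OF _ polytime_inner2])
      have "polytime ?D ?e (\<lambda>y. Bin (e (fst y)) (ex (fst (snd y))))"
        by (rule polytime_Bin[OF polytime_outer[OF polytime_input[of D]] polytime_inner1]) simp
      then show "polytime ?D ?e (\<lambda>y. ey (f (fst y) (fst (snd y))))"
        by (rule polytime_comp[OF _ f, where h = "\<lambda>y. (fst y, fst (snd y))", unfolded fst_conv snd_conv]) auto
    qed
    show "size (enc_list ey (foldr (\<lambda>x. (#) (f a x)) vs [])) \<le> ?B a"
      if a: "a \<in> D" and eq: "xs a = us @ vs" for a us vs
    proof -
      have "foldr (\<lambda>x. (#) (f a x)) vs [] = map (f a) vs" by (induction vs) auto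
      moreover have "(\<Sum>x\<leftarrow>vs. size (ey (f a x)) + 1) \<le> (\<Sum>x\<leftarrow>vs. poly T (?M a) + 1)"
        by (intro sum_list_mono add_mono T' a) (auto simp: eq)
      moreover have "\<dots> \<le> ?B a" by (simp add: sum_list_triv eq algebra_simps)
      ultimately show ?thesis by (simp add: size_enc_list comp_def)
    qed
  qed (simp add: polytime_Tip)
  moreover have "foldr (\<lambda>x s. f a x # s) xs [] = map (f a) xs" for a xs by (induction xs) auto
  ultimately show ?thesis by simp
qed

lemma polytime_filter:
  assumes xs: "polytime D e (\<lambda>a. enc_list ex (xs a))"
    and Q: "polytime {y. fst y \<in> D \<and> snd y \<in> set (xs (fst y))}
      (\<lambda>y. Bin (e (fst y)) (ex (snd y))) (\<lambda>y. enc_bool (Q (fst y) (snd y)))"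
  shows "polytime D e (\<lambda>a. enc_list ex (filter (Q a) (xs a)))"
proof -
  let ?g = "\<lambda>a x s. if Q a x then x # s else s"
  have *: "foldr (?g a) xs [] = filter (Q a) xs" for a xs by (induction xs) auto
  have "polytime D e (\<lambda>a. enc_list ex (foldr (?g a) (xs a) []))"
  proof (rule polytime_foldr[OF xs, where B = "\<lambda>a. size (enc_list ex (xs a))"])
    show "poly_bounded D e (\<lambda>a. size (enc_list ex (xs a)))" by (rule poly_bounded_polytime[OF xs])
    show "polytime {y. fst y \<in> D \<and> (\<exists>us vs. xs (fst y) = us @ fst (snd y) # vs \<and>
                snd (snd y) = foldr (?g (fst y)) vs [])}
           (\<lambda>y. Bin (e (fst y)) (Bin (ex (fst (snd y))) (enc_list ex (snd (snd y)))))
           (\<lambda>y. enc_list ex (?g (fst y) (fst (snd y)) (snd (snd y))))" (is "polytime ?D ?e _")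
      unfolding enc_list.simps if_distrib[of "enc_list ex"]
    proof (rule polytime_if)
      have "polytime ?D ?e (\<lambda>y. Bin (e (fst y)) (ex (fst (snd y))))"
        by (rule polytime_Bin[OF polytime_outer[OF polytime_input[of D]] polytime_inner1]) simp
      then show "polytime ?D ?e (\<lambda>y. enc_bool (Q (fst y) (fst (snd y))))"
        by (rule polytime_comp[OF _ Q, where h = "\<lambda>y. (fst y, fst (snd y))", unfolded fst_conv snd_conv]) auto
    qed (intro polytime_Bin polytime_inner1 polytime_inner2)+
    show "size (enc_list ex (foldr (?g a) vs [])) \<le> size (enc_list ex (xs a))"
      if "a \<in> D" "xs a = us @ vs" for a us vs
      unfolding * that(2) size_enc_list by (induction vs) auto
  qed (simp add: polytime_Tip)
  then show ?thesis by (simp add: *)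
qed

lemma polytime_concat:
  assumes xs: "polytime D e (\<lambda>a. enc_list (enc_list ex) (xs a))"
  shows "polytime D e (\<lambda>a. enc_list ex (concat (xs a)))"
proof -
  have "polytime D e (\<lambda>a. enc_list ex (foldr append (xs a) []))"
  proof (rule polytime_foldr[OF xs, where B = "\<lambda>a. size (enc_list (enc_list ex) (xs a))"])
    show "poly_bounded D e (\<lambda>a. size (enc_list (enc_list ex) (xs a)))" by (rule poly_bounded_polytime[OF xs])
    show "size (enc_list ex (foldr (@) vs [])) \<le> size (enc_list (enc_list ex) (xs a))"
      if "a \<in> D" "xs a = us @ vs" for a us vs
      unfolding that(2) by (induction vs) (auto simp: size_enc_list)
  qed (simp, rule polytime_Tip, intro polytime_append polytime_inner1 polytime_inner2)
  then show ?thesis by (simp add: concat_conv_foldr)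
qed

section \<open>Unary arithmetic, numbers being lists of units\<close>

lemma enc_nat_eq_enc_list: "enc_nat n = enc_list (\<lambda>_. Tip) (replicate n ())"
  by (induction n) auto

lemma polytime_replicate:
  assumes "polytime D e (\<lambda>a. enc_nat (n a))" "polytime D e (\<lambda>a. ex (x a))"
  shows "polytime D e (\<lambda>a. enc_list ex (replicate (n a) (x a)))"
proof -
  have "polytime D e (\<lambda>a. enc_list ex (map (\<lambda>_. x a) (replicate (n a) ())))"
    by (rule polytime_map[where ex = "\<lambda>_. Tip"])
      (use assms(1) in \<open>auto simp: enc_nat_eq_enc_list intro: polytime_outer[OF assms(2)]\<close>)
  then show ?thesis by (simp add: map_replicate_const)
qed

lemma polytime_length:
  assumes "polytime D e (\<lambda>a. enc_list ex (xs a))"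
  shows "polytime D e (\<lambda>a. enc_nat (length (xs a)))"
proof -
  have "polytime D e (\<lambda>a. enc_list (\<lambda>_. Tip) (map (\<lambda>_. ()) (xs a)))"
    by (rule polytime_map[OF assms]) (rule polytime_Tip)
  then show ?thesis by (simp add: map_replicate_const enc_nat_eq_enc_list)
qed

lemma polytime_funpow:
  assumes n: "polytime D e (\<lambda>a. enc_nat (n a))" and z: "polytime D e (\<lambda>a. ez (z a))"
    and step: "polytime {y. fst y \<in> D \<and> (\<exists>i < n (fst y). snd y = (g (fst y) ^^ i) (z (fst y)))}
                 (\<lambda>y. Bin (e (fst y)) (ez (snd y))) (\<lambda>y. ez (g (fst y) (snd y)))"
    and B: "poly_bounded D e B" "\<And>a i. a \<in> D \<Longrightarrow> i \<le> n a \<Longrightarrow> size (ez ((g a ^^ i) (z a))) \<le> B a"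
  shows "polytime D e (\<lambda>a. ez ((g a ^^ n a) (z a)))"
proof -
  have fold: "fold (\<lambda>_. g a) us s = (g a ^^ length us) s" for a s and us :: "unit list"
    by (induction us arbitrary: s) (auto simp: funpow_swap1)
  have "polytime D e (\<lambda>a. ez (fold (\<lambda>_. g a) (replicate (n a) ()) (z a)))"
  proof (rule polytime_fold[where ex = "\<lambda>_. Tip" and ez = ez and z = z and xs = "\<lambda>a. replicate (n a) ()",
        OF n[unfolded enc_nat_eq_enc_list] z _ B(1)])
    show "polytime {y. fst y \<in> D \<and> (\<exists>us vs. replicate (n (fst y)) () = us @ fst (snd y) # vs \<and>
             snd (snd y) = fold (\<lambda>_. g (fst y)) us (z (fst y)))}
           (\<lambda>y. Bin (e (fst y)) (Bin Tip (ez (snd (snd y))))) (\<lambda>y. ez (g (fst y) (snd (snd y))))"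
      (is "polytime ?D ?e _")
    proof (rule polytime_comp[OF _ step, where h = "\<lambda>y. (fst y, snd (snd y))", unfolded fst_conv snd_conv])
      show "polytime ?D ?e (\<lambda>y. Bin (e (fst y)) (ez (snd (snd y))))"
        by (rule polytime_Bin[OF polytime_outer[OF polytime_input[of D]] polytime_inner2]) simp
      fix y assume "y \<in> ?D"
      then obtain us vs where y: "fst y \<in> D" "replicate (n (fst y)) () = us @ fst (snd y) # vs"
        "snd (snd y) = fold (\<lambda>_. g (fst y)) us (z (fst y))" by blast
      have "length us < n (fst y)" using arg_cong[OF y(2), of length] by simp
      then show "(fst y, snd (snd y)) \<in> {y. fst y \<in> D \<and> (\<exists>i < n (fst y). snd y = (g (fst y) ^^ i) (z (fst y)))}"
        using y by (auto simp: fold)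
    qed simp
    show "size (ez (fold (\<lambda>_. g a) us (z a))) \<le> B a" if "a \<in> D" "replicate (n a) () = us @ vs" for a us vs
    proof -
      have "length us \<le> n a" using arg_cong[OF that(2), of length] by simp
      then show ?thesis unfolding fold by (rule B(2)[OF that(1)])
    qed
  qed
  then show ?thesis by (simp add: fold)
qed

lemma funpow_tl: "(tl ^^ n) xs = drop n xs"
  by (induction n arbitrary: xs) (auto simp: drop_Suc tl_drop)

lemma tail_enc_list: "tail (enc_list ex xs) = enc_list ex (tl xs)"
  by (cases xs) auto

lemma polytime_drop:
  assumes n: "polytime D e (\<lambda>a. enc_nat (n a))" and xs: "polytime D e (\<lambda>a. enc_list ex (xs a))"
  shows "polytime D e (\<lambda>a. enc_list ex (drop (n a) (xs a)))"
proof -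
  have "polytime D e (\<lambda>a. enc_list ex ((tl ^^ n a) (xs a)))"
  proof (rule polytime_funpow[where ez = "enc_list ex" and z = xs and B = "\<lambda>a. size (enc_list ex (xs a))", OF n xs])
    show "polytime {y. fst y \<in> D \<and> (\<exists>i < n (fst y). snd y = (tl ^^ i) (xs (fst y)))}
                 (\<lambda>y. Bin (e (fst y)) (enc_list ex (snd y))) (\<lambda>y. enc_list ex (tl (snd y)))"
      unfolding tail_enc_list[symmetric] by (rule polytime_tail[OF polytime_inner])
    show "poly_bounded D e (\<lambda>a. size (enc_list ex (xs a)))" by (rule poly_bounded_polytime[OF xs])
  qed (simp add: funpow_tl size_enc_list_drop_le)
  then show ?thesis by (simp add: funpow_tl)
qed

lemma polytime_diff:
  assumes "polytime D e (\<lambda>a. enc_nat (m a))" "polytime D e (\<lambda>a. enc_nat (n a))"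
  shows "polytime D e (\<lambda>a. enc_nat (m a - n a))"
  using polytime_drop[OF assms(2) assms(1)[unfolded enc_nat_eq_enc_list]]
  by (simp add: enc_nat_eq_enc_list)

lemma polytime_take:
  assumes n: "polytime D e (\<lambda>a. enc_nat (n a))" and xs: "polytime D e (\<lambda>a. enc_list ex (xs a))"
  shows "polytime D e (\<lambda>a. enc_list ex (take (n a) (xs a)))"
proof -
  have "polytime D e (\<lambda>a. enc_list ex (rev (drop (length (xs a) - n a) (rev (xs a)))))"
    by (intro polytime_rev polytime_drop polytime_diff polytime_length[OF xs] n xs)
  moreover have "take (length ys - (length ys - m)) ys = take m ys" for m and ys :: "'b list"
    by (cases "m \<le> length ys") auto
  ultimately show ?thesis by (simp add: rev_drop)
qed

lemma head_enc_list: "xs \<noteq> [] \<Longrightarrow> head (enc_list ex xs) = ex (hd xs)"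
  by (cases xs) auto

lemma polytime_hd:
  assumes "polytime D e (\<lambda>a. enc_list ex (xs a))" "\<And>a. a \<in> D \<Longrightarrow> xs a \<noteq> []"
  shows "polytime D e (\<lambda>a. ex (hd (xs a)))"
  by (rule polytime_cong[OF polytime_head[OF assms(1)]]) (simp add: head_enc_list assms(2))

lemma polytime_nth:
  assumes "polytime D e (\<lambda>a. enc_nat (n a))" "polytime D e (\<lambda>a. enc_list ex (xs a))"
    and "\<And>a. a \<in> D \<Longrightarrow> n a < length (xs a)"
  shows "polytime D e (\<lambda>a. ex (xs a ! n a))"
proof -
  have "polytime D e (\<lambda>a. ex (hd (drop (n a) (xs a))))"
    by (intro polytime_hd polytime_drop assms(1,2)) (use assms(3) in \<open>simp add: not_le\<close>)
  then show ?thesis by (rule polytime_cong) (simp add: assms(3) hd_drop_conv_nth)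
qed

lemma polytime_Suc:
  assumes "polytime D e (\<lambda>a. enc_nat (n a))"
  shows "polytime D e (\<lambda>a. enc_nat (Suc (n a)))"
  using polytime_Bin[OF polytime_Tip assms] by simp

lemma polytime_add:
  assumes "polytime D e (\<lambda>a. enc_nat (m a))" "polytime D e (\<lambda>a. enc_nat (n a))"
  shows "polytime D e (\<lambda>a. enc_nat (m a + n a))"
  using polytime_append[OF assms[unfolded enc_nat_eq_enc_list]]
  by (simp add: enc_nat_eq_enc_list replicate_add)

lemma polytime_mult:
  assumes "polytime D e (\<lambda>a. enc_nat (m a))" "polytime D e (\<lambda>a. enc_nat (n a))"
  shows "polytime D e (\<lambda>a. enc_nat (m a * n a))"
proof -
  have "polytime D e (\<lambda>a. enc_nat (length (concat (replicate (m a) (replicate (n a) ())))))"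
    by (intro polytime_length[where ex = "\<lambda>_. Tip"] polytime_concat polytime_replicate assms polytime_Tip)
  then show ?thesis by (simp add: length_concat map_replicate sum_list_replicate)
qed

lemma polytime_not:
  assumes "polytime D e (\<lambda>a. enc_bool (b a))"
  shows "polytime D e (\<lambda>a. enc_bool (\<not> b a))"
  by (rule polytime_cong[OF polytime_if[OF assms, of "\<lambda>_. Tip" "\<lambda>_. Bin Tip Tip"]])
    (auto intro: polytime_const)

lemma polytime_conj:
  assumes "polytime D e (\<lambda>a. enc_bool (b a))" "polytime {a\<in>D. b a} e (\<lambda>a. enc_bool (c a))"
  shows "polytime D e (\<lambda>a. enc_bool (b a \<and> c a))"
  by (rule polytime_cong[OF polytime_if[OF assms(1), of "\<lambda>a. enc_bool (c a)" "\<lambda>_. Tip"]])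
    (use assms(2) in \<open>auto intro: polytime_const\<close>)

lemma polytime_le:
  assumes "polytime D e (\<lambda>a. enc_nat (m a))" "polytime D e (\<lambda>a. enc_nat (n a))"
  shows "polytime D e (\<lambda>a. enc_bool (m a \<le> n a))"
proof (rule polytime_cong)
  show "polytime D e (\<lambda>a. if enc_nat (m a - n a) \<noteq> Tip then Tip else Bin Tip Tip)"
    by (intro polytime_cond polytime_diff assms polytime_const)
  show "(if enc_nat (m a - n a) \<noteq> Tip then Tip else Bin Tip Tip) = enc_bool (m a \<le> n a)" for a
    by (cases "m a \<le> n a"; cases "m a - n a") auto
qed

lemma polytime_eq_nat:
  assumes "polytime D e (\<lambda>a. enc_nat (m a))" "polytime D e (\<lambda>a. enc_nat (n a))"
  shows "polytime D e (\<lambda>a. enc_bool (m a = n a))"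
  unfolding order_eq_iff[of "m _"]
  by (intro polytime_conj polytime_le polytime_subset[OF assms(1)] polytime_subset[OF assms(2)]) auto

lemma funpow_Cons_length: "((\<lambda>s. length s # s) ^^ n) [] = rev [0..<n]"
  by (induction n) auto

lemma polytime_upt:
  assumes n: "polytime D e (\<lambda>a. enc_nat (n a))"
  shows "polytime D e (\<lambda>a. enc_list enc_nat [0..<n a])"
proof -
  have "polytime D e (\<lambda>a. enc_list enc_nat (((\<lambda>s. length s # s) ^^ n a) []))"
  proof (rule polytime_funpow[OF n, where B = "\<lambda>a. n a * (n a + 1)"])
    show "poly_bounded D e (\<lambda>a. n a * (n a + 1))"
      using poly_bounded_polytime[OF n] by (intro poly_bounded_intros) auto
    fix a i assume "i \<le> n a"
    have "(\<Sum>x\<leftarrow>rev [0..<i]. size (enc_nat x) + 1) \<le> (\<Sum>x\<leftarrow>rev [0..<i]. n a + 1)"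
      using \<open>i \<le> n a\<close> by (intro sum_list_mono) auto
    also have "\<dots> \<le> n a * (n a + 1)" using \<open>i \<le> n a\<close> by (simp add: sum_list_triv add_mono)
    finally show "size (enc_list enc_nat (((\<lambda>s. length s # s) ^^ i) [])) \<le> n a * (n a + 1)"
      by (simp add: funpow_Cons_length size_enc_list)
  qed (auto intro: polytime_Tip polytime_Bin polytime_length[OF polytime_inner] polytime_inner)
  from polytime_rev[OF this] show ?thesis by (simp add: funpow_Cons_length)
qed

definition enc_prod :: "('a \<Rightarrow> btree) \<Rightarrow> ('b \<Rightarrow> btree) \<Rightarrow> 'a \<times> 'b \<Rightarrow> btree" where
  "enc_prod f g p = Bin (f (fst p)) (g (snd p))"

lemma polytime_Pair:
  assumes "polytime D e (\<lambda>a. f (x a))" "polytime D e (\<lambda>a. g (y a))"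
  shows "polytime D e (\<lambda>a. enc_prod f g (x a, y a))"
  using polytime_Bin[OF assms] by (simp add: enc_prod_def)

lemma polytime_fst:
  assumes "polytime D e (\<lambda>a. enc_prod f g (x a))"
  shows "polytime D e (\<lambda>a. f (fst (x a)))"
  using polytime_head[OF assms] by (simp add: enc_prod_def)

lemma polytime_snd:
  assumes "polytime D e (\<lambda>a. enc_prod f g (x a))"
  shows "polytime D e (\<lambda>a. g (snd (x a)))"
  using polytime_tail[OF assms] by (simp add: enc_prod_def)

lemma zip_conv_map_nth:
  "zip xs ys = map (\<lambda>i. (xs ! i, ys ! i)) (take (length ys) [0..<length xs])"
  by (rule nth_equalityI) auto

lemma polytime_zip:
  assumes xs: "polytime D e (\<lambda>a. enc_list ex (xs a))" and ys: "polytime D e (\<lambda>a. enc_list ey (ys a))"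
  shows "polytime D e (\<lambda>a. enc_list (enc_prod ex ey) (zip (xs a) (ys a)))"
  unfolding zip_conv_map_nth
proof (rule polytime_map)
  show "polytime D e (\<lambda>a. enc_list enc_nat (take (length (ys a)) [0..<length (xs a)]))"
    by (intro polytime_take polytime_upt polytime_length[OF xs] polytime_length[OF ys])
  show "polytime {y. fst y \<in> D \<and> snd y \<in> set (take (length (ys (fst y))) [0..<length (xs (fst y))])}
     (\<lambda>y. Bin (e (fst y)) (enc_nat (snd y)))
     (\<lambda>y. enc_prod ex ey (xs (fst y) ! snd y, ys (fst y) ! snd y))"
    by (intro polytime_Pair polytime_nth polytime_inner polytime_outer[OF xs] polytime_outer[OF ys])
      (auto simp: in_set_conv_nth)
qed

section \<open>Functions with finitely many values\<close>

lemma polytime_eq_const: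
  "polytime D e f \<Longrightarrow> polytime D e (\<lambda>a. enc_bool (f a = c))"
proof (induction c arbitrary: D f)
  case Tip
  have "polytime D e (\<lambda>a. if f a \<noteq> Tip then Tip else Bin Tip Tip)"
    by (intro polytime_cond Tip polytime_const)
  then show ?case by (rule polytime_cong) auto
next
  case (Bin x y)
  have eq: "(f a = Bin x y) = (f a \<noteq> Tip \<and> head (f a) = x \<and> tail (f a) = y)" for a
    by (cases "f a") auto
  have sub: "polytime D' e f" if "D' \<subseteq> D" for D' using polytime_subset[OF Bin.prems that] .
  have nTip: "polytime D e (\<lambda>a. enc_bool (f a \<noteq> Tip))"
    by (rule polytime_cong[OF polytime_cond[OF Bin.prems polytime_const[of _ _ "Bin Tip Tip"] polytime_Tip]]) auto
  show ?case unfolding eq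
    by (intro polytime_conj nTip Bin.IH polytime_head polytime_tail sub) auto
qed

text \<open>A lookup table: \<open>f a\<close> is compared with each of its finitely many possible
  values in turn, and the answer is a constant. As \<open>g\<close> is arbitrary, this makes the
  predicates of any CSP available to programs.\<close>

lemma polytime_finite_range:
  assumes "polytime D e f" "finite (f ` D)"
  shows "polytime D e (\<lambda>a. g (f a))"
proof -
  have "finite S \<Longrightarrow> f ` D' \<subseteq> S \<Longrightarrow> D' \<subseteq> D \<Longrightarrow> polytime D' e (\<lambda>a. g (f a))" for S D'
  proof (induction S arbitrary: D' rule: finite_induct)
    case empty
    then show ?case by (simp add: polytime_def)
  next
    case (insert c S)
    have "polytime D' e (\<lambda>a. if f a = c then g c else g (f a))"
    proof (rule polytime_if)
      show "polytime D' e (\<lambda>a. enc_bool (f a = c))"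
        by (rule polytime_eq_const[OF polytime_subset[OF assms(1) insert.prems(2)]])
      show "polytime {a \<in> D'. f a \<noteq> c} e (\<lambda>a. g (f a))"
        using insert.prems by (intro insert.IH) auto
    qed (rule polytime_const)
    then show ?case by (rule polytime_cong) auto
  qed
  then show ?thesis using assms(2) by blast
qed

section \<open>The algorithms\<close>

definition slots :: "(nat \<times> 'v list) list \<Rightarrow> 'v list" where
  "slots cs = concat (map snd cs)"

text \<open>Together with \<open>slots\<close> this separates an instance into its shape (predicates
  and arities) and the flat list of the variables in its scopes; splitting variables then only
  transforms that list. The two type variables allow scopes to be refilled with lists as
  well.\<close>

fun relabel :: "(nat \<times> 'u list) list \<Rightarrow> 'v list \<Rightarrow> (nat \<times> 'v list) list" where
  "relabel [] xs = []"
| "relabel ((i, S) # cs) xs = (i, take (length S) xs) # relabel cs (drop (length S) xs)"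

text \<open>The padding makes the number of tuples \<open>M ^ k\<close> for lists of length \<open>M\<close>, whatever the arity.\<close>

fun padded_product :: "nat \<Rightarrow> nat \<Rightarrow> 'v list list \<Rightarrow> 'v list list" where
  "padded_product M 0 ls = [[]]"
| "padded_product M (Suc k) ls =
     (if ls = [] then concat (replicate M (padded_product M k []))
      else concat (map (\<lambda>x. map (Cons x) (padded_product M k (tl ls))) (hd ls)))"

text \<open>The number of binary digits, i.e. the least \<open>k\<close> with
  \<open>X < 2 ^ k\<close>; \<open>X\<close> rounds suffice because
  \<open>X < 2 ^ X\<close>.\<close>

definition ceil_log :: "nat \<Rightarrow> nat" where
  "ceil_log X = ((\<lambda>k. if 2 ^ k \<le> X then Suc k else k) ^^ X) 0"

definition same_var :: "nat list \<Rightarrow> nat \<Rightarrow> nat list \<Rightarrow> nat list" where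
  "same_var vs v ts = filter (\<lambda>t. vs ! t = v) ts"

text \<open>Moving the first \<open>t\<close> slots to the end starts the cyclic order at
  \<open>t\<close> itself; as \<open>t\<close> is among the slots of its own variable,
  \<open>L\<close> copies provide at least \<open>L\<close> entries.\<close>

definition chunk :: "nat \<Rightarrow> nat list \<Rightarrow> nat \<Rightarrow> nat list" where
  "chunk L vs t = take L (concat (replicate L
     (same_var vs (vs ! t) (drop t [0..<length vs] @ take t [0..<length vs]))))"

text \<open>
  \<open>out\<close> contains the slots further to the right with their bits. Counted from the right, the slots
  of a variable alternate between taking their own coin and negating the bit of their successor.
\<close>

definition split_step :: "nat \<times> bool \<Rightarrow> (nat \<times> bool) list \<Rightarrow> (nat \<times> bool) list" where
  "split_step p out = (fst p,
     if even (length (filter (\<lambda>r. fst r = fst p) out)) then snd p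
     else \<not> snd (hd (filter (\<lambda>r. fst r = fst p) out))) # out"

definition split_bits :: "(nat \<times> bool) list \<Rightarrow> (nat \<times> bool) list" where
  "split_bits ps = foldr split_step ps []"

definition halve :: "nat list \<Rightarrow> bool list \<Rightarrow> nat list" where
  "halve xs bs = map (\<lambda>p. 2 * fst p + (if snd p then 1 else 0)) (split_bits (zip xs bs))"

definition halve_state :: "nat list \<times> bool list \<Rightarrow> nat list \<times> bool list" where
  "halve_state s = (halve (fst s) (snd s), drop (length (fst s)) (snd s))"

definition halve_iter :: "nat \<Rightarrow> nat list \<Rightarrow> bool list \<Rightarrow> nat list" where
  "halve_iter s xs bs = fst ((halve_state ^^ s) (xs, bs))"

definition rep_constraints :: "csp_instance \<Rightarrow> (nat \<times> nat list) list" where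
  "rep_constraints F = concat (replicate (Suc (nvars F)) (constraints F))"

text \<open>Logarithm of the final degree, which for positive \<open>e\<close> lies between
  \<open>2 ^ c * e\<^sup>2\<close> and \<open>9 * 2 ^ c * e\<^sup>2\<close>.\<close>

definition log_deg :: "nat \<Rightarrow> nat \<Rightarrow> nat" where
  "log_deg c e = 2 * ceil_log e + c"

definition log_size :: "csp_instance \<Rightarrow> nat \<Rightarrow> nat" where
  "log_size F e = ceil_log (nvars F + length (constraints F) + e)"

text \<open>Logarithm of the chunk length \<open>L\<close>, which must outweigh the number of slots:
  the three copies of \<open>log_size\<close> pay for the number of variables plus one, the number
  of constraints and \<open>e\<close>, while \<open>log_deg\<close> pays for the constant
  \<open>2 * K * K\<close>.\<close>

definition log_blowup :: "nat \<Rightarrow> csp_instance \<Rightarrow> nat \<Rightarrow> nat" where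
  "log_blowup c F e = 3 * log_size F e + log_deg c e"

text \<open>This choice yields \<open>(2 ^ log_blowup c F e) ^ K = 2 ^ log_deg c e * 2 ^ levels K c F e\<close>.\<close>

definition levels :: "nat \<Rightarrow> nat \<Rightarrow> csp_instance \<Rightarrow> nat \<Rightarrow> nat" where
  "levels K c F e = 3 * log_size F e * K + log_deg c e * (K - 1)"

definition blowup :: "nat \<Rightarrow> nat \<Rightarrow> (nat \<times> nat list) list \<Rightarrow> (nat \<times> nat list) list" where
  "blowup L K cs = concat (map (\<lambda>p. map (Pair (fst p)) (padded_product L K (snd p)))
     (relabel cs (map (chunk L (slots cs)) [0..<length (slots cs)])))"

definition base :: "nat \<Rightarrow> nat \<Rightarrow> csp_instance \<Rightarrow> nat \<Rightarrow> (nat \<times> nat list) list" where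
  "base K c F e = blowup (2 ^ log_blowup c F e) K (rep_constraints F)"

definition num_coins :: "nat \<Rightarrow> nat \<Rightarrow> csp_instance \<Rightarrow> nat \<Rightarrow> nat" where
  "num_coins K c F e = levels K c F e * length (slots (base K c F e))"

definition regularized :: "nat \<Rightarrow> nat \<Rightarrow> csp_instance \<Rightarrow> nat \<Rightarrow> bool list \<Rightarrow> csp_instance" where
  "regularized K c F e bs =
     \<lparr>nvars = length (slots (rep_constraints F)) * 2 ^ levels K c F e,
      constraints = relabel (base K c F e) (halve_iter (levels K c F e) (slots (base K c F e)) bs)\<rparr>"

text \<open>A slot \<open>t\<close> ends up as \<open>N\<close> variables, numbered
  \<open>t * N\<close> to \<open>t * N + N - 1\<close>; their values under \<open>z\<close> form a
  block. The list of \<open>v\<close> joins the blocks of the first \<open>L\<close> slots of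
  \<open>v\<close> in cyclic order, counted from its first slot, so it does not depend on a
  particular occurrence. The default \<open>d\<close> gives variables without occurrences a list of
  the same length.\<close>

definition pool :: "nat \<Rightarrow> nat \<Rightarrow> nat list \<Rightarrow> 'v list \<Rightarrow> 'v \<Rightarrow> nat \<Rightarrow> 'v list" where
  "pool L N vs z d v = (if same_var vs v [0..<length vs] = [] then replicate (L * N) d
     else concat (map (\<lambda>t. take N (drop (t * N) z))
       (take L (concat (replicate L (same_var vs v [0..<length vs]))))))"

text \<open>The expected number of satisfied constraints, scaled by \<open>M ^ K\<close>: thanks to
  the padding every constraint has this denominator, and programs need only count and compare
  natural numbers.\<close>

definition score :: "csp \<Rightarrow> nat \<Rightarrow> nat \<Rightarrow> (nat \<times> nat list) list \<Rightarrow> nat list list \<Rightarrow> nat" where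
  "score \<Lambda> K M cs ls = length (concat (map (\<lambda>p. filter (holds (\<Lambda> ! fst p))
     (padded_product M K (map (\<lambda>v. ls ! v) (snd p)))) cs))"

text \<open>
  The list that is filtered always contains a suitable value; the default \<open>1\<close> is appended
  only to make the size of the result obvious.
\<close>

definition round_step :: "nat \<Rightarrow> csp \<Rightarrow> nat \<Rightarrow> nat \<Rightarrow> (nat \<times> nat list) list \<Rightarrow> nat \<Rightarrow> nat list list \<Rightarrow> nat list list" where
  "round_step q \<Lambda> K M cs v ls = take v ls @ replicate M (hd (filter
     (\<lambda>a. score \<Lambda> K M cs ls \<le> score \<Lambda> K M cs (take v ls @ replicate M a # drop (Suc v) ls))
     [1..<Suc q] @ [1])) # drop (Suc v) ls"

definition recovered :: "nat \<Rightarrow> csp \<Rightarrow> nat \<Rightarrow> nat \<Rightarrow> csp_instance \<Rightarrow> nat \<Rightarrow> nat list \<Rightarrow> nat list" where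
  "recovered q \<Lambda> K c F e z =
     (let L = 2 ^ log_blowup c F e; N = 2 ^ levels K c F e; vs = slots (rep_constraints F) in
      map hd (fold (round_step q \<Lambda> K (L * N) (constraints F)) [0..<nvars F]
        (map (pool L N vs z 1) [0..<nvars F])))"

section \<open>Running time of the algorithms\<close>

lemma polytime_pow2:
  assumes n: "polytime D e (\<lambda>a. enc_nat (n a))" and B: "poly_bounded D e (\<lambda>a. 2 ^ n a)"
  shows "polytime D e (\<lambda>a. enc_nat (2 ^ n a))"
proof -
  have *: "((\<lambda>m. m + m) ^^ k) 1 = (2 :: nat) ^ k" for k by (induction k) auto
  have "polytime D e (\<lambda>a. enc_nat (((\<lambda>m. m + m) ^^ n a) 1))"
  proof (rule polytime_funpow[OF n _ _ B])
    show "size (enc_nat (((\<lambda>m. m + m) ^^ i) 1)) \<le> 2 ^ n a" if "i \<le> n a" for a i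
      using that unfolding * by (simp add: power_increasing)
  qed (intro polytime_const polytime_add polytime_inner)+
  then show ?thesis by (simp only: *)
qed

text \<open>Invariants of the search: the exponent grows only while \<open>2 ^ k \<le> X\<close>, so
  it overshoots by at most a factor two; and it either grew in each of the \<open>i\<close> rounds
  or has already passed \<open>X\<close>.\<close>

lemma ceil_log_iterate:
  fixes X i :: nat
  defines "k \<equiv> ((\<lambda>k. if 2 ^ k \<le> X then Suc k else k) ^^ i) 0"
  shows "(k = 0 \<or> 2 ^ k \<le> 2 * X) \<and> (i \<le> k \<or> X < 2 ^ k)"
  unfolding k_def by (induction i) (auto simp: not_le)

lemma less_pow_ceil_log: "X < 2 ^ ceil_log X"
proof -
  have "X \<le> ceil_log X \<or> X < 2 ^ ceil_log X"
    using ceil_log_iterate[where i = X] unfolding ceil_log_def by auto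
  moreover have "ceil_log X < 2 ^ ceil_log X" by (rule less_exp)
  ultimately show ?thesis by linarith
qed

lemma pow_ceil_log_le: "2 ^ ceil_log X \<le> 2 * X + 1"
  using ceil_log_iterate[where i = X and X = X] unfolding ceil_log_def by auto

lemma polytime_ceil_log:
  assumes X: "polytime D e (\<lambda>a. enc_nat (X a))"
  shows "polytime D e (\<lambda>a. enc_nat (ceil_log (X a)))"
  unfolding ceil_log_def
proof (rule polytime_funpow[OF X, where B = "\<lambda>a. 2 * X a + 1"])
  let ?g = "\<lambda>a k. if 2 ^ k \<le> X a then Suc k else k"
  have le: "2 ^ (?g a ^^ i) 0 \<le> 2 * X a + 1" for a i
    using ceil_log_iterate[where i = i and X = "X a"] by auto
  have X': "poly_bounded D e X" using poly_bounded_polytime[OF X] by simp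
  then show "poly_bounded D e (\<lambda>a. 2 * X a + 1)" by (intro poly_bounded_intros)
  show "size (enc_nat ((?g a ^^ i) 0)) \<le> 2 * X a + 1" for a i
    unfolding size_enc_nat by (rule order.trans[OF less_imp_le[OF less_exp] le])
  show "polytime {y. fst y \<in> D \<and> (\<exists>i<X (fst y). snd y = (?g (fst y) ^^ i) 0)}
     (\<lambda>y. Bin (e (fst y)) (enc_nat (snd y))) (\<lambda>y. enc_nat (?g (fst y) (snd y)))"
    (is "polytime ?D ?e _")
  proof -
    have X1: "polytime ?D ?e (\<lambda>y. enc_nat (X (fst y)))" by (rule polytime_outer[OF X]) auto
    have "poly_bounded ?D ?e (\<lambda>y. 2 ^ snd y)"
    proof (rule poly_bounded_mono)
      show "poly_bounded ?D ?e (\<lambda>y. 2 * X (fst y) + 1)"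
        using poly_bounded_polytime[OF X1] by (intro poly_bounded_intros) simp
      show "2 ^ snd y \<le> 2 * X (fst y) + 1" if "y \<in> ?D" for y using that le by auto
    qed
    then show ?thesis unfolding if_distrib[of enc_nat]
      by (intro polytime_if polytime_le polytime_pow2 polytime_inner X1 polytime_Suc)
  qed
qed (rule polytime_const)

text \<open>The scope of the constraint at position \<open>r\<close> begins after the slots of the
  earlier constraints; this turns the recursion on two lists into a \<open>map\<close>, for which a
  program is at hand.\<close>

lemma relabel_conv_map:
  "relabel cs xs = map (\<lambda>r. (fst (cs ! r), take (length (snd (cs ! r))) (drop (length (slots (take r cs))) xs)))
     [0..<length cs]"
proof (induction cs xs rule: relabel.induct)
  case (2 i S cs xs)
  show ?case unfolding relabel.simps 2
    by (simp add: upt_conv_Cons slots_def map_Suc_upt[symmetric] comp_def add.commute del: upt_Suc)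
qed simp

lemma polytime_slots:
  assumes "polytime D e (\<lambda>a. enc_list (enc_prod ei (enc_list ev)) (cs a))"
  shows "polytime D e (\<lambda>a. enc_list ev (slots (cs a)))"
  unfolding slots_def
  by (intro polytime_concat polytime_map[OF assms] polytime_snd[OF polytime_inner])

lemma polytime_relabel:
  assumes cs: "polytime D e (\<lambda>a. enc_list (enc_prod enc_nat (enc_list eu)) (cs a))"
    and xs: "polytime D e (\<lambda>a. enc_list ev (xs a))"
  shows "polytime D e (\<lambda>a. enc_list (enc_prod enc_nat (enc_list ev)) (relabel (cs a) (xs a)))"
  unfolding relabel_conv_map
proof (rule polytime_map)
  show "polytime D e (\<lambda>a. enc_list enc_nat [0..<length (cs a)])"
    by (intro polytime_upt polytime_length[OF cs])
  let ?D = "{y. fst y \<in> D \<and> snd y \<in> set [0..<length (cs (fst y))]}"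
  let ?e = "\<lambda>y. Bin (e (fst y)) (enc_nat (snd y))"
  have cs': "polytime ?D ?e (\<lambda>y. enc_list (enc_prod enc_nat (enc_list eu)) (cs (fst y)))"
    by (rule polytime_outer[OF cs]) auto
  have xs': "polytime ?D ?e (\<lambda>y. enc_list ev (xs (fst y)))" by (rule polytime_outer[OF xs]) auto
  have nth: "polytime ?D ?e (\<lambda>y. enc_prod enc_nat (enc_list eu) (cs (fst y) ! snd y))"
    by (rule polytime_nth[OF polytime_inner cs']) auto
  show "polytime ?D ?e (\<lambda>y. enc_prod enc_nat (enc_list ev) (fst (cs (fst y) ! snd y),
      take (length (snd (cs (fst y) ! snd y))) (drop (length (slots (take (snd y) (cs (fst y))))) (xs (fst y)))))"
    by (intro polytime_Pair polytime_take polytime_drop polytime_fst[OF nth] polytime_length[OF polytime_snd[OF nth]]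
        polytime_length[OF polytime_slots[OF polytime_take[OF polytime_inner cs']]] xs')
qed

text \<open>The recursion on \<open>k\<close> is unrolled into nested programs, so the degree of the
  polynomial depends on \<open>k\<close>. This is harmless for the arity bound, a constant of the
  CSP.\<close>

lemma polytime_padded_product:
  assumes M: "polytime D e (\<lambda>a. enc_nat (M a))" and "polytime D e (\<lambda>a. enc_list (enc_list ex) (ls a))"
  shows "polytime D e (\<lambda>a. enc_list (enc_list ex) (padded_product (M a) k (ls a)))"
  using assms
proof (induction k arbitrary: D ls)
  case 0
  then show ?case by (simp add: polytime_const)
next
  case (Suc k)
  have tl: "polytime D' e (\<lambda>a. enc_list (enc_list ex) (tl (ls a)))" if "D' \<subseteq> D" for D'
    using polytime_tail[OF polytime_subset[OF Suc.prems(2) that]] by (simp add: tail_enc_list)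
  have M: "polytime D' e (\<lambda>a. enc_nat (M a))" if "D' \<subseteq> D" for D'
    using polytime_subset[OF Suc.prems(1) that] .
  have null: "polytime D e (\<lambda>a. enc_bool (ls a = []))"
  proof (rule polytime_cong[OF polytime_eq_const[OF Suc.prems(2), of Tip]])
    show "enc_bool (enc_list (enc_list ex) (ls a) = Tip) = enc_bool (ls a = [])" for a
      by (cases "ls a") auto
  qed
  show ?case unfolding padded_product.simps if_distrib[of "enc_list (enc_list ex)"]
  proof (rule polytime_if[OF null])
    have "polytime {a \<in> D. ls a = []} e (\<lambda>a. enc_list (enc_list ex) (padded_product (M a) k []))"
      by (rule Suc.IH) (auto intro: M polytime_const)
    then show "polytime {a \<in> D. ls a = []} e
       (\<lambda>a. enc_list (enc_list ex) (concat (replicate (M a) (padded_product (M a) k []))))"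
      by (intro polytime_concat polytime_replicate M) auto
    let ?D = "{a \<in> D. ls a \<noteq> []}"
    have P: "polytime ?D e (\<lambda>a. enc_list (enc_list ex) (padded_product (M a) k (tl (ls a))))"
      by (rule Suc.IH) (auto intro: M tl)
    have hd: "polytime ?D e (\<lambda>a. enc_list ex (hd (ls a)))"
      by (rule polytime_hd[OF polytime_subset[OF Suc.prems(2)]]) auto
    have "polytime ?D e (\<lambda>a. enc_list (enc_list (enc_list ex))
            (map (\<lambda>x. map ((#) x) (padded_product (M a) k (tl (ls a)))) (hd (ls a))))"
    proof (rule polytime_map[OF hd], rule polytime_map)
      show "polytime {y. fst y \<in> ?D \<and> snd y \<in> set (hd (ls (fst y)))} (\<lambda>y. Bin (e (fst y)) (ex (snd y)))
          (\<lambda>y. enc_list (enc_list ex) (padded_product (M (fst y)) k (tl (ls (fst y)))))"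
        by (rule polytime_outer[OF P]) auto
    qed (auto intro!: polytime_Bin polytime_inner polytime_outer[OF polytime_inner])
    then show "polytime ?D e (\<lambda>a. enc_list (enc_list ex)
            (concat (map (\<lambda>x. map ((#) x) (padded_product (M a) k (tl (ls a)))) (hd (ls a)))))"
      by (rule polytime_concat)
  qed
qed

lemma polytime_same_var:
  assumes "polytime D e (\<lambda>a. enc_list enc_nat (vs a))" "polytime D e (\<lambda>a. enc_nat (v a))"
    "polytime D e (\<lambda>a. enc_list enc_nat (ts a))" "\<And>a. a \<in> D \<Longrightarrow> set (ts a) \<subseteq> {..<length (vs a)}"
  shows "polytime D e (\<lambda>a. enc_list enc_nat (same_var (vs a) (v a) (ts a)))"
  unfolding same_var_def
  by (intro polytime_filter assms(3) polytime_eq_nat polytime_nth polytime_inner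
      polytime_outer[OF assms(1)] polytime_outer[OF assms(2)]) (use assms(4) in auto)

lemma polytime_chunk:
  assumes "polytime D e (\<lambda>a. enc_nat (L a))" "polytime D e (\<lambda>a. enc_list enc_nat (vs a))"
    "polytime D e (\<lambda>a. enc_nat (t a))" "\<And>a. a \<in> D \<Longrightarrow> t a < length (vs a)"
  shows "polytime D e (\<lambda>a. enc_list enc_nat (chunk (L a) (vs a) (t a)))"
  unfolding chunk_def
  by (intro polytime_take polytime_concat polytime_replicate polytime_same_var polytime_append
      polytime_drop polytime_upt polytime_length[OF assms(2)] polytime_nth assms)
    (auto dest: in_set_takeD in_set_dropD)

lemma polytime_even_length:
  assumes xs: "polytime D e (\<lambda>a. enc_list ex (xs a))"
  shows "polytime D e (\<lambda>a. enc_bool (even (length (xs a))))"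
proof -
  have *: "(Not ^^ n) True = even n" for n by (induction n) auto
  have "polytime D e (\<lambda>a. enc_bool ((Not ^^ length (xs a)) True))"
  proof (rule polytime_funpow[OF polytime_length[OF xs], where B = "\<lambda>_. 1"])
    show "size (enc_bool ((Not ^^ i) True)) \<le> 1" for i by (cases "(Not ^^ i) True") auto
  qed (intro polytime_const polytime_not polytime_inner poly_bounded_const)+
  then show ?thesis by (simp add: *)
qed

lemma map_fst_split_bits: "map fst (split_bits ps) = map fst ps"
  unfolding split_bits_def by (induction ps) (auto simp: split_step_def)

lemma size_enc_bool_le: "size (enc_bool b) \<le> 1"
  by (cases b) auto

lemma polytime_split_bits:
  assumes ps: "polytime D e (\<lambda>a. enc_list (enc_prod enc_nat enc_bool) (ps a))"
  shows "polytime D e (\<lambda>a. enc_list (enc_prod enc_nat enc_bool) (split_bits (ps a)))"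
  unfolding split_bits_def
proof (rule polytime_foldr[OF ps, where B = "\<lambda>a. 2 * size (enc_list (enc_prod enc_nat enc_bool) (ps a))"])
  let ?p = "enc_prod enc_nat enc_bool"
  show "poly_bounded D e (\<lambda>a. 2 * size (enc_list ?p (ps a)))"
    by (intro poly_bounded_intros poly_bounded_polytime[OF ps])
  show "size (enc_list ?p (foldr split_step vs [])) \<le> 2 * size (enc_list ?p (ps a))"
    if "ps a = us @ vs" for a us vs
  proof -
    \<comment> \<open>Splitting changes the bits only; sizes before and after are compared through
      the unchanged first components.\<close>
    have le: "size (enc_list ?p qs) \<le> (\<Sum>x\<leftarrow>map fst qs. x + 3)" "(\<Sum>x\<leftarrow>map fst qs. x + 3) \<le> 2 * size (enc_list ?p qs)"
      for qs :: "(nat \<times> bool) list"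
    proof (induction qs)
      case (Cons p qs)
      case 1 then show ?case using Cons.IH(1) size_enc_bool_le[of "snd p"] by (simp add: enc_prod_def)
      case 2 then show ?case using Cons.IH(2) by (simp add: enc_prod_def)
    qed auto
    have "size (enc_list ?p (split_bits vs)) \<le> (\<Sum>x\<leftarrow>map fst vs. x + 3)"
      using le(1)[of "split_bits vs"] by (simp only: map_fst_split_bits)
    also have "\<dots> \<le> 2 * size (enc_list ?p vs)" by (rule le(2))
    also have "\<dots> \<le> 2 * size (enc_list ?p (ps a))" unfolding that by (simp add: size_enc_list)
    finally show ?thesis by (simp add: split_bits_def)
  qed
  let ?D = "{y. fst y \<in> D \<and> (\<exists>us vs. ps (fst y) = us @ fst (snd y) # vs \<and> snd (snd y) = foldr split_step vs [])}"
  let ?e = "\<lambda>y. Bin (e (fst y)) (Bin (?p (fst (snd y))) (enc_list ?p (snd (snd y))))"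
  let ?f = "\<lambda>y. filter (\<lambda>r. fst r = fst (fst (snd y))) (snd (snd y))"
  have F: "polytime D' ?e (\<lambda>y. enc_list ?p (?f y))" for D'
    by (rule polytime_filter[OF polytime_inner2])
      (intro polytime_eq_nat polytime_fst[OF polytime_inner] polytime_fst[OF polytime_outer[OF polytime_inner1]], auto)
  have null: "xs = [] \<Longrightarrow> even (length xs)" for xs :: "(nat \<times> bool) list" by simp
  have "polytime D' ?e (\<lambda>y. enc_list ?p (split_step (fst (snd y)) (snd (snd y))))" for D'
    unfolding split_step_def enc_list.simps
    by (rule polytime_Bin[OF polytime_Pair polytime_inner2], rule polytime_fst[OF polytime_inner1],
        unfold if_distrib[of enc_bool],
        intro polytime_if polytime_even_length[OF F] polytime_snd[OF polytime_inner1] polytime_not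
          polytime_snd[OF polytime_hd[OF F]])
      (use null in auto)
  then show "polytime ?D ?e (\<lambda>y. enc_list ?p (split_step (fst (snd y)) (snd (snd y))))" .
qed (simp add: polytime_Tip)

lemma polytime_halve:
  assumes "polytime D e (\<lambda>a. enc_list enc_nat (xs a))" "polytime D e (\<lambda>a. enc_list enc_bool (bs a))"
  shows "polytime D e (\<lambda>a. enc_list enc_nat (halve (xs a) (bs a)))"
proof -
  have "polytime D' (\<lambda>y. Bin (l y) (enc_prod enc_nat enc_bool (r y))) (\<lambda>y. enc_nat (2 * fst (r y) + (if snd (r y) then 1 else 0)))"
    for D' and l :: "'b \<Rightarrow> btree" and r
    by (intro polytime_add polytime_mult polytime_const polytime_fst[OF polytime_inner],
        unfold if_distrib[of enc_nat], intro polytime_if polytime_const polytime_snd[OF polytime_inner])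
  then show ?thesis unfolding halve_def
    by (intro polytime_map[OF polytime_split_bits[OF polytime_zip[OF assms]]])
qed

lemma length_halve [simp]: "length (halve xs bs) = min (length xs) (length bs)"
  using arg_cong[OF map_fst_split_bits[of "zip xs bs"], of length] by (simp add: halve_def)

lemma halve_less:
  assumes "\<forall>x\<in>set xs. x < N" "y \<in> set (halve xs bs)"
  shows "y < 2 * N"
proof -
  from assms(2) obtain p where p: "p \<in> set (split_bits (zip xs bs))" "y = 2 * fst p + (if snd p then 1 else 0)"
    unfolding halve_def by auto
  have "fst p \<in> set (map fst (zip xs bs))" using p(1) map_fst_split_bits[of "zip xs bs"]
    by (metis image_eqI list.set_map)
  then have "fst p < N" using assms(1) by (auto dest: set_zip_leftD)
  then show ?thesis using p(2) by auto
qed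

lemma halve_state_iterate:
  fixes xs :: "nat list" and bs :: "bool list"
  assumes "\<forall>x\<in>set xs. x < N"
  defines "st \<equiv> \<lambda>i. (halve_state ^^ i) (xs, bs)"
  shows "length (fst (st i)) \<le> length xs \<and> (\<forall>x\<in>set (fst (st i)). x < 2 ^ i * N) \<and> (\<exists>k. snd (st i) = drop k bs)"
proof (induction i)
  case 0
  then show ?case using assms by (auto intro: exI[of _ 0])
next
  case (Suc i)
  have "y < 2 * (2 ^ i * N)" if "y \<in> set (halve (fst (st i)) (snd (st i)))" for y
    using Suc.IH halve_less that by blast
  then show ?case using Suc.IH by (auto simp: st_def halve_state_def mult.assoc)
qed

text \<open>Numbers are unary and may double at every level, hence the polynomial bound demanded for
  \<open>2 ^ s a\<close>.\<close>

lemma polytime_halve_iter: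
  assumes s: "polytime D e (\<lambda>a. enc_nat (s a))" and xs: "polytime D e (\<lambda>a. enc_list enc_nat (xs a))"
    and bs: "polytime D e (\<lambda>a. enc_list enc_bool (bs a))"
    and N: "poly_bounded D e N" "\<And>a. a \<in> D \<Longrightarrow> \<forall>x\<in>set (xs a). x < N a" and B: "poly_bounded D e (\<lambda>a. 2 ^ s a)"
  shows "polytime D e (\<lambda>a. enc_list enc_nat (halve_iter (s a) (xs a) (bs a)))"
proof -
  let ?p = "enc_prod (enc_list enc_nat) (enc_list enc_bool)"
  let ?B = "\<lambda>a. size (enc_list enc_nat (xs a)) * (2 ^ s a * N a + 1) + size (enc_list enc_bool (bs a)) + 1"
  have "polytime D e (\<lambda>a. ?p ((halve_state ^^ s a) (xs a, bs a)))"
  proof (rule polytime_funpow[where ez = ?p and z = "\<lambda>a. (xs a, bs a)" and B = ?B, OF s])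
    show "polytime D e (\<lambda>a. ?p (xs a, bs a))" by (intro polytime_Pair xs bs)
    show "poly_bounded D e ?B"
      by (intro poly_bounded_intros poly_bounded_polytime[OF xs] poly_bounded_polytime[OF bs] N(1) B)
    show "polytime {y. fst y \<in> D \<and> (\<exists>i<s (fst y). snd y = (halve_state ^^ i) (xs (fst y), bs (fst y)))}
        (\<lambda>y. Bin (e (fst y)) (?p (snd y))) (\<lambda>y. ?p (halve_state (snd y)))"
      unfolding halve_state_def
      by (intro polytime_Pair polytime_halve polytime_drop polytime_length[OF polytime_fst[OF polytime_inner]]
            polytime_fst[OF polytime_inner] polytime_snd[OF polytime_inner])
    fix a i assume a: "a \<in> D" and i: "i \<le> s a"
    let ?st = "(halve_state ^^ i) (xs a, bs a)"
    from halve_state_iterate[OF N(2)[OF a]] obtain k where st: "length (fst ?st) \<le> length (xs a)"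
      "\<forall>x\<in>set (fst ?st). x < 2 ^ i * N a" "snd ?st = drop k (bs a)" by blast
    have "size (enc_list enc_nat (fst ?st)) \<le> (\<Sum>x\<leftarrow>fst ?st. 2 ^ i * N a + 1)"
      using st(2) unfolding size_enc_list by (intro sum_list_mono) (auto intro: less_imp_le)
    also have "\<dots> = length (fst ?st) * (2 ^ i * N a + 1)" by (simp add: sum_list_triv)
    also have "\<dots> \<le> size (enc_list enc_nat (xs a)) * (2 ^ s a * N a + 1)"
      using st(1) length_le_size_enc_list[of "xs a" enc_nat] i
      by (intro mult_mono add_mono power_increasing) auto
    finally show "size (?p ?st) \<le> ?B a"
      using size_enc_list_drop_le[of enc_bool k "bs a"] st(3) by (simp add: enc_prod_def)
  qed
  from polytime_fst[OF this] show ?thesis by (simp add: halve_iter_def)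
qed

section \<open>The regularizing algorithm\<close>

lemma enc_instance_conv:
  "enc_instance F = Bin (enc_nat (nvars F)) (enc_list (enc_prod enc_nat (enc_list enc_nat)) (constraints F))"
proof -
  have "(\<lambda>(i, S). Bin (enc_nat i) (enc_list enc_nat S)) = enc_prod enc_nat (enc_list enc_nat)"
    by (rule ext) (simp add: enc_prod_def case_prod_beta)
  then show ?thesis by (simp add: enc_instance_def)
qed

lemma set_relabel: "(i, S) \<in> set (relabel cs xs) \<Longrightarrow> set S \<subseteq> set xs"
  by (induction cs xs rule: relabel.induct) (auto dest: in_set_takeD in_set_dropD)

lemma padded_product_memD:
  "tp \<in> set (padded_product M k ls) \<Longrightarrow> x \<in> set tp \<Longrightarrow> \<exists>l\<in>set ls. x \<in> set l"
proof (induction k arbitrary: ls tp)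
  case (Suc k)
  show ?case
  proof (cases ls)
    case Nil
    then have "tp \<in> set (padded_product M k [])" using Suc.prems(1) by (auto split: if_splits)
    then show ?thesis using Suc.IH[of tp "[]"] Suc.prems(2) by simp
  next
    case (Cons l ls')
    then obtain y tp' where "y \<in> set l" "tp' \<in> set (padded_product M k ls')" "tp = y # tp'"
      using Suc.prems(1) by auto
    then show ?thesis using Suc.IH[of tp' ls'] Suc.prems(2) Cons by auto
  qed
qed simp

lemma length_padded_product_mem_le: "tp \<in> set (padded_product M k ls) \<Longrightarrow> length tp \<le> k"
  by (induction k arbitrary: ls tp) (fastforce split: if_splits)+

lemma set_chunk: "set (chunk L vs t) \<subseteq> {..<length vs}"
  unfolding chunk_def same_var_def
  by (auto dest!: in_set_takeD in_set_dropD split: if_splits)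

lemma slots_blowup_less:
  assumes "x \<in> set (slots (blowup L K cs))"
  shows "x < length (slots cs)"
proof -
  from assms obtain i ls tp where tp: "(i, ls) \<in> set (relabel cs (map (chunk L (slots cs)) [0..<length (slots cs)]))"
    "tp \<in> set (padded_product L K ls)" "x \<in> set tp"
    unfolding slots_def[of "blowup L K cs"] by (auto simp: blowup_def)
  from padded_product_memD[OF tp(2,3)] obtain l where "l \<in> set ls" "x \<in> set l" by blast
  with set_relabel[OF tp(1)] have "x \<in> (\<Union>t<length (slots cs). set (chunk L (slots cs) t))"
    by (auto simp: lessThan_atLeast0)
  then show ?thesis using set_chunk by blast
qed

lemma polytime_blowup:
  assumes L: "polytime D e (\<lambda>a. enc_nat (L a))"
    and cs: "polytime D e (\<lambda>a. enc_list (enc_prod enc_nat (enc_list enc_nat)) (cs a))"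
  shows "polytime D e (\<lambda>a. enc_list (enc_prod enc_nat (enc_list enc_nat)) (blowup (L a) K (cs a)))"
  unfolding blowup_def
proof (rule polytime_concat, rule polytime_map)
  have sl: "polytime D e (\<lambda>a. enc_list enc_nat (slots (cs a)))" by (rule polytime_slots[OF cs])
  have "polytime D e (\<lambda>a. enc_list (enc_list enc_nat) (map (chunk (L a) (slots (cs a))) [0..<length (slots (cs a))]))"
    by (rule polytime_map[OF polytime_upt[OF polytime_length[OF sl]]])
      (intro polytime_chunk polytime_outer[OF L] polytime_outer[OF sl] polytime_inner, auto)
  then show "polytime D e (\<lambda>a. enc_list (enc_prod enc_nat (enc_list (enc_list enc_nat)))
      (relabel (cs a) (map (chunk (L a) (slots (cs a))) [0..<length (slots (cs a))])))"
    by (rule polytime_relabel[OF cs])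
  let ?D = "{y. fst y \<in> D \<and> snd y \<in> set (relabel (cs (fst y)) (map (chunk (L (fst y)) (slots (cs (fst y))))
      [0..<length (slots (cs (fst y)))]))}"
  let ?e = "\<lambda>y. Bin (e (fst y)) (enc_prod enc_nat (enc_list (enc_list enc_nat)) (snd y))"
  have "polytime ?D ?e (\<lambda>y. enc_list (enc_list enc_nat) (padded_product (L (fst y)) K (snd (snd y))))"
    by (intro polytime_padded_product polytime_outer[OF L] polytime_snd[OF polytime_inner]) auto
  then show "polytime ?D ?e (\<lambda>y. enc_list (enc_prod enc_nat (enc_list enc_nat))
       (map (Pair (fst (snd y))) (padded_product (L (fst y)) K (snd (snd y)))))"
    by (rule polytime_map) (intro polytime_Pair polytime_inner polytime_outer[OF polytime_fst[OF polytime_inner]], auto)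
qed

text \<open>Instance and accuracy are projections of an arbitrary input, so the same facts serve the
  regularizing program, whose input also holds coins, and the recovery program, whose input also
  holds an instance and an assignment.\<close>

locale polytime_instance =
  fixes D :: "'a set" and e :: "'a \<Rightarrow> btree" and F :: "'a \<Rightarrow> csp_instance" and E :: "'a \<Rightarrow> nat"
  assumes F: "polytime D e (\<lambda>a. enc_instance (F a))" and E: "polytime D e (\<lambda>a. enc_nat (E a))"
begin

lemma polytime_nvars: "polytime D e (\<lambda>a. enc_nat (nvars (F a)))"
  using polytime_head[OF F] by (simp add: enc_instance_conv)

lemma polytime_constraints:
  "polytime D e (\<lambda>a. enc_list (enc_prod enc_nat (enc_list enc_nat)) (constraints (F a)))"
  using polytime_tail[OF F] by (simp add: enc_instance_conv)

lemma polytime_rep_constraints: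
  "polytime D e (\<lambda>a. enc_list (enc_prod enc_nat (enc_list enc_nat)) (rep_constraints (F a)))"
  unfolding rep_constraints_def
  by (intro polytime_concat polytime_replicate polytime_Suc polytime_nvars polytime_constraints)

lemma polytime_log_deg: "polytime D e (\<lambda>a. enc_nat (log_deg c (E a)))"
  unfolding log_deg_def by (intro polytime_add polytime_mult polytime_const polytime_ceil_log E)

lemma polytime_log_size: "polytime D e (\<lambda>a. enc_nat (log_size (F a) (E a)))"
  unfolding log_size_def
  by (intro polytime_add polytime_ceil_log E polytime_nvars polytime_length[OF polytime_constraints])

lemma polytime_log_blowup: "polytime D e (\<lambda>a. enc_nat (log_blowup c (F a) (E a)))"
  unfolding log_blowup_def
  by (intro polytime_add polytime_mult polytime_const polytime_log_size polytime_log_deg)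

lemma polytime_levels: "polytime D e (\<lambda>a. enc_nat (levels K c (F a) (E a)))"
  unfolding levels_def
  by (intro polytime_add polytime_mult polytime_const polytime_log_size polytime_log_deg)

lemma poly_bounded_pow_log_deg: "poly_bounded D e (\<lambda>a. 2 ^ log_deg c (E a))"
proof (rule poly_bounded_mono)
  show "poly_bounded D e (\<lambda>a. (2 * E a + 1) ^ 2 * 2 ^ c)"
    using poly_bounded_polytime[OF E] by (intro poly_bounded_intros) simp
  show "2 ^ log_deg c (E a) \<le> (2 * E a + 1) ^ 2 * 2 ^ c" for a
    unfolding log_deg_def power_add mult.commute[of 2] power_mult
    using pow_ceil_log_le[of "E a"] by (intro mult_right_mono power_mono) auto
qed

lemma poly_bounded_pow_log_size: "poly_bounded D e (\<lambda>a. 2 ^ log_size (F a) (E a))"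
proof (rule poly_bounded_mono)
  show "poly_bounded D e (\<lambda>a. 2 * (nvars (F a) + length (constraints (F a)) + E a) + 1)"
    using poly_bounded_polytime[OF E] poly_bounded_polytime[OF polytime_nvars]
      poly_bounded_polytime[OF polytime_length[OF polytime_constraints]]
    by (intro poly_bounded_intros) simp_all
qed (simp only: log_size_def pow_ceil_log_le)

lemma poly_bounded_pow_log_blowup: "poly_bounded D e (\<lambda>a. 2 ^ log_blowup c (F a) (E a))"
  unfolding log_blowup_def power_add mult.commute[of 3] power_mult
  by (intro poly_bounded_intros poly_bounded_pow_log_size poly_bounded_pow_log_deg)

text \<open>\<open>K\<close> enters only as an exponent, so this is a product of fixed powers of
  polynomially bounded quantities.\<close>

lemma poly_bounded_pow_levels: "poly_bounded D e (\<lambda>a. 2 ^ levels K c (F a) (E a))"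
  unfolding levels_def power_add mult.commute[of 3] power_mult
  by (intro poly_bounded_intros poly_bounded_pow_log_size poly_bounded_pow_log_deg)

lemma polytime_base:
  "polytime D e (\<lambda>a. enc_list (enc_prod enc_nat (enc_list enc_nat)) (base K c (F a) (E a)))"
  unfolding base_def
  by (intro polytime_blowup polytime_pow2 polytime_log_blowup poly_bounded_pow_log_blowup polytime_rep_constraints)

lemma polytime_num_coins: "polytime D e (\<lambda>a. enc_nat (num_coins K c (F a) (E a)))"
  unfolding num_coins_def
  by (intro polytime_mult polytime_levels polytime_length[OF polytime_slots[OF polytime_base]])

lemma polytime_regularized:
  assumes bs: "polytime D e (\<lambda>a. enc_list enc_bool (bs a))"
  shows "polytime D e (\<lambda>a. enc_instance (regularized K c (F a) (E a) (bs a)))"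
proof -
  have N: "polytime D e (\<lambda>a. enc_nat (length (slots (rep_constraints (F a)))))"
    by (rule polytime_length[OF polytime_slots[OF polytime_rep_constraints]])
  show ?thesis unfolding enc_instance_conv regularized_def csp_instance.simps
    by (intro polytime_Bin polytime_mult polytime_pow2 N polytime_levels poly_bounded_pow_levels polytime_relabel[OF polytime_base]
        polytime_halve_iter[where N = "\<lambda>a. length (slots (rep_constraints (F a)))"] polytime_slots[OF polytime_base] bs)
      (use poly_bounded_polytime[OF N] in \<open>auto simp: base_def dest: slots_blowup_less\<close>)
qed

end

text \<open>Indices below \<open>length \<Lambda>\<close> and tuples of at most \<open>K\<close>
  values from \<open>{1..q}\<close> form a finite set, so evaluating predicates is a table
  lookup.\<close>

lemma polytime_holds:
  fixes \<Lambda> :: csp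
  assumes i: "polytime D e (\<lambda>a. enc_nat (i a))" and tp: "polytime D e (\<lambda>a. enc_list enc_nat (tp a))"
    and D: "\<And>a. a \<in> D \<Longrightarrow> i a < length \<Lambda> \<and> length (tp a) \<le> K \<and> set (tp a) \<subseteq> {1..q}"
  shows "polytime D e (\<lambda>a. enc_bool (holds (\<Lambda> ! i a) (tp a)))"
proof -
  let ?p = "enc_prod enc_nat (enc_list enc_nat)"
  have inj: "inj ?p"
    by (rule injI) (auto simp: enc_prod_def prod_eq_iff intro: enc_nat_inject enc_list_inject[of enc_nat])
  have "(\<lambda>a. ?p (i a, tp a)) ` D \<subseteq> ?p ` ({..<length \<Lambda>} \<times> {xs. set xs \<subseteq> {1..q} \<and> length xs \<le> K})"
    using D by (fastforce simp: image_iff)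
  moreover have "finite (?p ` ({..<length \<Lambda>} \<times> {xs. set xs \<subseteq> {1..q} \<and> length xs \<le> K}))"
    by (intro finite_imageI finite_cartesian_product finite_lists_length_le) auto
  ultimately have fin: "finite ((\<lambda>a. ?p (i a, tp a)) ` D)" by (rule finite_subset)
  have "polytime D e (\<lambda>a. (\<lambda>t. enc_bool (holds (\<Lambda> ! fst (inv ?p t)) (snd (inv ?p t)))) (?p (i a, tp a)))"
    by (rule polytime_finite_range[OF polytime_Pair[where f = enc_nat and g = "enc_list enc_nat", OF i tp] fin])
  then show ?thesis by (simp add: inv_f_f[OF inj])
qed

section \<open>The recovery algorithm\<close>

definition valid_pools :: "nat \<Rightarrow> nat \<Rightarrow> nat \<Rightarrow> nat list list \<Rightarrow> bool" where
  "valid_pools q n M ls \<longleftrightarrow> length ls = n \<and> (\<forall>l\<in>set ls. length l = M \<and> set l \<subseteq> {1..q})"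

lemma polytime_score:
  fixes \<Lambda> :: csp
  assumes M: "polytime D e (\<lambda>a. enc_nat (M a))"
    and cs: "polytime D e (\<lambda>a. enc_list (enc_prod enc_nat (enc_list enc_nat)) (cs a))"
    and ls: "polytime D e (\<lambda>a. enc_list (enc_list enc_nat) (ls a))"
    and D: "\<And>a i S. a \<in> D \<Longrightarrow> (i, S) \<in> set (cs a) \<Longrightarrow> i < length \<Lambda> \<and> set S \<subseteq> {..<length (ls a)}"
      "\<And>a l. a \<in> D \<Longrightarrow> l \<in> set (ls a) \<Longrightarrow> set l \<subseteq> {1..q}"
  shows "polytime D e (\<lambda>a. enc_nat (score \<Lambda> K (M a) (cs a) (ls a)))"
  unfolding score_def
proof (rule polytime_length, rule polytime_concat, rule polytime_map[OF cs])
  let ?D = "{y. fst y \<in> D \<and> snd y \<in> set (cs (fst y))}"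
  let ?e = "\<lambda>y. Bin (e (fst y)) (enc_prod enc_nat (enc_list enc_nat) (snd y))"
  have ls': "polytime ?D ?e (\<lambda>y. enc_list (enc_list enc_nat) (ls (fst y)))"
    by (rule polytime_outer[OF ls]) auto
  have "polytime ?D ?e (\<lambda>y. enc_list (enc_list enc_nat) (map ((!) (ls (fst y))) (snd (snd y))))"
    by (rule polytime_map[OF polytime_snd[OF polytime_inner]])
      (intro polytime_nth polytime_inner polytime_outer[OF ls']; use D(1) in fastforce)
  then have P: "polytime ?D ?e (\<lambda>y. enc_list (enc_list enc_nat)
      (padded_product (M (fst y)) K (map ((!) (ls (fst y))) (snd (snd y)))))"
    by (intro polytime_padded_product polytime_outer[OF M]) auto
  show "polytime ?D ?e (\<lambda>y. enc_list (enc_list enc_nat) (filter (holds (\<Lambda> ! fst (snd y)))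
         (padded_product (M (fst y)) K (map ((!) (ls (fst y))) (snd (snd y))))))"
  proof (rule polytime_filter[OF P], rule polytime_holds[where K = K and q = q])
    fix y assume y: "y \<in> {y. fst y \<in> ?D \<and> snd y \<in> set (padded_product (M (fst (fst y))) K
        (map ((!) (ls (fst (fst y)))) (snd (snd (fst y)))))}"
    obtain a i S tp where [simp]: "y = ((a, i, S), tp)" by (metis prod.collapse)
    have a: "a \<in> D" "(i, S) \<in> set (cs a)" "tp \<in> set (padded_product (M a) K (map ((!) (ls a)) S))"
      using y by auto
    have "x \<in> {1..q}" if x: "x \<in> set tp" for x
    proof -
      from padded_product_memD[OF a(3) x] obtain v where v: "v \<in> set S" "x \<in> set (ls a ! v)" by auto
      then have "ls a ! v \<in> set (ls a)" using D(1)[OF a(1,2)] by (intro nth_mem) auto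
      then show ?thesis using D(2)[OF a(1)] v(2) by blast
    qed
    then show "fst (snd (fst y)) < length \<Lambda> \<and> length (snd y) \<le> K \<and> set (snd y) \<subseteq> {1..q}"
      using D(1)[OF a(1,2)] length_padded_product_mem_le[OF a(3)] by auto
  qed (rule polytime_outer[OF polytime_fst[OF polytime_inner[of "?D"]]], simp, rule polytime_inner)
qed

lemma valid_pools_update:
  assumes "valid_pools q n M ls" "v < n" "a \<in> {1..q}"
  shows "valid_pools q n M (take v ls @ replicate M a # drop (Suc v) ls)"
  using assms unfolding valid_pools_def
  by (auto dest: in_set_takeD in_set_dropD)

lemma valid_pools_round_step:
  assumes "valid_pools q n M ls" "v < n" "q \<ge> 1"
  shows "valid_pools q n M (round_step q \<Lambda> K M cs v ls)"
proof -
  let ?f = "filter (\<lambda>a. score \<Lambda> K M cs ls \<le> score \<Lambda> K M cs (take v ls @ replicate M a # drop (Suc v) ls)) [1..<Suc q]"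
  have "hd (?f @ [1]) \<in> set (?f @ [1])" by (rule hd_in_set) simp
  then have "hd (?f @ [1]) \<in> {1..q}" using assms(3) by auto
  then show ?thesis unfolding round_step_def by (rule valid_pools_update[OF assms(1,2)])
qed

lemma valid_pools_fold:
  assumes "valid_pools q n M ls" "set us \<subseteq> {..<n}" "q \<ge> 1"
  shows "valid_pools q n M (fold (round_step q \<Lambda> K M cs) us ls)"
  using assms by (induction us arbitrary: ls) (auto simp: valid_pools_round_step)

lemma size_valid_pools:
  assumes "valid_pools q n M ls"
  shows "size (enc_list (enc_list enc_nat) ls) \<le> n * (M * (q + 1) + 1)"
proof -
  have "size (enc_list enc_nat l) \<le> M * (q + 1)" if "l \<in> set ls" for l
  proof -
    have "(\<Sum>x\<leftarrow>l. size (enc_nat x) + 1) \<le> (\<Sum>x\<leftarrow>l. q + 1)"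
      using assms that by (intro sum_list_mono) (fastforce simp: valid_pools_def)
    then show ?thesis using assms that by (simp add: size_enc_list sum_list_triv valid_pools_def)
  qed
  then have "(\<Sum>l\<leftarrow>ls. size (enc_list enc_nat l) + 1) \<le> (\<Sum>l\<leftarrow>ls. M * (q + 1) + 1)"
    by (intro sum_list_mono) auto
  then show ?thesis using assms
    by (simp add: size_enc_list[of "enc_list enc_nat"] sum_list_triv valid_pools_def)
qed

lemma polytime_round:
  fixes \<Lambda> :: csp
  assumes n: "polytime D e (\<lambda>a. enc_nat (n a))" and M: "polytime D e (\<lambda>a. enc_nat (M a))"
    and cs: "polytime D e (\<lambda>a. enc_list (enc_prod enc_nat (enc_list enc_nat)) (cs a))"
    and ls: "polytime D e (\<lambda>a. enc_list (enc_list enc_nat) (ls a))"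
    and D: "\<And>a i S. a \<in> D \<Longrightarrow> (i, S) \<in> set (cs a) \<Longrightarrow> i < length \<Lambda> \<and> set S \<subseteq> {..<n a}"
      "\<And>a. a \<in> D \<Longrightarrow> valid_pools q (n a) (M a) (ls a)" and q: "q \<ge> 1"
  shows "polytime D e (\<lambda>a. enc_list (enc_list enc_nat) (fold (round_step q \<Lambda> K (M a) (cs a)) [0..<n a] (ls a)))"
proof (rule polytime_fold[where ez = "enc_list (enc_list enc_nat)" and z = ls and B = "\<lambda>a. n a * (M a * (q + 1) + 1)",
      OF polytime_upt[OF n] ls])
  show "poly_bounded D e (\<lambda>a. n a * (M a * (q + 1) + 1))"
    using poly_bounded_polytime[OF n] poly_bounded_polytime[OF M] by (intro poly_bounded_intros) simp_all
  show "size (enc_list (enc_list enc_nat) (fold (round_step q \<Lambda> K (M a) (cs a)) us (ls a))) \<le> n a * (M a * (q + 1) + 1)"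
    if "a \<in> D" "[0..<n a] = us @ vs" for a us vs
    using arg_cong[OF that(2), of set] that(1)
    by (intro size_valid_pools valid_pools_fold D(2) q) auto
  let ?D = "{y. fst y \<in> D \<and> (\<exists>us vs. [0..<n (fst y)] = us @ fst (snd y) # vs \<and>
        snd (snd y) = fold (round_step q \<Lambda> K (M (fst y)) (cs (fst y))) us (ls (fst y)))}"
  let ?e = "\<lambda>y. Bin (e (fst y)) (Bin (enc_nat (fst (snd y))) (enc_list (enc_list enc_nat) (snd (snd y))))"
  have valid: "valid_pools q (n (fst y)) (M (fst y)) (snd (snd y)) \<and> fst (snd y) < n (fst y) \<and> fst y \<in> D" if y: "y \<in> ?D" for y
  proof -
    from y obtain us vs where "fst y \<in> D" "[0..<n (fst y)] = us @ fst (snd y) # vs"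
      "snd (snd y) = fold (round_step q \<Lambda> K (M (fst y)) (cs (fst y))) us (ls (fst y))" by blast
    note y' = this
    have "{0..<n (fst y)} = set us \<union> {fst (snd y)} \<union> set vs"
      using arg_cong[OF y'(2), of set] by auto
    then have "set us \<subseteq> {..<n (fst y)}" "fst (snd y) \<in> {..<n (fst y)}"
      unfolding lessThan_atLeast0 by blast+
    then show ?thesis
      using valid_pools_fold[OF D(2) _ q, of "fst y" us \<Lambda> K "cs (fst y)"] y' by auto
  qed
  define DD where "DD = ?D"
  have M1: "polytime DD ?e (\<lambda>y. enc_nat (M (fst y)))" unfolding DD_def by (rule polytime_outer[OF M]) auto
  have cs1: "polytime DD ?e (\<lambda>y. enc_list (enc_prod enc_nat (enc_list enc_nat)) (cs (fst y)))"
    unfolding DD_def by (rule polytime_outer[OF cs]) auto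
  let ?D2 = "{y. fst y \<in> DD \<and> snd y \<in> set [1..<Suc q]}"
  let ?e2 = "\<lambda>y. Bin (?e (fst y)) (enc_nat (snd y))"
  have sc: "polytime ?D2 ?e2 (\<lambda>y. enc_nat (score \<Lambda> K (M (fst (fst y))) (cs (fst (fst y))) (snd (snd (fst y)))))"
  proof (rule polytime_score[where q = q])
    show "polytime ?D2 ?e2 (\<lambda>a. enc_list (enc_list enc_nat) (snd (snd (fst a))))"
      by (rule polytime_outer[OF polytime_inner2[of DD]]) auto
    show "polytime ?D2 ?e2 (\<lambda>y. enc_nat (M (fst (fst y))))" by (rule polytime_outer[OF M1]) auto
    show "polytime ?D2 ?e2 (\<lambda>y. enc_list (enc_prod enc_nat (enc_list enc_nat)) (cs (fst (fst y))))"
      by (rule polytime_outer[OF cs1]) auto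
  qed (use valid D(1) in \<open>fastforce simp: valid_pools_def DD_def\<close>)+
  let ?l = "\<lambda>y. take (fst (snd (fst y))) (snd (snd (fst y))) @ replicate (M (fst (fst y))) (snd y) #
     drop (Suc (fst (snd (fst y)))) (snd (snd (fst y)))"
  have upd: "polytime D' e' (\<lambda>a. enc_list (enc_list enc_nat) (take (v a) (ls a) @ replicate (M a) (x a) # drop (Suc (v a)) (ls a)))"
    if "polytime D' e' (\<lambda>a. enc_nat (v a))" "polytime D' e' (\<lambda>a. enc_list (enc_list enc_nat) (ls a))"
      "polytime D' e' (\<lambda>a. enc_nat (M a))" "polytime D' e' (\<lambda>a. enc_nat (x a))" for D' e' v ls M x
  proof (rule polytime_append)
    show "polytime D' e' (\<lambda>a. enc_list (enc_list enc_nat) (replicate (M a) (x a) # drop (Suc (v a)) (ls a)))"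
      unfolding enc_list.simps by (intro polytime_Bin polytime_replicate polytime_drop polytime_Suc that)
  qed (intro polytime_take that)
  have sc2: "polytime ?D2 ?e2 (\<lambda>y. enc_nat (score \<Lambda> K (M (fst (fst y))) (cs (fst (fst y))) (?l y)))"
  proof (rule polytime_score[where q = q])
    show "polytime ?D2 ?e2 (\<lambda>y. enc_list (enc_list enc_nat) (?l y))"
      by (intro upd polytime_inner polytime_outer[OF polytime_inner2[of DD]] polytime_outer[OF polytime_inner1[of DD]]
          polytime_outer[OF M1]) auto
    show "polytime ?D2 ?e2 (\<lambda>y. enc_nat (M (fst (fst y))))" by (rule polytime_outer[OF M1]) auto
    show "polytime ?D2 ?e2 (\<lambda>y. enc_list (enc_prod enc_nat (enc_list enc_nat)) (cs (fst (fst y))))"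
      by (rule polytime_outer[OF cs1]) auto
    fix y assume y: "y \<in> ?D2"
    then have "valid_pools q (n (fst (fst y))) (M (fst (fst y))) (?l y)" "fst (fst y) \<in> D"
      using valid[of "fst y"] by (auto simp: DD_def intro!: valid_pools_update)
    then show "(i, S) \<in> set (cs (fst (fst y))) \<Longrightarrow> i < length \<Lambda> \<and> set S \<subseteq> {..<length (?l y)}"
      "l \<in> set (?l y) \<Longrightarrow> set l \<subseteq> {1..q}" for i S l
      using D(1)[of "fst (fst y)" i S] by (simp_all only: valid_pools_def)
  qed
  show "polytime ?D ?e (\<lambda>y. enc_list (enc_list enc_nat)
      (round_step q \<Lambda> K (M (fst y)) (cs (fst y)) (fst (snd y)) (snd (snd y))))"
    unfolding round_step_def DD_def[symmetric]
    by (intro upd polytime_inner1 polytime_inner2 M1 polytime_hd[where ex = enc_nat] polytime_append polytime_filter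
        polytime_const polytime_le sc sc2) auto
qed

lemma set_take_replicate_same_var:
  "set (take L (concat (replicate L (same_var vs v [0..<length vs])))) \<subseteq> {..<length vs}"
  by (auto simp: same_var_def dest!: in_set_takeD split: if_splits)

lemma length_concat_replicate: "length (concat (replicate n xs)) = n * length xs"
  by (induction n) auto

lemma length_pool:
  assumes "length z = length vs * N"
  shows "length (pool L N vs z d v) = L * N"
proof (cases "same_var vs v [0..<length vs] = []")
  case False
  let ?ts = "take L (concat (replicate L (same_var vs v [0..<length vs])))"
  have "length (take N (drop (t * N) z)) = N" if "t \<in> set ?ts" for t
  proof -
    have "t < length vs" using that set_take_replicate_same_var by blast
    then have "Suc t * N \<le> length vs * N" by (intro mult_right_mono) auto
    then show ?thesis using assms by simp
  qed
  then have "(\<Sum>t\<leftarrow>?ts. length (take N (drop (t * N) z))) = (\<Sum>t\<leftarrow>?ts. N)"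
    by (intro arg_cong[of _ _ sum_list] map_cong refl)
  moreover have "length ?ts = L"
    using False by (simp add: length_concat_replicate) (cases "same_var vs v [0..<length vs]"; simp)
  ultimately show ?thesis using False
    by (simp add: pool_def length_concat comp_def sum_list_triv)
qed (simp add: pool_def)

lemma set_pool:
  assumes "set z \<subseteq> A" "d \<in> A"
  shows "set (pool L N vs z d v) \<subseteq> A"
  using assms unfolding pool_def by (auto dest!: in_set_takeD[of _ N] in_set_dropD)

lemma polytime_pool:
  assumes L: "polytime D e (\<lambda>a. enc_nat (L a))" and N: "polytime D e (\<lambda>a. enc_nat (N a))"
    and vs: "polytime D e (\<lambda>a. enc_list enc_nat (vs a))" and z: "polytime D e (\<lambda>a. enc_list enc_nat (z a))"
    and v: "polytime D e (\<lambda>a. enc_nat (v a))"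
  shows "polytime D e (\<lambda>a. enc_list enc_nat (pool (L a) (N a) (vs a) (z a) d (v a)))"
proof -
  have sv: "polytime D e (\<lambda>a. enc_list enc_nat (same_var (vs a) (v a) [0..<length (vs a)]))"
    by (intro polytime_same_var vs v polytime_upt polytime_length[OF vs]) auto
  have null: "polytime D e (\<lambda>a. enc_bool (same_var (vs a) (v a) [0..<length (vs a)] = []))"
  proof (rule polytime_cong[OF polytime_eq_const[OF sv, of Tip]])
    show "enc_bool (enc_list enc_nat xs = Tip) = enc_bool (xs = [])" for xs by (cases xs) auto
  qed
  have C: "polytime D e (\<lambda>a. enc_list (enc_list enc_nat) (map (\<lambda>t. take (N a) (drop (t * N a) (z a)))
       (take (L a) (concat (replicate (L a) (same_var (vs a) (v a) [0..<length (vs a)]))))))"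
    by (rule polytime_map[where ex = enc_nat], intro polytime_take polytime_concat polytime_replicate L sv)
      (intro polytime_take polytime_drop polytime_mult polytime_inner polytime_outer[OF N] polytime_outer[OF z], auto)
  show ?thesis unfolding pool_def if_distrib[of "enc_list enc_nat"]
    by (rule polytime_if[OF null])
      (auto intro!: polytime_replicate polytime_const polytime_mult polytime_concat
        intro: polytime_subset[OF C] polytime_subset[OF L] polytime_subset[OF N])
qed

lemma (in polytime_instance) polytime_recovered:
  assumes z: "polytime D e (\<lambda>a. enc_list enc_nat (z a))" and q: "q \<ge> 1"
    and D: "\<And>a i S. a \<in> D \<Longrightarrow> (i, S) \<in> set (constraints (F a)) \<Longrightarrow> i < length \<Lambda> \<and> set S \<subseteq> {..<nvars (F a)}"
      "\<And>a. a \<in> D \<Longrightarrow> length (z a) = length (slots (rep_constraints (F a))) * 2 ^ levels K c (F a) (E a)"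
      "\<And>a. a \<in> D \<Longrightarrow> set (z a) \<subseteq> {1..q}"
  shows "polytime D e (\<lambda>a. enc_list enc_nat (recovered q \<Lambda> K c (F a) (E a) (z a)))"
proof -
  let ?L = "\<lambda>a. 2 ^ log_blowup c (F a) (E a)" and ?N = "\<lambda>a. 2 ^ levels K c (F a) (E a)"
  let ?vs = "\<lambda>a. slots (rep_constraints (F a))"
  let ?ls = "\<lambda>a. map (pool (?L a) (?N a) (?vs a) (z a) 1) [0..<nvars (F a)]"
  let ?r = "\<lambda>a. fold (round_step q \<Lambda> K (?L a * ?N a) (constraints (F a))) [0..<nvars (F a)] (?ls a)"
  have L: "polytime D e (\<lambda>a. enc_nat (?L a))" by (intro polytime_pow2 polytime_log_blowup poly_bounded_pow_log_blowup)
  have N: "polytime D e (\<lambda>a. enc_nat (?N a))" by (intro polytime_pow2 polytime_levels poly_bounded_pow_levels)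
  have vs: "polytime D e (\<lambda>a. enc_list enc_nat (?vs a))" by (rule polytime_slots[OF polytime_rep_constraints])
  have ls: "polytime D e (\<lambda>a. enc_list (enc_list enc_nat) (?ls a))"
    by (rule polytime_map[OF polytime_upt[OF polytime_nvars]])
      (intro polytime_pool polytime_inner polytime_outer[OF L] polytime_outer[OF N] polytime_outer[OF vs] polytime_outer[OF z], auto)
  have valid: "valid_pools q (nvars (F a)) (?L a * ?N a) (?ls a)" if "a \<in> D" for a
    using length_pool[OF D(2)[OF that]] set_pool[OF D(3)[OF that]] q by (fastforce simp: valid_pools_def)
  have R: "polytime D e (\<lambda>a. enc_list (enc_list enc_nat) (?r a))"
    by (intro polytime_round polytime_nvars polytime_mult L N polytime_constraints ls valid D(1) q)
  have ne: "l \<noteq> []" if "a \<in> D" "l \<in> set (?r a)" for a l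
    using valid_pools_fold[OF valid[OF that(1)] _ q, of "[0..<nvars (F a)]"] that(2)
    by (fastforce simp: valid_pools_def)
  show ?thesis unfolding recovered_def Let_def
    by (rule polytime_map[OF R], rule polytime_hd[OF polytime_inner]) (use ne in auto)
qed

text \<open>The state is a unary counter, the coins tossed so far and the input \<open>x\<close>;
  each round decrements, tosses once and passes \<open>x\<close> on. Coins are pushed to the front,
  which is why they come out reversed. The numeric bound is a generous estimate for one round on
  states of size at most \<open>3 * n + 2 + size x\<close>.\<close>

lemma eval_toss:
  assumes "length bs = n"
  shows "\<exists>t \<le> (n + 1) * (1 + 2 * (10 * size x + 30 * n + 40)).
     eval (While Head (Fork (Seq Head Tail) (Fork (Fork Flip (Seq Tail Head)) (Seq Tail Tail))))
       (Bin (enc_nat n) (Bin Tip x)) (bs @ \<omega>) t (Bin Tip (Bin (enc_list enc_bool (rev bs)) x)) \<omega>"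
proof -
  let ?st = "\<lambda>i. Bin (enc_nat (n - i)) (Bin (enc_list enc_bool (rev (take i bs))) x)"
  let ?\<tau> = "10 * size x + 30 * n + 40"
  have le: "size (enc_list enc_bool cs) \<le> 2 * length cs" for cs
    by (induction cs) (auto intro: order.trans[OF add_mono[OF size_enc_bool_le]])
  have sz: "size (?st i) \<le> 3 * n + 2 + size x" for i
    using le[of "rev (take i bs)"] assms by simp
  have "\<exists>t\<le>(n + 1) * (1 + 2 * ?\<tau>). eval (While Head (Fork (Seq Head Tail) (Fork (Fork Flip (Seq Tail Head)) (Seq Tail Tail))))
      (?st 0) (drop 0 bs @ \<omega>) t (?st n) (drop n bs @ \<omega>)"
  proof (rule eval_While_sequence[where b = "\<lambda>i. enc_nat (n - i)"])
    show "\<exists>t\<le>?\<tau>. eval Head (?st i) (drop i bs @ \<omega>) t (enc_nat (n - i)) (drop i bs @ \<omega>)" for i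
      using eval.Head[of "?st i" "drop i bs @ \<omega>"] sz[of i] by (intro exI[of _ "1 + size (?st i)"]) simp
    show "\<exists>t\<le>?\<tau>. eval Head (?st n) (drop n bs @ \<omega>) t Tip (drop n bs @ \<omega>)"
      using eval.Head[of "?st n" "drop n bs @ \<omega>"] sz[of n] by (intro exI[of _ "1 + size (?st n)"]) simp
    show "size (?st n) \<le> ?\<tau>" using sz[of n] by simp
    fix i assume i: "i < n"
    then obtain k where k: "n - i = Suc k" by (cases "n - i") auto
    have d: "drop i bs @ \<omega> = bs ! i # (drop (Suc i) bs @ \<omega>)"
      using i assms by (simp add: Cons_nth_drop_Suc[symmetric])
    have tk: "enc_list enc_bool (rev (take (Suc i) bs)) = Bin (enc_bool (bs ! i)) (enc_list enc_bool (rev (take i bs)))"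
      using i assms by (simp add: take_Suc_conv_app_nth)
    show "enc_nat (n - i) \<noteq> Tip" using k by simp
    let ?x = "?st i" and ?w = "drop (Suc i) bs @ \<omega>"
    have 1: "eval (Seq Head Tail) ?x (drop i bs @ \<omega>) (1 + (1 + size ?x) + (1 + size (head ?x))) (enc_nat (n - Suc i)) (drop i bs @ \<omega>)"
    proof -
      have "n - Suc i = k" using k by simp
      then have "tail (head ?x) = enc_nat (n - Suc i)" using k by simp
      with eval.Seq[OF eval.Head eval.Tail, of ?x "drop i bs @ \<omega>"] show ?thesis by (simp only:)
    qed
    have 2: "eval Flip ?x (drop i bs @ \<omega>) (1 + size ?x) (enc_bool (bs ! i)) ?w"
      unfolding d by (rule eval.Flip)
    have 3: "eval (Seq Tail Head) ?x ?w (1 + (1 + size ?x) + (1 + size (tail ?x))) (enc_list enc_bool (rev (take i bs))) ?w"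
      using eval.Seq[OF eval.Tail eval.Head, of ?x ?w] by (metis head.simps(2) tail.simps(2))
    have 4: "eval (Seq Tail Tail) ?x ?w (1 + (1 + size ?x) + (1 + size (tail ?x))) x ?w"
      using eval.Seq[OF eval.Tail eval.Tail, of ?x ?w] by (metis tail.simps(2))
    have h: "size (head ?x) \<le> size ?x" "size (tail ?x) \<le> size ?x" by simp_all
    show "\<exists>t\<le>?\<tau>. eval (Fork (Seq Head Tail) (Fork (Fork Flip (Seq Tail Head)) (Seq Tail Tail)))
        ?x (drop i bs @ \<omega>) t (?st (Suc i)) ?w"
      unfolding tk
      by (rule exI, rule conjI[rotated], rule eval.Fork[OF 1 eval.Fork[OF eval.Fork[OF 2 3] 4]])
        (use sz[of i] h in linarith)
  qed
  then show ?thesis using assms by simp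
qed

text \<open>
  All coins are tossed beforehand and stored in a list, so that only one loop has to
  deal with randomness.
\<close>

lemma randomized_program:
  assumes n: "polytime D e (\<lambda>a. enc_nat (n a))"
    and f: "polytime {y. fst y \<in> D \<and> length (snd y) = n (fst y)}
      (\<lambda>y. Bin (enc_list enc_bool (snd y)) (e (fst y))) (\<lambda>y. f (fst y) (snd y))"
  obtains p T where "\<And>a. a \<in> D \<Longrightarrow> n a \<le> poly T (size (e a))"
    "\<And>a bs \<omega>. a \<in> D \<Longrightarrow> length bs = n a \<Longrightarrow>
       \<exists>t \<le> poly T (size (e a)). eval p (e a) (bs @ \<omega>) t (f a (rev bs)) \<omega>"
proof -
  let ?w = "While Head (Fork (Seq Head Tail) (Fork (Fork Flip (Seq Tail Head)) (Seq Tail Tail)))"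
  have "polytime D e (\<lambda>a. Bin (enc_nat (n a)) (Bin Tip (e a)))"
    by (intro polytime_Bin polytime_Tip n polytime_input)
  then obtain r S where r: "\<forall>a\<in>D. \<forall>\<omega>. \<exists>t \<le> poly S (size (e a)). eval r (e a) \<omega> t (Bin (enc_nat (n a)) (Bin Tip (e a))) \<omega>"
    unfolding polytime_def by blast
  from f obtain p U where p: "\<And>a bs \<omega>. a \<in> D \<Longrightarrow> length bs = n a \<Longrightarrow> \<exists>t \<le> poly U (size (Bin (enc_list enc_bool bs) (e a))).
      eval p (Bin (enc_list enc_bool bs) (e a)) \<omega> t (f a bs) \<omega>"
    unfolding polytime_def by fastforce
  have nb: "poly_bounded D e n" using poly_bounded_polytime[OF n] by simp
  then obtain V where V: "\<And>a. a \<in> D \<Longrightarrow> n a \<le> poly V (size (e a))" unfolding poly_bounded_def by blast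
  have "poly_bounded D e (\<lambda>a. (n a + 1) * (1 + 2 * (10 * size (e a) + 30 * n a + 40)))"
    by (intro poly_bounded_intros nb)
  then obtain W where W: "\<And>a. a \<in> D \<Longrightarrow> (n a + 1) * (1 + 2 * (10 * size (e a) + 30 * n a + 40)) \<le> poly W (size (e a))"
    unfolding poly_bounded_def by blast
  have "poly_bounded D e (\<lambda>a. 2 * n a + size (e a) + 1)" by (intro poly_bounded_intros nb)
  then obtain X where X: "\<And>a. a \<in> D \<Longrightarrow> 2 * n a + size (e a) + 1 \<le> poly X (size (e a))"
    unfolding poly_bounded_def by blast
  let ?T = "V + S + W + X + X + U \<circ>\<^sub>p X + [:5:]"
  show ?thesis
  \<comment> \<open>\<open>r\<close> sets up the counter, \<open>?w\<close> tosses,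
    \<open>Tail\<close> discards the exhausted counter, and the deterministic \<open>p\<close>
    computes from the stored coins.\<close>
  proof (rule that[of ?T "Seq r (Seq ?w (Seq Tail p))"])
    show "n a \<le> poly ?T (size (e a))" if "a \<in> D" for a using V[OF that] by simp
    fix a :: 'a and bs \<omega> :: "bool list"
    assume a: "a \<in> D" and len: "length bs = n a"
    let ?c = "Bin (enc_list enc_bool (rev bs)) (e a)"
    obtain t1 where t1: "t1 \<le> poly S (size (e a))" "eval r (e a) (bs @ \<omega>) t1 (Bin (enc_nat (n a)) (Bin Tip (e a))) (bs @ \<omega>)"
      using r a by blast
    obtain t2 where t2: "t2 \<le> poly W (size (e a))"
      "eval ?w (Bin (enc_nat (n a)) (Bin Tip (e a))) (bs @ \<omega>) t2 (Bin Tip ?c) \<omega>"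
      using eval_toss[OF len, of "e a" \<omega>] W[OF a] order_trans by blast
    have sz: "size ?c \<le> poly X (size (e a))"
    proof -
      have "size (enc_list enc_bool cs) \<le> 2 * length cs" for cs
        by (induction cs) (auto intro: order.trans[OF add_mono[OF size_enc_bool_le]])
      from this[of "rev bs"] show ?thesis using X[OF a] len by simp
    qed
    obtain t3 where t3: "t3 \<le> poly U (size ?c)" "eval p ?c \<omega> t3 (f a (rev bs)) \<omega>"
      using p[OF a, of "rev bs"] len by auto
    have t3': "t3 \<le> poly U (poly X (size (e a)))" using t3(1) poly_mono_nat[OF sz, of U] by linarith
    have "eval (Seq r (Seq ?w (Seq Tail p))) (e a) (bs @ \<omega>) (1 + t1 + (1 + t2 + (1 + (1 + size (Bin Tip ?c)) + t3))) (f a (rev bs)) \<omega>"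
      by (rule eval.Seq[OF t1(2) eval.Seq[OF t2(2) eval.Seq[OF eval.Tail[of "Bin Tip ?c", unfolded tail.simps] t3(2)]]])
    moreover have "1 + t1 + (1 + t2 + (1 + (1 + size (Bin Tip ?c)) + t3)) \<le> poly ?T (size (e a))"
      using t1(1) t2(1) t3' sz by (simp add: poly_pcompose)
    ultimately show "\<exists>t \<le> poly ?T (size (e a)). eval (Seq r (Seq ?w (Seq Tail p))) (e a) (bs @ \<omega>) t (f a (rev bs)) \<omega>"
      by blast
  qed
qed

section \<open>Averages over lists and coins\<close>

definition mean :: "'a list \<Rightarrow> ('a \<Rightarrow> real) \<Rightarrow> real" where
  "mean l h = (\<Sum>x\<leftarrow>l. h x) / real (length l)"

text \<open>The expectation of \<open>P\<close> at a tuple whose entries are drawn independently and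
  uniformly from the lists. Lists with repetitions stand for distributions, so that expectations can
  be computed by counting.\<close>

fun mean_tuple :: "('a list \<Rightarrow> real) \<Rightarrow> 'a list list \<Rightarrow> real" where
  "mean_tuple P [] = P []"
| "mean_tuple P (l # ls) = mean l (\<lambda>a. mean_tuple (\<lambda>t. P (a # t)) ls)"

lemma mean_const: "l \<noteq> [] \<Longrightarrow> mean l (\<lambda>_. c) = c"
  by (simp add: mean_def sum_list_triv)

lemma mean_replicate: "M > 0 \<Longrightarrow> mean (replicate M a) h = h a"
  by (simp add: mean_def sum_list_replicate)

lemma mean_cong: "(\<And>x. x \<in> set l \<Longrightarrow> h x = g x) \<Longrightarrow> mean l h = mean l g"
  unfolding mean_def by (metis map_cong)

lemma mean_mono: "(\<And>x. x \<in> set l \<Longrightarrow> h x \<le> g x) \<Longrightarrow> mean l h \<le> mean l g"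
  unfolding mean_def by (intro divide_right_mono sum_list_mono) auto

lemma mean_add_const: "l \<noteq> [] \<Longrightarrow> mean l (\<lambda>x. h x + c) = mean l h + c"
  by (simp add: mean_def sum_list_addf sum_list_triv field_simps)

lemma mean_diff: "mean l (\<lambda>x. h x - g x) = mean l h - mean l g"
  by (simp add: mean_def sum_list_subtractf diff_divide_distrib)

lemma sum_list_swap: "(\<Sum>x\<leftarrow>xs. \<Sum>y\<leftarrow>ys. h x y) = (\<Sum>y\<leftarrow>ys. \<Sum>x\<leftarrow>xs. (h x y :: real))"
  by (induction xs) (auto simp: sum_list_addf)

lemma mean_sum_list: "mean l (\<lambda>a. \<Sum>x\<leftarrow>xs. h x a) = (\<Sum>x\<leftarrow>xs. mean l (h x))"
proof -
  have "mean l (\<lambda>a. \<Sum>x\<leftarrow>xs. h x a) = (\<Sum>x\<leftarrow>xs. \<Sum>a\<leftarrow>l. h x a) / real (length l)"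
    unfolding mean_def by (subst sum_list_swap) simp
  also have "\<dots> = (\<Sum>x\<leftarrow>xs. mean l (h x))"
    by (induction xs) (auto simp: mean_def add_divide_distrib)
  finally show ?thesis .
qed

lemma mean_swap: "mean l (\<lambda>a. mean l' (\<lambda>b. h a b)) = mean l' (\<lambda>b. mean l (\<lambda>a. h a b))"
proof -
  have "mean l (\<lambda>a. mean l' (\<lambda>b. h a b)) = mean l (\<lambda>a. \<Sum>b\<leftarrow>l'. h a b / real (length l'))"
    by (rule mean_cong) (simp add: mean_def divide_inverse sum_list_mult_const)
  also have "\<dots> = (\<Sum>b\<leftarrow>l'. mean l (\<lambda>a. h a b / real (length l')))" by (rule mean_sum_list)
  also have "\<dots> = mean l' (\<lambda>b. mean l (\<lambda>a. h a b))"
    by (simp add: mean_def divide_inverse sum_list_mult_const sum_list_const_mult mult.commute mult.left_commute)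
  finally show ?thesis .
qed

lemma mean_append: "length l = length l' \<Longrightarrow> mean (l @ l') h = (mean l h + mean l' h) / 2"
  by (simp add: mean_def add_divide_distrib)

lemma mean_concat:
  assumes "\<And>x. x \<in> set xs \<Longrightarrow> length (f x) = M"
  shows "mean (concat (map f xs)) h = mean xs (\<lambda>x. mean (f x) h)"
proof -
  have len: "length (concat (map f xs)) = length xs * M"
    using assms by (induction xs) auto
  have "(\<Sum>a\<leftarrow>concat (map f xs). h a) = (\<Sum>x\<leftarrow>xs. \<Sum>a\<leftarrow>f x. h a)" by (induction xs) auto
  moreover have "mean xs (\<lambda>x. mean (f x) h) = mean xs (\<lambda>x. (\<Sum>a\<leftarrow>f x. h a) / real M)"
    by (rule mean_cong) (simp add: mean_def assms)
  ultimately show ?thesis using len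
    by (auto simp: mean_def divide_inverse sum_list_mult_const)
qed

lemma ex_mean_le: assumes "l \<noteq> []" shows "\<exists>a\<in>set l. mean l h \<le> h a"
proof (rule ccontr)
  assume "\<not> ?thesis"
  then have "\<forall>a\<in>set l. h a < mean l h" by auto
  moreover have "(\<Sum>a\<leftarrow>l. h a) < (\<Sum>a\<leftarrow>l. c)" if "\<forall>a\<in>set l. h a < c" for c
    using assms that by (induction l rule: list_nonempty_induct) (auto intro: add_strict_mono)
  ultimately have "(\<Sum>a\<leftarrow>l. h a) < (\<Sum>a\<leftarrow>l. mean l h)" by blast
  then show False using assms by (simp add: mean_def sum_list_triv)
qed

lemma mean_tuple_bounds:
  assumes "\<And>t. 0 \<le> P t \<and> P t \<le> 1"
  shows "0 \<le> mean_tuple P ls \<and> mean_tuple P ls \<le> 1"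
  using assms
proof (induction ls arbitrary: P)
  case (Cons l ls)
  have b: "0 \<le> mean_tuple (\<lambda>t. P (a # t)) ls \<and> mean_tuple (\<lambda>t. P (a # t)) ls \<le> 1" for a
    using Cons by auto
  have "mean l (\<lambda>_. 0) \<le> mean l (\<lambda>a. mean_tuple (\<lambda>t. P (a # t)) ls)"
    "mean l (\<lambda>a. mean_tuple (\<lambda>t. P (a # t)) ls) \<le> mean l (\<lambda>_. 1)"
    by (intro mean_mono; use b in auto)+
  moreover have "mean l (\<lambda>_. 1) \<le> 1" "mean l (\<lambda>_. 0) = 0" by (auto simp: mean_def sum_list_triv)
  ultimately show ?case by auto
qed auto

text \<open>As \<open>u\<close> occurs at most once in \<open>S\<close>, a mixture in the list at
  \<open>u\<close> becomes the same mixture of the expectations. The family \<open>B\<close> is kept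
  general: it is applied to single lists and to lists made by concatenating two.\<close>

lemma mean_tuple_affine:
  assumes "distinct S" "l \<noteq> []" "\<And>a x. x \<in> set S \<Longrightarrow> x \<noteq> u \<Longrightarrow> B a x = A x"
    "\<And>h. mean (A u) h = mean l (\<lambda>a. mean (B a u) h)"
  shows "mean_tuple P (map A S) = mean l (\<lambda>a. mean_tuple P (map (B a) S))"
  using assms(1,3)
proof (induction S arbitrary: P)
  case Nil
  then show ?case using assms(2) by (simp add: mean_const)
next
  case (Cons x S)
  show ?case
  proof (cases "x = u")
    case True
    have eq: "map (B a) S = map A S" for a using Cons.prems True by auto
    show ?thesis unfolding True list.map mean_tuple.simps eq by (rule assms(4))
  next
    case False
    have "mean_tuple P (map A (x # S)) = mean (A x) (\<lambda>b. mean l (\<lambda>a. mean_tuple (\<lambda>t. P (b # t)) (map (B a) S)))"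
      using Cons.IH Cons.prems by simp
    also have "\<dots> = mean l (\<lambda>a. mean (A x) (\<lambda>b. mean_tuple (\<lambda>t. P (b # t)) (map (B a) S)))"
      by (rule mean_swap)
    finally show ?thesis using Cons.prems(2)[of x] False by simp
  qed
qed

lemma mean_tuple_cong:
  assumes "list_all2 (\<lambda>A B. \<forall>h. mean A h = mean B h) As Bs"
  shows "mean_tuple P As = mean_tuple P Bs"
  using assms by (induction As Bs arbitrary: P rule: list_all2_induct) auto

text \<open>A hybrid argument: the lists are exchanged one at a time, each exchange costing at most
  \<open>d\<close> because the remaining expectation is a test function with values between 0 and
  1.\<close>

lemma mean_tuple_perturb:
  assumes "list_all2 (\<lambda>A B. \<forall>h. (\<forall>x. 0 \<le> h x \<and> h x \<le> 1) \<longrightarrow> mean A h \<le> mean B h + d) As Bs"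
    "\<And>B. B \<in> set Bs \<Longrightarrow> B \<noteq> []" "\<And>t. 0 \<le> P t \<and> P t \<le> 1"
  shows "mean_tuple P As \<le> mean_tuple P Bs + real (length As) * d"
  using assms
proof (induction As Bs arbitrary: P rule: list_all2_induct)
  case (Cons A As B Bs)
  have "mean_tuple P (A # As) \<le> mean B (\<lambda>a. mean_tuple (\<lambda>t. P (a # t)) As) + d"
    using Cons(1) mean_tuple_bounds[of "\<lambda>t. P (_ # t)" As] Cons.prems by simp
  also have "mean B (\<lambda>a. mean_tuple (\<lambda>t. P (a # t)) As) \<le> mean B (\<lambda>a. mean_tuple (\<lambda>t. P (a # t)) Bs + real (length As) * d)"
    by (intro mean_mono Cons.IH) (use Cons.prems in auto)
  also have "\<dots> = mean_tuple P (B # Bs) + real (length As) * d"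
    using Cons.prems(1) by (simp add: mean_add_const)
  finally show ?case by (simp add: algebra_simps)
qed simp

lemma mean_tuple_replicate:
  "M > 0 \<Longrightarrow> mean_tuple P (map (replicate M) as) = P as"
  by (induction "as" arbitrary: P) (auto simp: mean_replicate)

text \<open>Of the \<open>K\<close> steps, those past the end of \<open>ls\<close> merely produce
  \<open>M\<close> copies; so all constraints, whatever their arity, get the same total
  weight.\<close>

lemma sum_list_padded_product:
  assumes "\<And>l. l \<in> set ls \<Longrightarrow> length l = M" "length ls \<le> K" "M > 0"
  shows "(\<Sum>tp\<leftarrow>padded_product M K ls. P tp) = real M ^ K * mean_tuple P ls"
  using assms
proof (induction K arbitrary: ls P)
  case (Suc K)
  show ?case
  proof (cases ls)
    case Nil
    have "(\<Sum>x\<leftarrow>concat (replicate n xs). f x) = real n * (\<Sum>x\<leftarrow>xs. f x)" for n xs and f :: "'a list \<Rightarrow> real"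
      by (induction n) (auto simp: algebra_simps)
    then show ?thesis using Suc.IH[of "[]"] Suc.prems(3) Nil by simp
  next
    case (Cons l ls')
    have IH: "(\<Sum>tp\<leftarrow>padded_product M K ls'. P (x # tp)) = real M ^ K * mean_tuple (\<lambda>t. P (x # t)) ls'" for x
      using Suc.prems Cons by (intro Suc.IH) auto
    have "(\<Sum>tp\<leftarrow>padded_product M (Suc K) ls. P tp) = (\<Sum>x\<leftarrow>l. \<Sum>tp\<leftarrow>padded_product M K ls'. P (x # tp))"
      unfolding Cons by (simp, induction l) (auto simp: comp_def)
    also have "\<dots> = (\<Sum>x\<leftarrow>l. real M ^ K * mean_tuple (\<lambda>t. P (x # t)) ls')" by (simp only: IH)
    also have "\<dots> = real M ^ Suc K * mean_tuple P ls"
      using Suc.prems(1)[of l] Suc.prems(3) Cons by (simp add: mean_def sum_list_const_mult)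
    finally show ?thesis .
  qed
qed simp

section \<open>Fair coins and bounded differences\<close>

definition coin_mean :: "nat \<Rightarrow> (bool list \<Rightarrow> real) \<Rightarrow> real" where
  "coin_mean n \<phi> = (\<Sum>\<omega>\<in>coins n. \<phi> \<omega>) / 2 ^ n"

lemma coins_0: "coins 0 = {[]}"
  by (auto simp: coins_def)

lemma coins_Suc: "coins (Suc n) = (#) True ` coins n \<union> (#) False ` coins n"
proof (intro equalityI subsetI)
  fix \<omega> assume "\<omega> \<in> coins (Suc n)"
  then obtain b \<omega>' where "\<omega> = b # \<omega>'" "\<omega>' \<in> coins n" by (cases \<omega>) (auto simp: coins_def)
  then show "\<omega> \<in> (#) True ` coins n \<union> (#) False ` coins n" by (cases b) auto
qed (auto simp: coins_def)

lemma finite_coins [simp]: "finite (coins n)"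
  by (induction n) (auto simp: coins_0 coins_Suc)

lemma coin_mean_Suc: "coin_mean (Suc n) \<phi> = (coin_mean n (\<lambda>\<omega>. \<phi> (True # \<omega>)) + coin_mean n (\<lambda>\<omega>. \<phi> (False # \<omega>))) / 2"
proof -
  have "(\<Sum>\<omega>\<in>coins (Suc n). \<phi> \<omega>) = (\<Sum>\<omega>\<in>(#) True ` coins n. \<phi> \<omega>) + (\<Sum>\<omega>\<in>(#) False ` coins n. \<phi> \<omega>)"
    unfolding coins_Suc by (intro sum.union_disjoint) auto
  also have "\<dots> = (\<Sum>\<omega>\<in>coins n. \<phi> (True # \<omega>)) + (\<Sum>\<omega>\<in>coins n. \<phi> (False # \<omega>))"
    by (simp add: sum.reindex)
  finally show ?thesis by (simp add: coin_mean_def field_simps)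
qed

lemma card_coins: "card (coins n) = 2 ^ n"
proof -
  have "coin_mean n (\<lambda>_. 1) = 1" by (induction n) (simp_all add: coin_mean_Suc, simp add: coin_mean_def coins_0)
  then have "real (card (coins n)) = real (2 ^ n)" by (simp add: coin_mean_def field_simps)
  then show ?thesis by linarith
qed

lemma coins_nonempty [simp]: "coins n \<noteq> {}"
  using card_coins[of n] by (metis card.empty power_not_zero zero_neq_numeral)

lemma coin_mean_update:
  "k < n \<Longrightarrow> coin_mean n \<phi> = (coin_mean n (\<lambda>\<omega>. \<phi> (list_update \<omega> (k) True)) + coin_mean n (\<lambda>\<omega>. \<phi> (list_update \<omega> (k) False))) / 2"
proof (induction n arbitrary: k \<phi>)
  case (Suc n)
  show ?case
  proof (cases k)
    case 0
    then show ?thesis by (simp add: coin_mean_Suc)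
  next
    case (Suc k')
    have "coin_mean n (\<lambda>\<omega>. \<phi> (b # \<omega>)) = (coin_mean n (\<lambda>\<omega>. \<phi> (b # list_update \<omega> k' True)) + coin_mean n (\<lambda>\<omega>. \<phi> (b # list_update \<omega> (k') False))) / 2" for b
      using Suc.IH[of k' "\<lambda>\<omega>. \<phi> (b # \<omega>)"] Suc.prems Suc by simp
    note eq = this[of True] this[of False]
    show ?thesis
      unfolding coin_mean_Suc Suc list_update.simps nat.case eq by (simp add: field_simps)
  qed
qed simp

text \<open>Distinct coins are independent: each entry of the tuple is decided by a coin of its own,
  so its two outcomes form a two-element list.\<close>

lemma coin_mean_tuple:
  assumes "distinct (map src js)" "\<And>j. j \<in> set js \<Longrightarrow> src j < n"
  shows "coin_mean n (\<lambda>\<omega>. P (map (\<lambda>j. g j (\<omega> ! src j)) js)) = mean_tuple P (map (\<lambda>j. [g j True, g j False]) js)"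
  using assms
proof (induction js arbitrary: P)
  case Nil
  then show ?case by (simp add: coin_mean_def card_coins)
next
  case (Cons j js)
  have upd: "P (map (\<lambda>i. g i (list_update \<omega> (src j) b ! src i)) (j # js)) = P (g j b # map (\<lambda>i. g i (\<omega> ! src i)) js)"
    if "\<omega> \<in> coins n" for \<omega> b
  proof -
    have "map (\<lambda>i. g i (list_update \<omega> (src j) b ! src i)) js = map (\<lambda>i. g i (\<omega> ! src i)) js"
      using Cons.prems(1) by (intro map_cong refl arg_cong[of _ _ "g _"] nth_list_update_neq) auto
    then show ?thesis using that Cons.prems(2)[of j] by (simp only: list.map) (simp add: coins_def)
  qed
  have s1: "coin_mean n (\<lambda>\<omega>. P (map (\<lambda>i. g i (\<omega> ! src i)) (j # js))) =
    (coin_mean n (\<lambda>\<omega>. P (map (\<lambda>i. g i (list_update \<omega> (src j) True ! src i)) (j # js))) +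
     coin_mean n (\<lambda>\<omega>. P (map (\<lambda>i. g i (list_update \<omega> (src j) False ! src i)) (j # js)))) / 2"
    using coin_mean_update[of "src j" n "\<lambda>\<omega>. P (map (\<lambda>i. g i (\<omega> ! src i)) (j # js))"] Cons.prems(2) by simp
  have s2: "coin_mean n (\<lambda>\<omega>. P (map (\<lambda>i. g i (list_update \<omega> (src j) b ! src i)) (j # js))) =
      mean_tuple (\<lambda>t. P (g j b # t)) (map (\<lambda>j. [g j True, g j False]) js)" for b
    using Cons.IH[of "\<lambda>t. P (g j b # t)"] Cons.prems upd by (simp add: coin_mean_def cong: sum.cong)
  show ?case unfolding s1 s2 by (simp add: mean_def)
qed

text \<open>Read off from the estimate behind Hoeffding's lemma, for a fair coin with range
  \<open>2 * x\<close>.\<close>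

lemma cosh_le_exp_square: "(exp x + exp (- x)) / 2 \<le> exp (x\<^sup>2 / 2)" for x :: real
proof -
  have nonneg: "(exp x + exp (- x)) / 2 \<le> exp (x\<^sup>2 / 2)" if "x \<ge> 0" for x :: real
  proof -
    have "- (2 * x) * (1 / 2) + ln (1 + (1 / 2) * (exp (2 * x) - 1)) \<le> (2 * x)\<^sup>2 / 8"
      using Hoeffdings_lemma_aux[of "2 * x" "1 / 2"] that by simp
    then have "exp (- x + ln (1 + (1 / 2) * (exp (2 * x) - 1))) \<le> exp (x\<^sup>2 / 2)"
      by (simp add: power2_eq_square)
    moreover have "exp (- x + ln (1 + (1 / 2) * (exp (2 * x) - 1))) = exp (- x) * ((1 + exp (2 * x)) / 2)"
    proof -
      have pos: "1 + (1 / 2) * (exp (2 * x) - 1) > 0" by (simp add: field_simps add_pos_pos)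
      show ?thesis unfolding exp_add exp_ln[OF pos] by (simp add: field_simps)
    qed
    moreover have "exp (- x) * ((1 + exp (2 * x)) / 2) = (exp x + exp (- x)) / 2"
      by (simp add: distrib_left flip: exp_add)
    ultimately show ?thesis by (simp only:)
  qed
  show ?thesis
  proof (cases "x \<ge> 0")
    case False
    then show ?thesis using nonneg[of "- x"] by (simp add: add.commute)
  qed (rule nonneg)
qed

text \<open>Induction on the coins: the two means conditional on the first coin differ by at most
  \<open>c\<close>, so averaging over it costs a factor \<open>exp ((t * c)\<^sup>2 / 8)\<close>,
  and the factors of all coins multiply.\<close>

lemma bounded_differences_mgf:
  assumes "\<And>\<omega> k. \<omega> \<in> coins n \<Longrightarrow> k < n \<Longrightarrow> \<bar>h (list_update \<omega> (k) True) - h (list_update \<omega> (k) False)\<bar> \<le> c"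
  shows "coin_mean n (\<lambda>\<omega>. exp (t * h \<omega>)) \<le> exp (t * coin_mean n h + real n * (t * c)\<^sup>2 / 8)"
  using assms
proof (induction n arbitrary: h)
  case 0
  then show ?case by (simp add: coin_mean_def coins_0)
next
  case (Suc n)
  let ?m = "\<lambda>b. coin_mean n (\<lambda>\<omega>. h (b # \<omega>))"
  have IH: "coin_mean n (\<lambda>\<omega>. exp (t * h (b # \<omega>))) \<le> exp (t * ?m b + real n * (t * c)\<^sup>2 / 8)" for b
  proof (rule Suc.IH)
    fix \<omega> k assume "\<omega> \<in> coins n" "k < n"
    then show "\<bar>h (b # list_update \<omega> (k) True) - h (b # list_update \<omega> (k) False)\<bar> \<le> c"
      using Suc.prems[of "b # \<omega>" "Suc k"] by (simp add: coins_def)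
  qed
  have "\<bar>h (True # \<omega>) - h (False # \<omega>)\<bar> \<le> c" if "\<omega> \<in> coins n" for \<omega>
    using Suc.prems[of "True # \<omega>" 0] that by (simp add: coins_def)
  then have "\<bar>\<Sum>\<omega>\<in>coins n. h (True # \<omega>) - h (False # \<omega>)\<bar> \<le> (\<Sum>\<omega>\<in>coins n. c)"
    by (intro order_trans[OF sum_abs] sum_mono)
  then have "\<bar>?m True - ?m False\<bar> \<le> c"
    by (simp add: coin_mean_def card_coins sum_subtractf field_simps flip: diff_divide_distrib)
  then have diff: "(?m True - ?m False)\<^sup>2 \<le> c\<^sup>2" by (simp add: abs_le_square_iff[symmetric])
  define d where "d = t * (?m True - ?m False) / 2"
  have "coin_mean (Suc n) (\<lambda>\<omega>. exp (t * h \<omega>)) \<le>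
      (exp (t * ?m True + real n * (t * c)\<^sup>2 / 8) + exp (t * ?m False + real n * (t * c)\<^sup>2 / 8)) / 2"
    unfolding coin_mean_Suc using IH[of True] IH[of False] by simp
  also have "\<dots> = exp (t * coin_mean (Suc n) h + real n * (t * c)\<^sup>2 / 8) * ((exp d + exp (- d)) / 2)"
  proof -
    have "t * ?m True + real n * (t * c)\<^sup>2 / 8 = t * coin_mean (Suc n) h + real n * (t * c)\<^sup>2 / 8 + d"
      "t * ?m False + real n * (t * c)\<^sup>2 / 8 = t * coin_mean (Suc n) h + real n * (t * c)\<^sup>2 / 8 + - d"
      unfolding coin_mean_Suc d_def by (simp_all add: field_simps)
    then show ?thesis by (simp only: exp_add) (simp add: algebra_simps)
  qed
  also have "\<dots> \<le> exp (t * coin_mean (Suc n) h + real n * (t * c)\<^sup>2 / 8) * exp (d\<^sup>2 / 2)"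
    by (intro mult_left_mono cosh_le_exp_square) auto
  also have "d\<^sup>2 / 2 \<le> (t * c)\<^sup>2 / 8"
    using mult_left_mono[OF diff, of "t\<^sup>2"] by (simp add: d_def power_mult_distrib power_divide)
  finally show ?case by (simp add: exp_add[symmetric] distrib_right add_divide_distrib add_ac)
qed

lemma bounded_differences:
  assumes h: "\<And>\<omega> k. \<omega> \<in> coins n \<Longrightarrow> k < n \<Longrightarrow> \<bar>h (list_update \<omega> (k) True) - h (list_update \<omega> (k) False)\<bar> \<le> 2"
    and "\<tau> \<ge> 0" "real n \<le> W" "W > 0"
  shows "real (card {\<omega> \<in> coins n. h \<omega> > coin_mean n h + \<tau>}) / 2 ^ n \<le> exp (- (\<tau>\<^sup>2) / (2 * W))"
proof -
  \<comment> \<open>This \<open>t\<close> minimizes \<open>W * t\<^sup>2 / 2 - t * \<tau>\<close>,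
    the exponent of the Chernoff bound for differences of at most \<open>2\<close>.\<close>
  define t where "t = \<tau> / W"
  have t: "t \<ge> 0" unfolding t_def using assms by simp
  let ?A = "{\<omega> \<in> coins n. h \<omega> > coin_mean n h + \<tau>}"
  have "real (card ?A) * exp (t * (coin_mean n h + \<tau>)) = (\<Sum>\<omega>\<in>?A. exp (t * (coin_mean n h + \<tau>)))" by simp
  also have "\<dots> \<le> (\<Sum>\<omega>\<in>?A. exp (t * h \<omega>))" using t by (intro sum_mono) (auto intro: mult_left_mono)
  also have "\<dots> \<le> (\<Sum>\<omega>\<in>coins n. exp (t * h \<omega>))" by (intro sum_mono2) auto
  also have "\<dots> = 2 ^ n * coin_mean n (\<lambda>\<omega>. exp (t * h \<omega>))" by (simp add: coin_mean_def)
  also have "\<dots> \<le> 2 ^ n * exp (t * coin_mean n h + real n * (t * 2)\<^sup>2 / 8)"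
    by (intro mult_left_mono bounded_differences_mgf h) auto
  finally have "real (card ?A) / 2 ^ n \<le> exp (t * coin_mean n h + real n * (t * 2)\<^sup>2 / 8) / exp (t * (coin_mean n h + \<tau>))"
    by (simp add: field_simps)
  also have "\<dots> = exp (real n * t\<^sup>2 / 2 - t * \<tau>)"
    by (simp add: exp_diff[symmetric] power_mult_distrib algebra_simps)
  also have "\<dots> \<le> exp (W * t\<^sup>2 / 2 - t * \<tau>)" using assms(3) by (simp add: mult_right_mono)
  also have "W * t\<^sup>2 / 2 - t * \<tau> = - (\<tau>\<^sup>2) / (2 * W)"
    using assms(4) by (simp add: t_def power2_eq_square field_simps)
  finally show ?thesis .
qed

section \<open>Halving the degree\<close>

definition positions :: "'a \<Rightarrow> 'a list \<Rightarrow> nat list" where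
  "positions x xs = filter (\<lambda>j. xs ! j = x) [0..<length xs]"

lemma positions_Cons:
  "positions y (x # xs) = (if x = y then [0] else []) @ map Suc (positions y xs)"
  by (simp add: positions_def upt_conv_Cons map_Suc_upt[symmetric] filter_map comp_def del: upt_Suc)

lemma set_positions: "set (positions x xs) = {j. j < length xs \<and> xs ! j = x}"
  by (auto simp: positions_def)

text \<open>The bit assigned to the slot \<open>j\<close> is \<open>(\<beta> ! coin_pos xs j) = coin_sign xs j\<close>, where \<open>\<beta>\<close> are the coins.\<close>

fun coin_pos :: "'a list \<Rightarrow> nat \<Rightarrow> nat" where
  "coin_pos [] j = 0"
| "coin_pos (x # xs) 0 = (if even (length (positions x xs)) then 0 else Suc (coin_pos xs (hd (positions x xs))))"
| "coin_pos (x # xs) (Suc j) = Suc (coin_pos xs j)"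

fun coin_sign :: "'a list \<Rightarrow> nat \<Rightarrow> bool" where
  "coin_sign [] j = True"
| "coin_sign (x # xs) 0 = (if even (length (positions x xs)) then True else \<not> coin_sign xs (hd (positions x xs)))"
| "coin_sign (x # xs) (Suc j) = coin_sign xs j"

lemma hd_positions:
  assumes "odd (length (positions x xs))"
  shows "hd (positions x xs) < length xs \<and> xs ! hd (positions x xs) = x"
proof -
  have "positions x xs \<noteq> []" using assms by auto
  then have "hd (positions x xs) \<in> set (positions x xs)" by (rule hd_in_set)
  then show ?thesis by (simp add: set_positions)
qed

text \<open>The coin of a slot sits at a slot of the same variable; so slots of different variables
  never share a coin.\<close>

lemma coin_pos_less:
  "j < length xs \<Longrightarrow> coin_pos xs j < length xs \<and> xs ! coin_pos xs j = xs ! j"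
proof (induction xs arbitrary: j)
  case (Cons x xs)
  show ?case
  proof (cases j)
    case 0
    then show ?thesis using Cons.IH[of "hd (positions x xs)"] hd_positions[of x xs] by auto
  next
    case (Suc i)
    then show ?thesis using Cons.IH[of i] Cons.prems by simp
  qed
qed simp

text \<open>The second part carries the induction: while the slots of \<open>y\<close> are odd in
  number, the leftmost one has no partner yet and is alone in using its coin, so a new slot of
  \<open>y\<close> may share it.\<close>

lemma card_coin_pos_eq:
  "card {j. j < length xs \<and> coin_pos xs j = k} \<le> 2 \<and>
   (odd (length (positions y xs)) \<longrightarrow>
      card {j. j < length xs \<and> coin_pos xs j = coin_pos xs (hd (positions y xs))} \<le> 1)"
proof (induction xs arbitrary: k y)
  case Nil
  then show ?case by (simp add: positions_def)
next
  case (Cons x xs)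
  let ?A = "\<lambda>xs k. {j. j < length xs \<and> coin_pos xs j = k}"
  have A0: "?A (x # xs) 0 \<subseteq> {0}"
  proof
    fix j assume "j \<in> ?A (x # xs) 0"
    then show "j \<in> {0}" by (cases j) auto
  qed
  have AS: "?A (x # xs) (Suc k) \<subseteq> (if coin_pos (x # xs) 0 = Suc k then {0} else {}) \<union> Suc ` ?A xs k" for k
  proof
    fix j assume "j \<in> ?A (x # xs) (Suc k)"
    then show "j \<in> (if coin_pos (x # xs) 0 = Suc k then {0} else {}) \<union> Suc ` ?A xs k"
      by (cases j) auto
  qed
  have cS: "card (?A (x # xs) (Suc k)) \<le> (if coin_pos (x # xs) 0 = Suc k then 1 else 0) + card (?A xs k)" for k
  proof -
    have "card (?A (x # xs) (Suc k)) \<le> card ((if coin_pos (x # xs) 0 = Suc k then {0} else {}) \<union> Suc ` ?A xs k)"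
      by (rule card_mono[OF _ AS]) auto
    also have "\<dots> \<le> card (if coin_pos (x # xs) 0 = Suc k then {0 :: nat} else {}) + card (Suc ` ?A xs k)"
      by (rule card_Un_le)
    finally show ?thesis by (simp add: card_image split: if_splits)
  qed
  have c0: "card (?A (x # xs) 0) \<le> 1" using card_mono[OF _ A0] by simp
  have "card (?A (x # xs) k) \<le> 2"
  proof (cases k)
    case 0
    then show ?thesis using c0 by simp
  next
    case (Suc i)
    show ?thesis
    proof (cases "coin_pos (x # xs) 0 = Suc i")
      case True
      then have "odd (length (positions x xs))" "i = coin_pos xs (hd (positions x xs))"
        by (auto split: if_splits)
      then have "card (?A xs i) \<le> 1" using Cons.IH[of i x] by simp
      then show ?thesis using cS[of i] Suc True by simp
    next
      case False
      then show ?thesis using cS[of i] Suc Cons.IH[of i x] by simp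
    qed
  qed
  moreover have "card (?A (x # xs) (coin_pos (x # xs) (hd (positions y (x # xs))))) \<le> 1"
    if odd: "odd (length (positions y (x # xs)))"
  proof (cases "x = y")
    case True
    then have "coin_pos (x # xs) 0 = 0" using odd by (simp add: positions_Cons)
    then show ?thesis using True c0 by (simp add: positions_Cons)
  next
    case False
    then have oy: "odd (length (positions y xs))" using odd by (simp add: positions_Cons)
    then have "positions y xs \<noteq> []" by auto
    then have h: "hd (positions y (x # xs)) = Suc (hd (positions y xs))"
      using False by (simp add: positions_Cons hd_map)
    have "coin_pos (x # xs) 0 \<noteq> Suc (coin_pos xs (hd (positions y xs)))"
    proof
      assume "coin_pos (x # xs) 0 = Suc (coin_pos xs (hd (positions y xs)))"
      then have ox: "odd (length (positions x xs))" and
        eq: "coin_pos xs (hd (positions x xs)) = coin_pos xs (hd (positions y xs))"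
        by (auto split: if_splits)
      show False
        using coin_pos_less[of "hd (positions x xs)" xs] coin_pos_less[of "hd (positions y xs)" xs]
          hd_positions[OF ox] hd_positions[OF oy] eq False by simp
    qed
    then have "card (?A (x # xs) (Suc (coin_pos xs (hd (positions y xs))))) \<le> card (?A xs (coin_pos xs (hd (positions y xs))))"
      using cS[of "coin_pos xs (hd (positions y xs))"] by simp
    then show ?thesis using Cons.IH[of k y] oy unfolding h by simp
  qed
  ultimately show ?case by blast
qed

lemma split_bits_conv:
  "length bs = length xs \<Longrightarrow>
   split_bits (zip xs bs) = map (\<lambda>j. (xs ! j, (bs ! coin_pos xs j) = coin_sign xs j)) [0..<length xs]"
proof (induction xs arbitrary: bs)
  case Nil
  then show ?case by (simp add: split_bits_def)
next
  case (Cons x xs)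
  then obtain b bs' where bs: "bs = b # bs'" "length bs' = length xs" by (cases bs) auto
  let ?\<phi> = "\<lambda>j. (xs ! j, (bs' ! coin_pos xs j) = coin_sign xs j)"
  have out: "split_bits (zip xs bs') = map ?\<phi> [0..<length xs]" using Cons.IH bs(2) by blast
  have fil: "filter (\<lambda>r. fst r = x) (map ?\<phi> [0..<length xs]) = map ?\<phi> (positions x xs)"
    by (simp add: filter_map comp_def positions_def)
  have step: "split_bits (zip (x # xs) bs) = split_step (x, b) (split_bits (zip xs bs'))"
    by (simp add: split_bits_def bs)
  have ne: "positions x xs \<noteq> []" if "odd (length (positions x xs))" using that by auto
  have "split_bits (zip (x # xs) bs) =
      (x, if even (length (positions x xs)) then b
          else \<not> ((bs' ! coin_pos xs (hd (positions x xs))) = coin_sign xs (hd (positions x xs)))) # map ?\<phi> [0..<length xs]"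
    unfolding step split_step_def out fst_conv snd_conv fil using ne by (auto simp: hd_map)
  then show ?case
    by (auto simp: upt_conv_Cons map_Suc_upt[symmetric] comp_def bs simp del: upt_Suc)
qed

lemma halve_conv:
  assumes "length bs = length xs"
  shows "halve xs bs = map (\<lambda>j. 2 * xs ! j + (if (bs ! coin_pos xs j) = coin_sign xs j then 1 else 0)) [0..<length xs]"
  by (simp add: halve_def split_bits_conv[OF assms] comp_def)

lemma halve_take: "halve xs (take (length xs) bs) = halve xs bs"
proof -
  have "zip xs (take (length xs) bs) = take (length xs) (zip xs bs)" by (simp add: take_zip)
  then show ?thesis by (simp add: halve_def)
qed

lemma halve_div_2: "length xs \<le> length bs \<Longrightarrow> map (\<lambda>y. y div 2) (halve xs bs) = xs"
proof -
  assume "length xs \<le> length bs"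
  then have "map fst (split_bits (zip xs bs)) = xs" by (simp add: map_fst_split_bits map_fst_zip_take)
  moreover have "map (\<lambda>y. y div 2) (halve xs bs) = map fst (split_bits (zip xs bs))"
    by (auto simp: halve_def)
  ultimately show ?thesis by simp
qed

text \<open>Invariant of the scan from the right: with an even number of slots of \<open>u\<close>
  the two bits are balanced; with an odd number the most recent slot holds the one surplus bit,
  which the next slot of \<open>u\<close> cancels by negation.\<close>

lemma split_bits_balanced:
  fixes ps u
  defines "out \<equiv> split_bits ps"
  defines "fs \<equiv> filter (\<lambda>r. fst r = u) out"
  shows "if even (length fs) then count_list out (u, True) = count_list out (u, False)
     else count_list out (hd fs) = Suc (count_list out (u, \<not> snd (hd fs)))"
  unfolding fs_def out_def
proof (induction ps)
  case (Cons p ps)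
  define out where "out = split_bits ps"
  define fs where "fs = filter (\<lambda>r. fst r = u) out"
  have IH: "if even (length fs) then count_list out (u, True) = count_list out (u, False)
     else count_list out (hd fs) = Suc (count_list out (u, \<not> snd (hd fs)))"
    using Cons unfolding fs_def out_def .
  have step: "split_bits (p # ps) = split_step p out" by (simp add: split_bits_def out_def)
  have hd: "hd fs = (u, snd (hd fs))" if "odd (length fs)"
  proof -
    have "fs \<noteq> []" using that by auto
    then have "hd fs \<in> set fs" by (rule hd_in_set)
    then show ?thesis by (simp add: fs_def prod_eq_iff)
  qed
  show ?case
  proof (cases "fst p = u")
    case False
    then show ?thesis unfolding step split_step_def using IH hd
      by (auto simp: fs_def dest!: arg_cong[of _ _ fst])
  next
    case True
    show ?thesis
    proof (cases "even (length fs)")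
      case e: True
      then show ?thesis unfolding step split_step_def using IH True
        by (cases "snd p") (simp_all add: fs_def)
    next
      case o: False
      then have "hd fs = (u, snd (hd fs))" by (rule hd)
      then show ?thesis unfolding step split_step_def using IH True o
        by (cases "snd (hd fs)") (simp_all flip: fs_def)
    qed
  qed
qed (simp add: split_bits_def)

lemma count_list_map_inj: "inj g \<Longrightarrow> count_list (map g xs) (g x) = count_list xs x"
  by (induction xs) (auto dest: injD)

text \<open>The bits are balanced for all coins and not just on average, so an even degree is halved
  exactly.\<close>

lemma count_list_halve:
  assumes "length xs \<le> length bs" "even (count_list xs u)"
  shows "2 * count_list (halve xs bs) (2 * u + (if b then 1 else 0)) = count_list xs u"
proof -
  let ?out = "split_bits (zip xs bs)" and ?g = "\<lambda>p :: nat \<times> bool. 2 * fst p + (if snd p then 1 else 0)"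
  have inj: "inj ?g" by (rule injI) (auto simp: prod_eq_iff split: if_splits; presburger)
  have cnt: "count_list (halve xs bs) (2 * u + (if b then 1 else 0)) = count_list ?out (u, b)" for b
    unfolding halve_def using count_list_map_inj[OF inj, of ?out "(u, b)"] by (simp only: fst_conv snd_conv)
  have sum: "count_list out (u, True) + count_list out (u, False) = length (filter (\<lambda>r. fst r = u) out)"
    for out :: "(nat \<times> bool) list"
    by (induction out) auto
  have "length (filter (\<lambda>r. fst r = u) out) = count_list (map fst out) u" for out :: "(nat \<times> bool) list"
    by (induction out) auto
  then have "length (filter (\<lambda>r. fst r = u) ?out) = count_list (map fst ?out) u" .
  also have "\<dots> = count_list xs u" using assms(1) by (simp add: map_fst_split_bits map_fst_zip_take)
  finally have len: "length (filter (\<lambda>r. fst r = u) ?out) = count_list xs u" .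
  have "count_list ?out (u, True) = count_list ?out (u, False)"
    using split_bits_balanced[where ps = "zip xs bs" and u = u] assms(2) len by simp
  then show ?thesis using sum[of ?out] len cnt[of b] by (cases b) auto
qed

section \<open>One halving step\<close>

lemma relabel_map: "relabel cs (map h xs) = map (\<lambda>p. (fst p, map h (snd p))) (relabel cs xs)"
  by (induction cs xs rule: relabel.induct) (auto simp: take_map drop_map)

lemma slots_relabel: "length xs = length (slots cs) \<Longrightarrow> slots (relabel cs xs) = xs"
  by (induction cs xs rule: relabel.induct) (auto simp: slots_def)

lemma length_relabel [simp]: "length (relabel cs xs) = length cs"
  by (induction cs xs rule: relabel.induct) auto

lemma relabel_slots: "relabel cs (slots cs) = cs"
  by (induction cs) (auto simp: slots_def)

definition satisfied :: "(nat \<Rightarrow> nat list \<Rightarrow> real) \<Rightarrow> (nat \<times> nat list) list \<Rightarrow> (nat \<Rightarrow> nat) \<Rightarrow> real" where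
  "satisfied Q cs \<zeta> = (\<Sum>p\<leftarrow>cs. Q (fst p) (map \<zeta> (snd p)))"

text \<open>The multilinear extension of \<open>satisfied\<close>: every variable draws its value
  independently and uniformly from its list.\<close>

definition satisfied_mean :: "(nat \<Rightarrow> nat list \<Rightarrow> real) \<Rightarrow> (nat \<times> nat list) list \<Rightarrow> (nat \<Rightarrow> nat list) \<Rightarrow> real" where
  "satisfied_mean Q cs pl = (\<Sum>p\<leftarrow>cs. mean_tuple (Q (fst p)) (map pl (snd p)))"

lemma coin_mean_sum_list: "coin_mean n (\<lambda>\<omega>. \<Sum>x\<leftarrow>xs. \<phi> x \<omega>) = (\<Sum>x\<leftarrow>xs. coin_mean n (\<phi> x))"
  by (induction xs) (auto simp: coin_mean_def sum.distrib add_divide_distrib)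

lemma sum_list_length_filter:
  "(\<Sum>p\<leftarrow>cs. real (length (filter R (snd p)))) = real (length (filter R (slots cs)))"
  by (induction cs) (auto simp: slots_def)

definition distinct_scopes :: "(nat \<times> 'v list) list \<Rightarrow> bool" where
  "distinct_scopes cs \<longleftrightarrow> (\<forall>p\<in>set cs. distinct (snd p))"

context
  fixes cs :: "(nat \<times> nat list) list" and xs :: "nat list" and Q :: "nat \<Rightarrow> nat list \<Rightarrow> real"
  assumes len: "length xs = length (slots cs)" and dist: "distinct_scopes (relabel cs xs)"
    and Q: "\<And>i t. 0 \<le> Q i t \<and> Q i t \<le> 1"
begin


text \<open>In \<open>relabel cs [0..<length xs]\<close> the scopes list slot indices instead of
  variables; this is the form in which single coins can be traced.\<close>

private lemma pcs: "p \<in> set (relabel cs [0..<length xs]) \<Longrightarrow> set (snd p) \<subseteq> {..<length xs}"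
  using set_relabel[of "fst p" "snd p" cs "[0..<length xs]"] by auto

private lemma satisfied_halve:
  assumes "length \<beta> = length xs"
  shows "satisfied Q (relabel cs (halve xs \<beta>)) \<zeta> =
    (\<Sum>p\<leftarrow>relabel cs [0..<length xs]. Q (fst p) (map (\<lambda>j. \<zeta> (2 * xs ! j + (if (\<beta> ! coin_pos xs j) = coin_sign xs j then 1 else 0))) (snd p)))"
  unfolding satisfied_def halve_conv[OF assms] relabel_map by (simp add: comp_def)

text \<open>Equal coins would mean equal variables, which a scope excludes; the bits within one
  constraint are thus independent.\<close>

private lemma distinct_coin_pos:
  assumes p: "p \<in> set (relabel cs [0..<length xs])"
  shows "distinct (map (coin_pos xs) (snd p))"
proof -
  have "relabel cs xs = relabel cs (map ((!) xs) [0..<length xs])" by (simp add: map_nth)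
  then have "(fst p, map ((!) xs) (snd p)) \<in> set (relabel cs xs)" using p unfolding relabel_map by force
  then have "distinct (map ((!) xs) (snd p))" using dist unfolding distinct_scopes_def by force
  moreover have "map ((!) xs) (map (coin_pos xs) (snd p)) = map ((!) xs) (snd p)"
    using pcs[OF p] coin_pos_less by (auto simp: subset_iff)
  ultimately show ?thesis by (metis distinct_map)
qed

lemma coin_mean_satisfied_halve:
  "coin_mean (length xs) (\<lambda>\<beta>. satisfied Q (relabel cs (halve xs \<beta>)) \<zeta>) =
   satisfied_mean Q (relabel cs xs) (\<lambda>u. [\<zeta> (2 * u), \<zeta> (2 * u + 1)])"
proof -
  let ?g = "\<lambda>j b. \<zeta> (2 * xs ! j + (if b = coin_sign xs j then 1 else 0))"
  have "coin_mean (length xs) (\<lambda>\<beta>. satisfied Q (relabel cs (halve xs \<beta>)) \<zeta>) =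
      coin_mean (length xs) (\<lambda>\<beta>. \<Sum>p\<leftarrow>relabel cs [0..<length xs]. Q (fst p) (map (\<lambda>j. ?g j (\<beta> ! coin_pos xs j)) (snd p)))"
    unfolding coin_mean_def by (intro arg_cong2[of _ _ _ _ "(/)"] sum.cong refl) (auto simp: satisfied_halve coins_def)
  also have "\<dots> = (\<Sum>p\<leftarrow>relabel cs [0..<length xs]. mean_tuple (Q (fst p)) (map (\<lambda>j. [?g j True, ?g j False]) (snd p)))"
    unfolding coin_mean_sum_list
  proof (intro arg_cong[of _ _ sum_list] map_cong refl)
    fix p assume p: "p \<in> set (relabel cs [0..<length xs])"
    show "coin_mean (length xs) (\<lambda>\<beta>. Q (fst p) (map (\<lambda>j. ?g j (\<beta> ! coin_pos xs j)) (snd p))) =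
        mean_tuple (Q (fst p)) (map (\<lambda>j. [?g j True, ?g j False]) (snd p))"
      by (rule coin_mean_tuple[OF distinct_coin_pos[OF p]]) (use pcs[OF p] coin_pos_less in auto)
  qed
  \<comment> \<open>The sign of a slot only swaps the two values, which leaves their mean
    unchanged.\<close>
  also have "\<dots> = (\<Sum>p\<leftarrow>relabel cs [0..<length xs]. mean_tuple (Q (fst p)) (map (\<lambda>j. [\<zeta> (2 * xs ! j), \<zeta> (2 * xs ! j + 1)]) (snd p)))"
  proof (intro arg_cong[of _ _ sum_list] map_cong refl mean_tuple_cong)
    fix p :: "nat \<times> nat list"
    show "list_all2 (\<lambda>A B. \<forall>h. mean A h = mean B h) (map (\<lambda>j. [?g j True, ?g j False]) (snd p))
        (map (\<lambda>j. [\<zeta> (2 * xs ! j), \<zeta> (2 * xs ! j + 1)]) (snd p))"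
      by (auto simp: list_all2_conv_all_nth mean_def)
  qed
  also have "\<dots> = satisfied_mean Q (relabel cs (map ((!) xs) [0..<length xs])) (\<lambda>u. [\<zeta> (2 * u), \<zeta> (2 * u + 1)])"
    unfolding satisfied_mean_def relabel_map by (simp add: comp_def)
  finally show ?thesis by (simp add: map_nth)
qed

text \<open>A coin decides at most two slots, every slot lies in exactly one constraint of the list,
  and a constraint contributes between 0 and 1.\<close>

lemma satisfied_halve_bounded_difference:
  assumes "\<beta> \<in> coins (length xs)" "k < length xs"
  shows "\<bar>satisfied Q (relabel cs (halve xs (list_update \<beta> k True))) \<zeta> - satisfied Q (relabel cs (halve xs (list_update \<beta> k False))) \<zeta>\<bar> \<le> 2"
proof -
  let ?A = "{j. j < length xs \<and> coin_pos xs j = k}"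
  let ?f = "\<lambda>b p. Q (fst p) (map (\<lambda>j. \<zeta> (2 * xs ! j + (if (list_update \<beta> k b ! coin_pos xs j) = coin_sign xs j then 1 else 0))) (snd p))"
  have s: "satisfied Q (relabel cs (halve xs (list_update \<beta> k b))) \<zeta> = (\<Sum>p\<leftarrow>relabel cs [0..<length xs]. ?f b p)" for b
    using assms by (intro satisfied_halve) (simp add: coins_def)
  have "\<bar>(\<Sum>p\<leftarrow>relabel cs [0..<length xs]. ?f True p) - (\<Sum>p\<leftarrow>relabel cs [0..<length xs]. ?f False p)\<bar> = \<bar>\<Sum>p\<leftarrow>relabel cs [0..<length xs]. ?f True p - ?f False p\<bar>"
    by (simp add: sum_list_subtractf)
  also have "\<dots> \<le> (\<Sum>p\<leftarrow>relabel cs [0..<length xs]. \<bar>?f True p - ?f False p\<bar>)"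
    using sum_list_abs[of "map (\<lambda>p. ?f True p - ?f False p) (relabel cs [0..<length xs])"] by (simp add: comp_def)
  also have "\<dots> \<le> (\<Sum>p\<leftarrow>relabel cs [0..<length xs]. real (length (filter (\<lambda>j. j \<in> ?A) (snd p))))"
  proof (rule sum_list_mono)
    fix p assume p: "p \<in> set (relabel cs [0..<length xs])"
    show "\<bar>?f True p - ?f False p\<bar> \<le> real (length (filter (\<lambda>j. j \<in> ?A) (snd p)))"
    proof (cases "filter (\<lambda>j. j \<in> ?A) (snd p) = []")
      case True
      then have "\<forall>j\<in>set (snd p). coin_pos xs j \<noteq> k" using pcs[OF p] by (auto simp: filter_empty_conv)
      then have "?f True p = ?f False p"
        by (intro arg_cong[of _ _ "Q (fst p)"] map_cong refl) auto
      then show ?thesis by simp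
    next
      case False
      then have "1 \<le> real (length (filter (\<lambda>j. j \<in> ?A) (snd p)))" by (cases "filter (\<lambda>j. j \<in> ?A) (snd p)") auto
      moreover have "\<bar>a - b\<bar> \<le> 1" if "0 \<le> a \<and> a \<le> 1" "0 \<le> b \<and> b \<le> 1" for a b :: real using that by linarith
      ultimately show ?thesis using Q by (meson order_trans)
    qed
  qed
  also have "\<dots> = real (length (filter (\<lambda>j. j \<in> ?A) (slots (relabel cs [0..<length xs]))))"
    by (rule sum_list_length_filter)
  also have "slots (relabel cs [0..<length xs]) = [0..<length xs]" using len by (intro slots_relabel) simp
  also have "length (filter (\<lambda>j. j \<in> ?A) [0..<length xs]) = card ?A"
    by (subst distinct_length_filter) (auto intro: arg_cong[of _ _ card])
  also have "real (card ?A) \<le> 2" using card_coin_pos_eq[of xs k] by (simp add: numeral_le_real_of_nat_iff)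
  finally show ?thesis by (simp add: s)
qed

end

text \<open>Only the upper deviation is controlled: an assignment of the split instance must not be
  much better than the random choice it induces. The converse comparison is obtained by copying
  assignments.\<close>

definition level_ok :: "(nat \<Rightarrow> nat list \<Rightarrow> real) \<Rightarrow> nat \<Rightarrow> (nat \<times> nat list) list \<Rightarrow> nat \<Rightarrow> real \<Rightarrow> nat list \<Rightarrow> bool list \<Rightarrow> bool" where
  "level_ok Q q cs N \<tau> xs \<beta> \<longleftrightarrow> (\<forall>\<zeta> \<in> {..<2 * N} \<rightarrow>\<^sub>E {1..q}.
     satisfied Q (relabel cs (halve xs \<beta>)) \<zeta> \<le>
     satisfied_mean Q (relabel cs xs) (\<lambda>u. [\<zeta> (2 * u), \<zeta> (2 * u + 1)]) + \<tau>)"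

lemma level_ok_probability:
  assumes "length xs = length (slots cs)" "distinct_scopes (relabel cs xs)" "\<And>i t. 0 \<le> Q i t \<and> Q i t \<le> 1"
    and "\<tau> \<ge> 0" "real (length xs) \<le> W" "W > 0"
  shows "real (card {\<beta> \<in> coins (length xs). \<not> level_ok Q q cs N \<tau> xs \<beta>}) / 2 ^ length xs
    \<le> real q ^ (2 * N) * exp (- (\<tau>\<^sup>2) / (2 * W))"
proof -
  let ?Z = "{..<2 * N} \<rightarrow>\<^sub>E {1..q}"
  let ?n = "length xs"
  let ?h = "\<lambda>\<zeta> \<beta>. satisfied Q (relabel cs (halve xs \<beta>)) \<zeta>"
  let ?A = "\<lambda>\<zeta>. {\<beta> \<in> coins ?n. ?h \<zeta> \<beta> > coin_mean ?n (?h \<zeta>) + \<tau>}"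
  have fin: "finite ?Z" by (intro finite_PiE) auto
  have "{\<beta> \<in> coins ?n. \<not> level_ok Q q cs N \<tau> xs \<beta>} \<subseteq> (\<Union>\<zeta>\<in>?Z. ?A \<zeta>)"
    unfolding level_ok_def coin_mean_satisfied_halve[OF assms(1-3)] by (auto simp: not_le)
  then have "card {\<beta> \<in> coins ?n. \<not> level_ok Q q cs N \<tau> xs \<beta>} \<le> card (\<Union>\<zeta>\<in>?Z. ?A \<zeta>)"
    by (intro card_mono finite_UN_I fin) auto
  also have "\<dots> \<le> (\<Sum>\<zeta>\<in>?Z. card (?A \<zeta>))" by (rule card_UN_le[OF fin])
  finally have "real (card {\<beta> \<in> coins ?n. \<not> level_ok Q q cs N \<tau> xs \<beta>}) \<le> real (\<Sum>\<zeta>\<in>?Z. card (?A \<zeta>))"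
    by linarith
  then have "real (card {\<beta> \<in> coins ?n. \<not> level_ok Q q cs N \<tau> xs \<beta>}) / 2 ^ ?n \<le> real (\<Sum>\<zeta>\<in>?Z. card (?A \<zeta>)) / 2 ^ ?n"
    by (rule divide_right_mono) simp
  also have "\<dots> = (\<Sum>\<zeta>\<in>?Z. real (card (?A \<zeta>)) / 2 ^ ?n)"
    by (simp add: sum_divide_distrib)
  also have "\<dots> \<le> (\<Sum>\<zeta>\<in>?Z. exp (- (\<tau>\<^sup>2) / (2 * W)))"
    by (intro sum_mono bounded_differences satisfied_halve_bounded_difference assms)
  also have "\<dots> = real q ^ (2 * N) * exp (- (\<tau>\<^sup>2) / (2 * W))"
    by (simp add: card_PiE)
  finally show ?thesis .
qed

text \<open>Some entry of a list reaches at least the average, so the lists can be frozen one after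
  another to constant ones without decreasing \<Phi>.\<close>

lemma multi_affine_extreme_point:
  fixes \<Phi> :: "(nat \<Rightarrow> 'a list) \<Rightarrow> real"
  assumes affine: "\<And>pl w. w < n \<Longrightarrow> (\<And>v. v < n \<Longrightarrow> length (pl v) = M) \<Longrightarrow>
      \<Phi> pl = mean (pl w) (\<lambda>a. \<Phi> (pl(w := replicate M a)))"
    and pl: "\<And>v. v < n \<Longrightarrow> length (pl v) = M" and "M > 0"
  shows "\<exists>\<zeta>. (\<forall>w<n. \<zeta> w \<in> set (pl w)) \<and> \<Phi> pl \<le> \<Phi> (\<lambda>w. if w < n then replicate M (\<zeta> w) else pl w)"
proof -
  have "k \<le> n \<Longrightarrow> \<exists>\<zeta>. (\<forall>w<k. \<zeta> w \<in> set (pl w)) \<and> \<Phi> pl \<le> \<Phi> (\<lambda>w. if w < k then replicate M (\<zeta> w) else pl w)" for k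
  proof (induction k)
    case 0
    then show ?case by simp
  next
    case (Suc k)
    then obtain \<zeta> where \<zeta>: "\<forall>w<k. \<zeta> w \<in> set (pl w)" "\<Phi> pl \<le> \<Phi> (\<lambda>w. if w < k then replicate M (\<zeta> w) else pl w)"
      by auto
    let ?pl = "\<lambda>w. if w < k then replicate M (\<zeta> w) else pl w"
    have "\<Phi> ?pl = mean (?pl k) (\<lambda>a. \<Phi> (?pl(k := replicate M a)))"
      using Suc.prems pl by (intro affine) auto
    moreover have "?pl k \<noteq> []" using pl[of k] Suc.prems \<open>M > 0\<close> by auto
    ultimately obtain a where a: "a \<in> set (pl k)" "\<Phi> ?pl \<le> \<Phi> (?pl(k := replicate M a))"
      using ex_mean_le[of "?pl k" "\<lambda>a. \<Phi> (?pl(k := replicate M a))"] by auto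
    have "?pl(k := replicate M a) = (\<lambda>w. if w < Suc k then replicate M ((\<zeta>(k := a)) w) else pl w)"
      by (auto simp: less_Suc_eq)
    then show ?case using a \<zeta> by (intro exI[of _ "\<zeta>(k := a)"]) (auto simp: less_Suc_eq)
  qed
  then show ?thesis by blast
qed

lemma satisfied_mean_affine:
  assumes "distinct_scopes cs" "length (pl w) = M" "M > 0"
  shows "satisfied_mean Q cs pl = mean (pl w) (\<lambda>a. satisfied_mean Q cs (pl(w := replicate M a)))"
  unfolding satisfied_mean_def mean_sum_list
proof (intro arg_cong[of _ _ sum_list] map_cong refl)
  fix p assume "p \<in> set cs"
  then show "mean_tuple (Q (fst p)) (map pl (snd p)) =
      mean (pl w) (\<lambda>a. mean_tuple (Q (fst p)) (map (pl(w := replicate M a)) (snd p)))"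
    using assms by (intro mean_tuple_affine[where u = w]) (auto simp: distinct_scopes_def mean_replicate)
qed

text \<open>The list of a variable before splitting. If both parts have the same length, a uniform
  draw amounts to choosing one of the two new variables by a fair coin and then drawing from its
  list.\<close>

definition merge :: "(nat \<Rightarrow> 'a list) \<Rightarrow> nat \<Rightarrow> 'a list" where
  "merge pl u = pl (2 * u) @ pl (2 * u + 1)"

lemma mean_merge_affine:
  assumes "length (pl (2 * u)) = M" "length (pl (2 * u + 1)) = M" "M > 0" "w div 2 = u"
  shows "mean (merge pl u) h = mean (pl w) (\<lambda>a. mean (merge (pl(w := replicate M a)) u) h)"
proof -
  have half: "mean l (\<lambda>a. (h a + c) / 2) = (mean l h + c) / 2" if "l \<noteq> []" for l c
  proof -
    have "(\<Sum>a\<leftarrow>l. (h a + c) / 2) = (\<Sum>a\<leftarrow>l. h a + c) / 2" by (induction l) (auto simp: add_divide_distrib)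
    then have "mean l (\<lambda>a. (h a + c) / 2) = mean l (\<lambda>a. h a + c) / 2" by (simp only: mean_def) simp
    then show ?thesis by (simp only: mean_add_const[OF that])
  qed
  have w: "w = 2 * u \<or> w = 2 * u + 1" using assms(4) by presburger
  then have ne: "pl w \<noteq> []" using assms(1-3) by auto
  from w show ?thesis
  proof
    assume w: "w = 2 * u"
    have eq: "mean (merge (pl(w := replicate M a)) u) h = (h a + mean (pl (2 * u + 1)) h) / 2" for a
      using assms unfolding merge_def w by (subst mean_append) (auto simp: mean_replicate)
    have "mean (merge pl u) h = (mean (pl w) h + mean (pl (2 * u + 1)) h) / 2"
      using assms by (simp add: merge_def mean_append w)
    also have "\<dots> = mean (pl w) (\<lambda>a. (h a + mean (pl (2 * u + 1)) h) / 2)" by (rule half[OF ne, symmetric])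
    finally show ?thesis unfolding eq .
  next
    assume w: "w = 2 * u + 1"
    have eq: "mean (merge (pl(w := replicate M a)) u) h = (h a + mean (pl (2 * u)) h) / 2" for a
      using assms unfolding merge_def w by (subst mean_append) (auto simp: mean_replicate)
    have "mean (merge pl u) h = (mean (pl w) h + mean (pl (2 * u)) h) / 2"
      using assms by (simp add: merge_def mean_append w)
    also have "\<dots> = mean (pl w) (\<lambda>a. (h a + mean (pl (2 * u)) h) / 2)" by (rule half[OF ne, symmetric])
    finally show ?thesis unfolding eq .
  qed
qed

text \<open>Changing the list of \<open>w\<close> affects the merged lists only at
  \<open>w div 2\<close>, and there affinely.\<close>

lemma satisfied_mean_merge_affine:
  assumes "distinct_scopes cs" "\<And>v. v < 2 * N \<Longrightarrow> length (pl v) = M" "M > 0" "w < 2 * N"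
  shows "satisfied_mean Q cs (merge pl) = mean (pl w) (\<lambda>a. satisfied_mean Q cs (merge (pl(w := replicate M a))))"
  unfolding satisfied_mean_def mean_sum_list
proof (intro arg_cong[of _ _ sum_list] map_cong refl)
  fix p assume p: "p \<in> set cs"
  show "mean_tuple (Q (fst p)) (map (merge pl) (snd p)) =
      mean (pl w) (\<lambda>a. mean_tuple (Q (fst p)) (map (merge (pl(w := replicate M a))) (snd p)))"
  proof (rule mean_tuple_affine[where u = "w div 2"])
    show "distinct (snd p)" using p assms(1) by (auto simp: distinct_scopes_def)
    show "pl w \<noteq> []" using assms(2)[OF assms(4)] assms(3) by auto
    show "merge (pl(w := replicate M a)) x = merge pl x" if "x \<noteq> w div 2" for a x
      using that by (auto simp: merge_def)
    show "mean (merge pl (w div 2)) h = mean (pl w) (\<lambda>a. mean (merge (pl(w := replicate M a)) (w div 2)) h)" for h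
    proof (rule mean_merge_affine)
      have "2 * (w div 2) < 2 * N" "2 * (w div 2) + 1 < 2 * N" using assms(4) by presburger+
      then show "length (pl (2 * (w div 2))) = M" "length (pl (2 * (w div 2) + 1)) = M"
        using assms(2) by blast+
    qed (use assms(3) in auto)
  qed
qed

lemma satisfied_mean_cong:
  "(\<And>p v. p \<in> set cs \<Longrightarrow> v \<in> set (snd p) \<Longrightarrow> pl v = pl' v) \<Longrightarrow> satisfied_mean Q cs pl = satisfied_mean Q cs pl'"
  unfolding satisfied_mean_def by (intro arg_cong[of _ _ sum_list] map_cong refl arg_cong[of _ _ "mean_tuple _"]) auto

lemma satisfied_mean_replicate:
  assumes "M > 0"
  shows "satisfied_mean Q cs (\<lambda>v. replicate M (\<zeta> v)) = satisfied Q cs \<zeta>"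
proof -
  have "map (\<lambda>v. replicate M (\<zeta> v)) S = map (replicate M) (map \<zeta> S)" for S by simp
  then show ?thesis
    unfolding satisfied_mean_def satisfied_def by (simp only: mean_tuple_replicate[OF assms])
qed

text \<open>
  Both sides are affine in every single list, so it suffices to consider constant lists,
  i.e. integral assignments.
\<close>

lemma level_ok_lists:
  assumes ok: "level_ok Q q cs N \<tau> xs \<beta>"
    and d1: "distinct_scopes (relabel cs xs)" and d2: "distinct_scopes (relabel cs (halve xs \<beta>))"
    and less: "\<forall>x\<in>set xs. x < N"
    and pl: "\<And>v. v < 2 * N \<Longrightarrow> length (pl v) = M \<and> set (pl v) \<subseteq> {1..q}" and M: "M > 0"
  shows "satisfied_mean Q (relabel cs (halve xs \<beta>)) pl \<le> satisfied_mean Q (relabel cs xs) (merge pl) + \<tau>"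
proof -
  let ?c1 = "relabel cs xs" and ?c2 = "relabel cs (halve xs \<beta>)"
  let ?\<Phi> = "\<lambda>pl. satisfied_mean Q ?c2 pl - satisfied_mean Q ?c1 (merge pl)"
  have "\<exists>\<zeta>. (\<forall>w<2 * N. \<zeta> w \<in> set (pl w)) \<and> ?\<Phi> pl \<le> ?\<Phi> (\<lambda>w. if w < 2 * N then replicate M (\<zeta> w) else pl w)"
  proof (rule multi_affine_extreme_point)
    fix pl :: "nat \<Rightarrow> nat list" and w assume w: "w < 2 * N" "\<And>v. v < 2 * N \<Longrightarrow> length (pl v) = M"
    show "?\<Phi> pl = mean (pl w) (\<lambda>a. ?\<Phi> (pl(w := replicate M a)))"
      unfolding mean_diff
      by (rule arg_cong2[where f = "(-)", OF
            satisfied_mean_affine[where pl = pl and w = w, OF d2 w(2)[OF w(1)] M]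
            satisfied_mean_merge_affine[where pl = pl and w = w, OF d1 w(2) M w(1)]])
  qed (use pl M in auto)
  then obtain \<zeta> where \<zeta>: "\<forall>w<2 * N. \<zeta> w \<in> set (pl w)" "?\<Phi> pl \<le> ?\<Phi> (\<lambda>w. if w < 2 * N then replicate M (\<zeta> w) else pl w)"
    by blast
  \<comment> \<open>\<open>level_ok\<close> ranges over extensional functions, so the extreme point
    is cut down to the relevant variables.\<close>
  define \<zeta>' where "\<zeta>' = restrict \<zeta> {..<2 * N}"
  have \<zeta>': "\<zeta>' \<in> {..<2 * N} \<rightarrow>\<^sub>E {1..q}" 
  proof -
    have "\<zeta> v \<in> {1..q}" if "v < 2 * N" for v
      using bspec[OF conjunct2[OF pl[OF that], unfolded subset_eq] \<zeta>(1)[rule_format, OF that]] .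
    then show ?thesis unfolding \<zeta>'_def by (simp add: PiE_iff)
  qed
  have e2: "satisfied_mean Q ?c2 (\<lambda>w. if w < 2 * N then replicate M (\<zeta> w) else pl w) = satisfied Q ?c2 \<zeta>'"
  proof -
    have "satisfied_mean Q ?c2 (\<lambda>w. if w < 2 * N then replicate M (\<zeta> w) else pl w) =
        satisfied_mean Q ?c2 (\<lambda>w. replicate M (\<zeta>' w))"
    proof (rule satisfied_mean_cong)
      fix p v assume "p \<in> set ?c2" "v \<in> set (snd p)"
      then have "v \<in> set (halve xs \<beta>)" using set_relabel[of "fst p" "snd p" cs "halve xs \<beta>"] by auto
      then have "v < 2 * N" using halve_less less by blast
      then show "(if v < 2 * N then replicate M (\<zeta> v) else pl v) = replicate M (\<zeta>' v)" by (simp add: \<zeta>'_def)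
    qed
    then show ?thesis by (simp add: satisfied_mean_replicate M)
  qed
  \<comment> \<open>Merging two constant lists of length \<open>M\<close> gives a list with the same
    means as the two-element list in \<open>level_ok\<close>.\<close>
  have e1: "satisfied_mean Q ?c1 (merge (\<lambda>w. if w < 2 * N then replicate M (\<zeta> w) else pl w)) =
      satisfied_mean Q ?c1 (\<lambda>u. [\<zeta>' (2 * u), \<zeta>' (2 * u + 1)])"
    unfolding satisfied_mean_def
  proof (intro arg_cong[of _ _ sum_list] map_cong refl mean_tuple_cong)
    fix p assume p: "p \<in> set ?c1"
    have lt: "2 * u < 2 * N" "2 * u + 1 < 2 * N" if "u \<in> set (snd p)" for u
      using set_relabel[of "fst p" "snd p" cs xs] p that less by fastforce+
    have "mean (merge (\<lambda>w. if w < 2 * N then replicate M (\<zeta> w) else pl w) u) h = mean [\<zeta>' (2 * u), \<zeta>' (2 * u + 1)] h"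
      if u: "u \<in> set (snd p)" for u h
    proof -
      have "merge (\<lambda>w. if w < 2 * N then replicate M (\<zeta> w) else pl w) u = replicate M (\<zeta> (2 * u)) @ replicate M (\<zeta> (2 * u + 1))"
        using lt[OF u] by (simp only: merge_def if_True)
      moreover have "\<zeta>' (2 * u) = \<zeta> (2 * u)" "\<zeta>' (2 * u + 1) = \<zeta> (2 * u + 1)"
        using lt[OF u] by (simp_all only: \<zeta>'_def restrict_apply lessThan_iff if_True)
      moreover have "mean [a, b] h = (h a + h b) / 2" for a b by (simp add: mean_def)
      ultimately show ?thesis using M by (simp only: mean_append length_replicate mean_replicate)
    qed
    then show "list_all2 (\<lambda>A B. \<forall>h. mean A h = mean B h)
        (map (merge (\<lambda>w. if w < 2 * N then replicate M (\<zeta> w) else pl w)) (snd p))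
        (map (\<lambda>u. [\<zeta>' (2 * u), \<zeta>' (2 * u + 1)]) (snd p))"
      by (simp only: list_all2_map1 list_all2_map2 list_all2_same) blast
  qed
  have "satisfied Q ?c2 \<zeta>' \<le> satisfied_mean Q ?c1 (\<lambda>u. [\<zeta>' (2 * u), \<zeta>' (2 * u + 1)]) + \<tau>"
    using ok \<zeta>' unfolding level_ok_def by blast
  then show ?thesis using \<zeta>(2) unfolding e1 e2 by linarith
qed

section \<open>Iterated halving\<close>

lemma halve_iter_0 [simp]: "halve_iter 0 xs bs = xs"
  by (simp add: halve_iter_def)

lemma halve_iter_Suc: "halve_iter (Suc s) xs bs = halve_iter s (halve xs bs) (drop (length xs) bs)"
  by (simp add: halve_iter_def funpow_swap1 halve_state_def)

text \<open>Division by two maps a new scope back to the old one, so two of its entries cannot have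
  become equal.\<close>

lemma distinct_scopes_halve:
  assumes "length xs \<le> length bs" "distinct_scopes (relabel cs xs)"
  shows "distinct_scopes (relabel cs (halve xs bs))"
proof -
  have "relabel cs xs = map (\<lambda>p. (fst p, map (\<lambda>y. y div 2) (snd p))) (relabel cs (halve xs bs))"
    by (subst halve_div_2[OF assms(1), symmetric]) (rule relabel_map)
  then show ?thesis using assms(2) by (auto simp: distinct_scopes_def distinct_map)
qed

fun levels_ok :: "(nat \<Rightarrow> nat list \<Rightarrow> real) \<Rightarrow> nat \<Rightarrow> (nat \<times> nat list) list \<Rightarrow> (nat \<Rightarrow> real) \<Rightarrow> nat \<Rightarrow> nat \<Rightarrow> nat \<Rightarrow> nat list \<Rightarrow> bool list \<Rightarrow> bool" where
  "levels_ok Q q cs \<tau> 0 i N xs bs \<longleftrightarrow> True"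
| "levels_ok Q q cs \<tau> (Suc s) i N xs bs \<longleftrightarrow> level_ok Q q cs N (\<tau> i) xs (take (length xs) bs) \<and>
     levels_ok Q q cs \<tau> s (Suc i) (2 * N) (halve xs bs) (drop (length xs) bs)"

text \<open>After \<open>s\<close> halvings the descendants of \<open>u\<close> are the numbers from
  \<open>u * 2 ^ s\<close> to \<open>Suc u * 2 ^ s - 1\<close>, and their values form its list. The
  later levels leave lists instead of single values for the first one, which is why
  \<open>level_ok\<close> was extended to lists; the errors add up.\<close>

lemma satisfied_halve_iter:
  assumes "levels_ok Q q cs \<tau> s i N xs bs" "length bs = s * length xs"
    "distinct_scopes (relabel cs xs)" "\<forall>x\<in>set xs. x < N" "\<And>v. v < N * 2 ^ s \<Longrightarrow> \<zeta> v \<in> {1..q}"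
  shows "satisfied Q (relabel cs (halve_iter s xs bs)) \<zeta> \<le>
    satisfied_mean Q (relabel cs xs) (\<lambda>u. map \<zeta> [u * 2 ^ s..<Suc u * 2 ^ s]) + (\<Sum>k<s. \<tau> (i + k))"
  using assms
proof (induction s arbitrary: i N xs bs)
  case 0
  have "satisfied_mean Q (relabel cs xs) (\<lambda>u. map \<zeta> [u..<Suc u]) = satisfied_mean Q (relabel cs xs) (\<lambda>u. replicate 1 (\<zeta> u))"
    by (rule satisfied_mean_cong) simp
  then show ?case by (simp only: satisfied_mean_replicate[of 1] zero_less_one) simp
next
  case (Suc s)
  let ?ys = "halve xs bs" and ?bs = "drop (length xs) bs"
  have len: "length xs \<le> length bs" using Suc.prems(2) by simp
  have d: "distinct_scopes (relabel cs ?ys)" by (rule distinct_scopes_halve[OF len Suc.prems(3)])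
  have 1: "satisfied Q (relabel cs (halve_iter s ?ys ?bs)) \<zeta> \<le>
    satisfied_mean Q (relabel cs ?ys) (\<lambda>u. map \<zeta> [u * 2 ^ s..<Suc u * 2 ^ s]) + (\<Sum>k<s. \<tau> (Suc i + k))"
  proof (rule Suc.IH)
    show "levels_ok Q q cs \<tau> s (Suc i) (2 * N) ?ys ?bs" using Suc.prems(1) by simp
    show "length ?bs = s * length ?ys" using Suc.prems(2) by simp
    show "\<forall>x\<in>set ?ys. x < 2 * N" using halve_less Suc.prems(4) by blast
    show "\<zeta> v \<in> {1..q}" if "v < 2 * N * 2 ^ s" for v using Suc.prems(5)[of v] that by (simp add: algebra_simps)
  qed (rule d)
  have 2: "satisfied_mean Q (relabel cs ?ys) (\<lambda>u. map \<zeta> [u * 2 ^ s..<Suc u * 2 ^ s]) \<le>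
      satisfied_mean Q (relabel cs xs) (merge (\<lambda>u. map \<zeta> [u * 2 ^ s..<Suc u * 2 ^ s])) + \<tau> i"
  proof -
    have "level_ok Q q cs N (\<tau> i) xs bs" 
      using Suc.prems(1) by (simp add: level_ok_def halve_take)
    then show ?thesis
    proof (rule level_ok_lists[OF _ Suc.prems(3) d Suc.prems(4), where M = "2 ^ s"])
      fix v assume v: "v < 2 * N"
      have "Suc v * 2 ^ s \<le> 2 * N * 2 ^ s" using v by (intro mult_right_mono) auto
      then have "\<zeta> x \<in> {1..q}" if "x < Suc v * 2 ^ s" for x
        using Suc.prems(5)[of x] that by (simp add: algebra_simps)
      then show "length (map \<zeta> [v * 2 ^ s..<Suc v * 2 ^ s]) = 2 ^ s \<and> set (map \<zeta> [v * 2 ^ s..<Suc v * 2 ^ s]) \<subseteq> {1..q}"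
        by auto
    qed simp
  qed
  have 3: "merge (\<lambda>u. map \<zeta> [u * 2 ^ s..<Suc u * 2 ^ s]) = (\<lambda>u. map \<zeta> [u * 2 ^ Suc s..<Suc u * 2 ^ Suc s])"
  proof
    fix u :: nat
    have "[u * 2 ^ Suc s..<Suc u * 2 ^ Suc s] = [2 * u * 2 ^ s..<(2 * u + 1) * 2 ^ s] @ [(2 * u + 1) * 2 ^ s..<Suc (2 * u + 1) * 2 ^ s]"
      using upt_add_eq_append[of "2 * u * 2 ^ s" "(2 * u + 1) * 2 ^ s" "2 ^ s"] by (simp add: algebra_simps)
    then show "merge (\<lambda>u. map \<zeta> [u * 2 ^ s..<Suc u * 2 ^ s]) u = map \<zeta> [u * 2 ^ Suc s..<Suc u * 2 ^ Suc s]"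
      by (simp add: merge_def)
  qed
  have 4: "(\<Sum>k<s. \<tau> (Suc i + k)) + \<tau> i = (\<Sum>k<Suc s. \<tau> (i + k))"
    unfolding sum.lessThan_Suc_shift by simp
  show ?case unfolding halve_iter_Suc 4[symmetric] using 1 2 unfolding 3 by linarith
qed

lemma card_coins_add:
  "card {\<omega> \<in> coins (m + n). R (take m \<omega>) (drop m \<omega>)} = (\<Sum>\<beta>\<in>coins m. card {\<gamma> \<in> coins n. R \<beta> \<gamma>})"
proof -
  have "bij_betw (\<lambda>\<omega>. (take m \<omega>, drop m \<omega>)) {\<omega> \<in> coins (m + n). R (take m \<omega>) (drop m \<omega>)}
      (SIGMA \<beta>:coins m. {\<gamma> \<in> coins n. R \<beta> \<gamma>})"
    by (rule bij_betw_byWitness[where f' = "\<lambda>(\<beta>, \<gamma>). \<beta> @ \<gamma>"]) (auto simp: coins_def)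
  then have "card {\<omega> \<in> coins (m + n). R (take m \<omega>) (drop m \<omega>)} = card (SIGMA \<beta>:coins m. {\<gamma> \<in> coins n. R \<beta> \<gamma>})"
    by (rule bij_betw_same_card)
  also have "\<dots> = (\<Sum>\<beta>\<in>coins m. card {\<gamma> \<in> coins n. R \<beta> \<gamma>})" by (rule card_SigmaI) auto
  finally show ?thesis .
qed

text \<open>The coins of the first level are fixed, and the bound for the later levels is applied to
  every resulting list, since halving preserves the hypotheses on \<open>xs\<close>.\<close>

lemma levels_ok_probability:
  assumes "length xs = length (slots cs)" "distinct_scopes (relabel cs xs)" "\<And>i t. 0 \<le> Q i t \<and> Q i t \<le> 1"
    and "\<And>i. \<tau> i \<ge> 0" "real (length xs) \<le> W" "W > 0"
  shows "real (card {bs \<in> coins (s * length xs). \<not> levels_ok Q q cs \<tau> s i N xs bs}) / 2 ^ (s * length xs)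
    \<le> (\<Sum>k<s. real q ^ (2 * (N * 2 ^ k)) * exp (- ((\<tau> (i + k))\<^sup>2) / (2 * W)))"
  using assms(1,2,5)
proof (induction s arbitrary: i N xs)
  case 0
  then show ?case by simp
next
  case (Suc s)
  define n where "n = length xs"
  let ?B = "\<lambda>\<beta>. \<not> level_ok Q q cs N (\<tau> i) xs \<beta>"
  let ?C = "\<lambda>\<beta> \<gamma>. \<not> levels_ok Q q cs \<tau> s (Suc i) (2 * N) (halve xs \<beta>) \<gamma>"
  let ?e = "\<Sum>k<s. real q ^ (2 * (2 * N * 2 ^ k)) * exp (- ((\<tau> (Suc i + k))\<^sup>2) / (2 * W))"
  have IH: "real (card {\<gamma> \<in> coins (s * n). ?C \<beta> \<gamma>}) / 2 ^ (s * n) \<le> ?e" if "\<beta> \<in> coins n" for \<beta>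
  proof -
    have l: "length \<beta> = length xs" using that by (simp add: coins_def n_def)
    have "length (halve xs \<beta>) = length xs" using l by simp
    then show ?thesis
      using Suc.IH[of "halve xs \<beta>" "Suc i" "2 * N"] Suc.prems distinct_scopes_halve[of xs \<beta> cs] l by (simp add: n_def)
  qed
  have split: "levels_ok Q q cs \<tau> (Suc s) i N xs bs \<longleftrightarrow> \<not> (?B (take n bs) \<or> ?C (take n bs) (drop n bs))" for bs
    by (simp add: n_def halve_take)
  have "real (card {bs \<in> coins (n + s * n). \<not> levels_ok Q q cs \<tau> (Suc s) i N xs bs}) =
      (\<Sum>\<beta>\<in>coins n. real (card {\<gamma> \<in> coins (s * n). ?B \<beta> \<or> ?C \<beta> \<gamma>}))"
    unfolding split not_not by (subst card_coins_add[where R = "\<lambda>\<beta> \<gamma>. ?B \<beta> \<or> ?C \<beta> \<gamma>"]) simp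
  \<comment> \<open>If the first level already fails, all continuations are counted as
    failures.\<close>
  also have "\<dots> \<le> (\<Sum>\<beta>\<in>coins n. (if ?B \<beta> then 2 ^ (s * n) else 0) + 2 ^ (s * n) * ?e)"
  proof (rule sum_mono)
    fix \<beta> assume \<beta>: "\<beta> \<in> coins n"
    have e: "0 \<le> ?e" by (intro sum_nonneg) auto
    show "real (card {\<gamma> \<in> coins (s * n). ?B \<beta> \<or> ?C \<beta> \<gamma>}) \<le> (if ?B \<beta> then 2 ^ (s * n) else 0) + 2 ^ (s * n) * ?e"
    proof (cases "?B \<beta>")
      case True
      have "card {\<gamma> \<in> coins (s * n). ?B \<beta> \<or> ?C \<beta> \<gamma>} \<le> card (coins (s * n))" by (intro card_mono) auto
      then have "real (card {\<gamma> \<in> coins (s * n). ?B \<beta> \<or> ?C \<beta> \<gamma>}) \<le> real (2 ^ (s * n))"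
        unfolding card_coins by (rule of_nat_mono)
      then show ?thesis using True e by (simp add: add_increasing2)
    next
      case False
      then show ?thesis using IH[OF \<beta>] by (simp add: field_simps)
    qed
  qed
  also have "\<dots> = 2 ^ (s * n) * real (card {\<beta> \<in> coins n. ?B \<beta>}) + 2 ^ n * 2 ^ (s * n) * ?e"
    by (simp add: sum.distrib card_coins sum.If_cases Int_def mult.commute)
  finally have "real (card {bs \<in> coins (n + s * n). \<not> levels_ok Q q cs \<tau> (Suc s) i N xs bs}) / 2 ^ (n + s * n) \<le>
      real (card {\<beta> \<in> coins n. ?B \<beta>}) / 2 ^ n + ?e"
    by (simp add: power_add field_simps)
  also have "real (card {\<beta> \<in> coins n. ?B \<beta>}) / 2 ^ n \<le> real q ^ (2 * N) * exp (- ((\<tau> i)\<^sup>2) / (2 * W))"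
    unfolding n_def by (rule level_ok_probability[OF Suc.prems(1,2) assms(3,4) Suc.prems(3) assms(6)])
  also have "real q ^ (2 * N) * exp (- ((\<tau> i)\<^sup>2) / (2 * W)) + ?e =
      (\<Sum>k<Suc s. real q ^ (2 * (N * 2 ^ k)) * exp (- ((\<tau> (i + k))\<^sup>2) / (2 * W)))"
    unfolding sum.lessThan_Suc_shift by (simp add: mult.assoc mult.left_commute)
  finally show ?case by (simp add: n_def)
qed

section \<open>The regular blow-up\<close>

lemma nth_concat_replicate:
  "x < n * length r \<Longrightarrow> concat (replicate n r) ! x = r ! (x mod length r)"
proof (induction n arbitrary: x)
  case (Suc n)
  show ?case
  proof (cases "x < length r")
    case False
    then show ?thesis using Suc by (simp add: nth_append le_mod_geq)
  qed (simp add: nth_append)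
qed simp

lemma take_concat_replicate:
  assumes "r \<noteq> []"
  shows "take L (concat (replicate L r)) = map (\<lambda>x. r ! (x mod length r)) [0..<L]"
proof (rule nth_equalityI)
  have le: "L \<le> L * length r" using assms by (cases r) auto
  then show "length (take L (concat (replicate L r))) = length (map (\<lambda>x. r ! (x mod length r)) [0..<L])"
    by (simp add: length_concat_replicate)
  fix i assume "i < length (take L (concat (replicate L r)))"
  then have "i < L" by simp
  moreover from this le have "i < L * length r" by linarith
  ultimately show "take L (concat (replicate L r)) ! i = map (\<lambda>x. r ! (x mod length r)) [0..<L] ! i"
    by (simp add: nth_concat_replicate)
qed

lemma same_var_append: "same_var vs v (xs @ ys) = same_var vs v xs @ same_var vs v ys"
  by (simp add: same_var_def)

definition occ_rank :: "nat list \<Rightarrow> nat \<Rightarrow> nat" where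
  "occ_rank vs t = length (same_var vs (vs ! t) [0..<t])"

abbreviation occurrences :: "nat list \<Rightarrow> nat \<Rightarrow> nat list" where
  "occurrences vs v \<equiv> same_var vs v [0..<length vs]"

lemma set_occurrences: "set (occurrences vs v) = {t. t < length vs \<and> vs ! t = v}"
  by (auto simp: same_var_def)

lemma distinct_occurrences: "distinct (occurrences vs v)"
  by (simp add: same_var_def)

lemma length_occurrences_le: "length (occurrences vs v) \<le> length vs"
  unfolding same_var_def by (rule order_trans[OF length_filter_le]) simp

lemma occurrences_split:
  assumes "t < length vs"
  shows "occurrences vs (vs ! t) = same_var vs (vs ! t) [0..<t] @ same_var vs (vs ! t) [t..<length vs]"
  using upt_add_eq_append[of 0 t "length vs - t"] assms by (simp add: same_var_append[symmetric])

lemma rank_occurrence: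
  assumes "t < length vs"
  shows "occ_rank vs t < length (occurrences vs (vs ! t))" "occurrences vs (vs ! t) ! occ_rank vs t = t"
proof -
  have "[t..<length vs] = t # [Suc t..<length vs]" using assms by (rule upt_conv_Cons)
  then have eq: "occurrences vs (vs ! t) = same_var vs (vs ! t) [0..<t] @ t # same_var vs (vs ! t) [Suc t..<length vs]"
    unfolding occurrences_split[OF assms] by (simp add: same_var_def)
  show "occ_rank vs t < length (occurrences vs (vs ! t))" "occurrences vs (vs ! t) ! occ_rank vs t = t"
    unfolding eq occ_rank_def by (simp_all add: nth_append)
qed

text \<open>The rotated list of slots begins with \<open>t\<close>, whose rank is the amount of
  rotation; so a chunk is a window of length \<open>L\<close> in a periodic sequence of
  slots.\<close>

lemma chunk_conv:
  assumes "t < length vs"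
  defines "c \<equiv> occurrences vs (vs ! t)"
  shows "chunk L vs t = map (\<lambda>x. c ! ((occ_rank vs t + x) mod length c)) [0..<L]"
proof -
  have "same_var vs (vs ! t) (drop t [0..<length vs] @ take t [0..<length vs]) = rotate (occ_rank vs t) c"
    using assms(1) unfolding c_def occurrences_split[OF assms(1)] occ_rank_def rotate_append
    by (simp add: same_var_append min_def)
  moreover have "c \<noteq> []" using rank_occurrence(1)[OF assms(1)] by (auto simp: c_def)
  ultimately show ?thesis
    unfolding chunk_def by (simp add: take_concat_replicate nth_rotate mod_add_right_eq)
qed

lemma length_chunk: "t < length vs \<Longrightarrow> length (chunk L vs t) = L"
  by (simp add: chunk_conv)

lemma map_nth_chunk:
  assumes "t < length vs"
  shows "map ((!) vs) (chunk L vs t) = replicate L (vs ! t)"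
proof (rule replicate_eqI)
  show "length (map ((!) vs) (chunk L vs t)) = L" using assms by (simp add: length_chunk)
  fix y assume "y \<in> set (map ((!) vs) (chunk L vs t))"
  then obtain x where x: "x \<in> set (chunk L vs t)" "y = vs ! x" by auto
  let ?c = "occurrences vs (vs ! t)"
  have "?c \<noteq> []" using rank_occurrence(1)[OF assms] by auto
  then have "set (chunk L vs t) \<subseteq> set ?c" unfolding chunk_conv[OF assms] by auto
  then show "y = vs ! t" using x set_occurrences by auto
qed

lemma count_list_conv_card: "count_list xs y = card {i. i < length xs \<and> xs ! i = y}"
  by (simp add: count_list_eq_length_filter length_filter_conv_card eq_commute)

lemma count_list_distinct: "distinct xs \<Longrightarrow> y \<in> set xs \<Longrightarrow> count_list xs y = 1"
  by (induction xs) (auto simp: count_list_0_iff)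

lemma sum_of_bool_card: "finite A \<Longrightarrow> (\<Sum>x\<in>A. of_bool (P x)) = card {x \<in> A. P x}" for A :: "'a set"
  by (simp add: Int_def of_bool_def sum.If_cases)

text \<open>For a fixed offset \<open>x < L\<close>, moving \<open>x\<close> places along the cyclic
  order permutes the slots of a variable; hence \<open>y\<close> is hit once per offset. This is the
  source of regularity.\<close>

lemma sum_count_list_chunk:
  assumes "y < length vs"
  shows "(\<Sum>t<length vs. count_list (chunk L vs t) y) = L"
proof -
  define c where "c = occurrences vs (vs ! y)"
  have y: "y \<in> set c" using assms by (simp add: c_def set_occurrences)
  have zero: "count_list (chunk L vs t) y = 0" if "t < length vs" "t \<notin> set c" for t
  proof -
    have "vs ! t \<noteq> vs ! y" using that by (auto simp: c_def set_occurrences)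
    moreover have "vs ! y = vs ! t" if "y \<in> set (chunk L vs t)"
      using arg_cong[OF map_nth_chunk[OF \<open>t < length vs\<close>, of L], of set] that by (auto split: if_splits)
    ultimately show ?thesis by (auto simp: count_list_0_iff)
  qed
  have cnt: "count_list (chunk L vs (c ! i)) y = (\<Sum>x<L. of_bool (rotate x c ! i = y))" if "i < length c" for i
  proof -
    have t: "c ! i < length vs" "vs ! (c ! i) = vs ! y"
      using nth_mem[OF that] by (auto simp: c_def set_occurrences)
    have "c ! occ_rank vs (c ! i) = c ! i" "occ_rank vs (c ! i) < length c"
      using rank_occurrence[OF t(1)] unfolding t(2) c_def[symmetric] by simp_all
    then have "occ_rank vs (c ! i) = i" using distinct_occurrences that by (metis c_def nth_eq_iff_index_eq)
    then have "chunk L vs (c ! i) = map (\<lambda>x. c ! ((i + x) mod length c)) [0..<L]"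
      using chunk_conv[OF t(1), of L] unfolding t(2) c_def[symmetric] by simp
    also have "\<dots> = map (\<lambda>x. rotate x c ! i) [0..<L]" using that by (simp add: nth_rotate add.commute)
    finally show ?thesis
      by (simp add: count_list_conv_card sum_of_bool_card) (intro arg_cong[of _ _ card]; auto)
  qed
  have "(\<Sum>t<length vs. count_list (chunk L vs t) y) = (\<Sum>t\<in>set c. count_list (chunk L vs t) y)"
    using zero by (intro sum.mono_neutral_right) (auto simp: c_def set_occurrences)
  also have "\<dots> = (\<Sum>i<length c. count_list (chunk L vs (c ! i)) y)"
    using sum.reindex_bij_betw[OF bij_betw_nth[OF distinct_occurrences refl refl, of vs "vs ! y"], of "\<lambda>t. count_list (chunk L vs t) y"]
    by (simp add: c_def)
  also have "\<dots> = (\<Sum>i<length c. \<Sum>x<L. of_bool (rotate x c ! i = y))" by (simp add: cnt)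
  also have "\<dots> = (\<Sum>x<L. \<Sum>i<length c. of_bool (rotate x c ! i = y))" by (rule sum.swap)
  also have "\<dots> = (\<Sum>x<L. 1)"
  proof (rule sum.cong[OF refl])
    fix x
    have "(\<Sum>i<length c. of_bool (rotate x c ! i = y)) = count_list (rotate x c) y"
      by (simp add: count_list_conv_card sum_of_bool_card Int_def)
    also have "\<dots> = 1" using y distinct_occurrences[of vs "vs ! y"] by (intro count_list_distinct) (auto simp: c_def)
    finally show "(\<Sum>i<length c. of_bool (rotate x c ! i = y)) = (1 :: nat)" .
  qed
  finally show ?thesis by simp
qed

section \<open>Counting in padded products\<close>

lemma length_padded_product:
  assumes "\<And>l. l \<in> set ls \<Longrightarrow> length l = M" "length ls \<le> K"
  shows "length (padded_product M K ls) = M ^ K"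
  using assms
proof (induction K arbitrary: ls)
  case (Suc K)
  show ?case
  proof (cases ls)
    case Nil
    then show ?thesis using Suc.IH[of "[]"] by (simp add: length_concat_replicate)
  next
    case (Cons l ls')
    have "(\<Sum>x\<leftarrow>l. length (padded_product M K ls')) = length l * length (padded_product M K ls')"
      by (simp add: sum_list_triv)
    then show ?thesis using Suc.IH[of ls'] Suc.prems Cons by (simp add: length_concat comp_def)
  qed
qed simp

lemma count_list_append: "count_list (xs @ ys) y = count_list xs y + count_list ys y"
  by (induction xs) auto

lemma count_list_concat: "count_list (concat xss) y = (\<Sum>xs\<leftarrow>xss. count_list xs y)"
  by (induction xss) (auto simp: count_list_append)

text \<open>Fixing one position of one list leaves a fraction \<open>1 / M\<close> of all
  \<open>M ^ K\<close> tuples; both sides are multiplied by \<open>M\<close> to stay within the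
  natural numbers.\<close>

lemma count_list_padded_product:
  assumes "\<And>l. l \<in> set ls \<Longrightarrow> length l = M" "length ls \<le> K"
  shows "M * count_list (concat (padded_product M K ls)) y = M ^ K * (\<Sum>l\<leftarrow>ls. count_list l y)"
  using assms
proof (induction K arbitrary: ls)
  case (Suc K)
  show ?case
  proof (cases ls)
    case Nil
    have "count_list (concat (concat (replicate n xss))) y = n * count_list (concat xss) y" for n and xss :: "'a list list"
      by (induction n) (auto simp: count_list_append)
    then show ?thesis using Suc.IH[of "[]"] Nil by simp
  next
    case (Cons l ls')
    let ?p = "padded_product M K ls'"
    have IH: "M * count_list (concat ?p) y = M ^ K * (\<Sum>l\<leftarrow>ls'. count_list l y)" and len: "length ?p = M ^ K"
      using Suc.prems Cons by (auto intro: Suc.IH length_padded_product)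
    have one: "count_list (concat (map ((#) x) xss)) y = (if x = y then length xss else 0) + count_list (concat xss) y"
      for x and xss :: "'a list list" by (induction xss) (auto simp: count_list_append)
    have "count_list (concat (concat (map (\<lambda>x. map ((#) x) ?p) l))) y =
        length ?p * count_list l y + length l * count_list (concat ?p) y"
      by (induction l) (auto simp: count_list_append one)
    then have "M * count_list (concat (padded_product M (Suc K) ls)) y =
        M * M ^ K * count_list l y + length l * (M * count_list (concat ?p) y)"
      using Cons len by (simp add: algebra_simps)
    then show ?thesis unfolding IH using Suc.prems(1)[of l] Cons by (simp add: algebra_simps)
  qed
qed simp

lemma map_padded_product: "map (map g) (padded_product M k ls) = padded_product M k (map (map g) ls)"
proof (induction k arbitrary: ls)
  case (Suc k)
  show ?case
  proof (cases ls)
    case (Cons l ls')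
    have "map (map g) (map ((#) x) xss) = map ((#) (g x)) (map (map g) xss)" for x xss by simp
    then show ?thesis using Cons by (simp add: map_concat comp_def Suc.IH[of ls', symmetric])
  qed (use Suc in \<open>simp add: map_concat map_replicate\<close>)
qed simp

lemma concat_replicate_replicate: "concat (replicate m (replicate n x)) = replicate (m * n) x"
  by (induction m) (auto simp: replicate_add)

lemma padded_product_replicate: "length S \<le> k \<Longrightarrow> padded_product M k (map (replicate M) S) = replicate (M ^ k) S"
proof (induction k arbitrary: S)
  case (Suc k)
  then show ?case using Suc.IH[of "[]"]
    by (cases S) (auto simp: concat_replicate_replicate map_replicate)
qed simp

lemma slots_concat_Pair:
  "slots (concat (map (\<lambda>p. map (Pair (a p)) (f p)) ps)) = concat (map (\<lambda>p. concat (f p)) ps)"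
proof (induction ps)
  case (Cons p ps)
  have "map snd (map (Pair (a p)) (f p)) = f p" by (simp add: comp_def)
  then show ?case using Cons by (simp add: slots_def)
qed (simp add: slots_def)

lemma sum_list_slots: "(\<Sum>p\<leftarrow>ps. k * (\<Sum>t\<leftarrow>snd p. f t)) = k * (\<Sum>t\<leftarrow>slots ps. f t)" for k :: nat
  by (induction ps) (auto simp: slots_def algebra_simps)

context
  fixes cs :: "(nat \<times> nat list) list" and L K :: nat
  assumes arity: "\<And>p. p \<in> set cs \<Longrightarrow> length (snd p) \<le> K"
begin

private lemma relabel_chunks:
  "relabel cs (map (chunk L (slots cs)) [0..<length (slots cs)]) =
   map (\<lambda>p. (fst p, map (chunk L (slots cs)) (snd p))) (relabel cs [0..<length (slots cs)])"
  by (rule relabel_map)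

private lemma relabel_positions:
  "cs = map (\<lambda>p. (fst p, map ((!) (slots cs)) (snd p))) (relabel cs [0..<length (slots cs)])"
  using relabel_map[of cs "(!) (slots cs)" "[0..<length (slots cs)]"] by (simp add: map_nth relabel_slots)

private lemma position:
  assumes "p \<in> set (relabel cs [0..<length (slots cs)])"
  shows "length (snd p) \<le> K" "t \<in> set (snd p) \<Longrightarrow> t < length (slots cs)"
proof -
  have "(fst p, map ((!) (slots cs)) (snd p)) \<in> set cs" using assms by (subst relabel_positions) force
  from arity[OF this] show "length (snd p) \<le> K" by simp
  show "t \<in> set (snd p) \<Longrightarrow> t < length (slots cs)"
    using set_relabel[of "fst p" "snd p" cs "[0..<length (slots cs)]"] assms by auto
qed

lemma blowup_conv:
  "blowup L K cs = concat (map (\<lambda>p. map (Pair (fst p)) (padded_product L K (map (chunk L (slots cs)) (snd p))))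
     (relabel cs [0..<length (slots cs)]))"
  unfolding blowup_def relabel_chunks by (simp add: comp_def)

text \<open>A chunk consists of slots of a single variable; reading slots as their variables
  therefore turns all tuples of a constraint into its original scope.\<close>

lemma project_blowup:
  "map (\<lambda>p. (fst p, map ((!) (slots cs)) (snd p))) (blowup L K cs) = concat (map (replicate (L ^ K)) cs)"
proof -
  let ?vs = "slots cs"
  have "map (\<lambda>p. (fst p, map ((!) ?vs) (snd p))) (map (Pair (fst p)) (padded_product L K (map (chunk L ?vs) (snd p)))) =
      replicate (L ^ K) (fst p, map ((!) ?vs) (snd p))" if p: "p \<in> set (relabel cs [0..<length ?vs])" for p
  proof -
    have "map (map ((!) ?vs)) (map (chunk L ?vs) (snd p)) = map (replicate L) (map ((!) ?vs) (snd p))"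
      using position(2)[OF p] by (auto simp: map_nth_chunk)
    then have "map (map ((!) ?vs)) (padded_product L K (map (chunk L ?vs) (snd p))) = replicate (L ^ K) (map ((!) ?vs) (snd p))"
      using position(1)[OF p] unfolding map_padded_product by (simp only: padded_product_replicate length_map)
    moreover have "map (\<lambda>p. (fst p, map ((!) ?vs) (snd p))) (map (Pair (fst p)) xss) = map (Pair (fst p)) (map (map ((!) ?vs)) xss)" for xss
      by simp
    ultimately show ?thesis by (simp only: map_replicate)
  qed
  then have "map (\<lambda>p. (fst p, map ((!) ?vs) (snd p))) (blowup L K cs) =
      concat (map (\<lambda>p. replicate (L ^ K) (fst p, map ((!) ?vs) (snd p))) (relabel cs [0..<length ?vs]))"
    unfolding blowup_conv map_concat map_map comp_def by (intro arg_cong[of _ _ concat] map_cong refl) simp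
  also have "\<dots> = concat (map (replicate (L ^ K)) (map (\<lambda>p. (fst p, map ((!) ?vs) (snd p))) (relabel cs [0..<length ?vs])))"
    by (simp add: comp_def)
  finally show ?thesis by (simp only: relabel_positions[symmetric])
qed

text \<open>A slot is contained in the chunks \<open>L\<close> times in total, and each containment
  produces \<open>L ^ K / L\<close> occurrences, independently of the original degrees.\<close>

lemma count_list_slots_blowup:
  assumes "y < length (slots cs)" "L > 0"
  shows "count_list (slots (blowup L K cs)) y = L ^ K"
proof -
  let ?vs = "slots cs"
  have sl: "slots (blowup L K cs) = concat (map (\<lambda>p. concat (padded_product L K (map (chunk L ?vs) (snd p)))) (relabel cs [0..<length ?vs]))"
    unfolding blowup_conv by (rule slots_concat_Pair)
  have "L * count_list (slots (blowup L K cs)) y =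
      (\<Sum>p\<leftarrow>relabel cs [0..<length ?vs]. L * count_list (concat (padded_product L K (map (chunk L ?vs) (snd p)))) y)"
    unfolding sl count_list_concat[of "map _ _"] by (simp add: comp_def sum_list_const_mult)
  also have "\<dots> = (\<Sum>p\<leftarrow>relabel cs [0..<length ?vs]. L ^ K * (\<Sum>t\<leftarrow>snd p. count_list (chunk L ?vs t) y))"
  proof (intro arg_cong[of _ _ sum_list] map_cong refl)
    fix p assume p: "p \<in> set (relabel cs [0..<length ?vs])"
    show "L * count_list (concat (padded_product L K (map (chunk L ?vs) (snd p)))) y =
        L ^ K * (\<Sum>t\<leftarrow>snd p. count_list (chunk L ?vs t) y)"
    proof -
      have "length l = L" if "l \<in> set (map (chunk L ?vs) (snd p))" for l
        using that position(2)[OF p] by (auto simp: length_chunk)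
      from count_list_padded_product[where K = K and y = y and ls = "map (chunk L ?vs) (snd p)", OF this] position(1)[OF p] show ?thesis by (simp add: comp_def)
    qed
  qed
  also have "\<dots> = L ^ K * (\<Sum>t\<leftarrow>slots (relabel cs [0..<length ?vs]). count_list (chunk L ?vs t) y)"
    by (rule sum_list_slots)
  also have "slots (relabel cs [0..<length ?vs]) = [0..<length ?vs]" by (simp add: slots_relabel)
  also have "(\<Sum>t\<leftarrow>[0..<length ?vs]. count_list (chunk L ?vs t) y) = L"
    using sum_count_list_chunk[OF assms(1), of L] by (simp add: interv_sum_list_conv_sum_set_nat lessThan_atLeast0)
  finally show ?thesis using assms(2) by simp
qed

end

section \<open>Recovering an assignment\<close>

lemma sum_window_le:
  fixes f :: "nat \<Rightarrow> real"
  assumes "\<And>x. 0 \<le> f x \<and> f x \<le> 1"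
  shows "(\<Sum>x<L. f (d + x)) \<le> (\<Sum>x<L. f x) + real d"
proof -
  have "(\<Sum>x<L. f (d + x)) = (\<Sum>x\<in>{d..<d + L}. f x)"
    using sum.shift_bounds_nat_ivl[of f 0 d L] by (simp add: lessThan_atLeast0 add.commute)
  also have "\<dots> \<le> (\<Sum>x<L + d. f x)" using assms by (intro sum_mono2) auto
  also have "\<dots> = (\<Sum>x<L. f x) + (\<Sum>x\<in>{L..<L + d}. f x)"
    by (subst sum.atLeastLessThan_concat[of 0 L "L + d", symmetric, folded lessThan_atLeast0]) auto
  also have "(\<Sum>x\<in>{L..<L + d}. f x) \<le> (\<Sum>x\<in>{L..<L + d}. 1)" using assms by (intro sum_mono) auto
  finally show ?thesis by simp
qed

lemma mean_bounds: "(\<And>x. 0 \<le> h x \<and> h x \<le> 1) \<Longrightarrow> 0 \<le> mean l h \<and> mean l h \<le> 1"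
  using mean_tuple_bounds[of "\<lambda>t. h (hd t)" "[l]"] by simp

text \<open>Both lists are windows of length \<open>L\<close> in the same periodic sequence, shifted
  by the rank of \<open>t\<close>, which is less than \<open>length vs\<close>; the shift brings in
  at most that many new terms. So one list can serve all occurrences of a variable.\<close>

lemma mean_chunk_le:
  assumes t: "t < length vs" and "L > 0" and g: "\<And>x. 0 \<le> g x \<and> g x \<le> 1"
  shows "mean (chunk L vs t) g \<le>
    mean (take L (concat (replicate L (occurrences vs (vs ! t))))) g + real (length vs) / real L"
proof -
  define c where "c = occurrences vs (vs ! t)"
  have rank: "occ_rank vs t < length c" using rank_occurrence(1)[OF t] by (simp add: c_def)
  then have ne: "c \<noteq> []" by auto
  let ?f = "\<lambda>x. g (c ! (x mod length c))"
  have "(\<Sum>x<L. ?f (occ_rank vs t + x)) \<le> (\<Sum>x<L. ?f x) + real (occ_rank vs t)"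
    by (rule sum_window_le) (rule g)
  also have "real (occ_rank vs t) \<le> real (length vs)"
    using rank length_occurrences_le[of vs "vs ! t"] by (simp add: c_def)
  finally have "(\<Sum>x<L. ?f (occ_rank vs t + x)) / L \<le> ((\<Sum>x<L. ?f x) + real (length vs)) / L"
    by (intro divide_right_mono) auto
  moreover have "mean (chunk L vs t) g = (\<Sum>x<L. ?f (occ_rank vs t + x)) / L"
    unfolding chunk_conv[OF t] c_def[symmetric]
    by (simp add: mean_def comp_def interv_sum_list_conv_sum_set_nat lessThan_atLeast0)
  moreover have "mean (take L (concat (replicate L c))) g = (\<Sum>x<L. ?f x) / L"
    unfolding take_concat_replicate[OF ne]
    by (simp add: mean_def comp_def interv_sum_list_conv_sum_set_nat lessThan_atLeast0)
  ultimately show ?thesis by (simp add: c_def add_divide_distrib)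
qed

lemma mean_tuple_mean: "mean_tuple (\<lambda>t. mean A (\<lambda>b. R b t)) ls = mean A (\<lambda>b. mean_tuple (R b) ls)"
proof (induction ls arbitrary: R)
  case (Cons l ls)
  have "mean_tuple (\<lambda>t. mean A (\<lambda>b. R b t)) (l # ls) = mean l (\<lambda>a. mean A (\<lambda>b. mean_tuple (\<lambda>t. R b (a # t)) ls))"
    by (simp add: Cons)
  also have "\<dots> = mean A (\<lambda>b. mean l (\<lambda>a. mean_tuple (\<lambda>t. R b (a # t)) ls))" by (rule mean_swap)
  finally show ?case by simp
qed simp

text \<open>Drawing an element and then a value from its list is a single uniform draw from the
  concatenation, because all these lists have the same length.\<close>

lemma mean_tuple_concat:
  assumes "\<And>l x. l \<in> set ls \<Longrightarrow> x \<in> set l \<Longrightarrow> length (pl x) = N"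
  shows "mean_tuple (\<lambda>tp. mean_tuple P (map pl tp)) ls = mean_tuple P (map (\<lambda>l. concat (map pl l)) ls)"
  using assms
proof (induction ls arbitrary: P)
  case (Cons l ls)
  have "mean_tuple (\<lambda>tp. mean_tuple P (map pl tp)) (l # ls) =
      mean l (\<lambda>a. mean (pl a) (\<lambda>b. mean_tuple (\<lambda>tp. mean_tuple (\<lambda>t. P (b # t)) (map pl tp)) ls))"
    by (simp add: mean_tuple_mean)
  also have "\<dots> = mean l (\<lambda>a. mean (pl a) (\<lambda>b. mean_tuple (\<lambda>t. P (b # t)) (map (\<lambda>l. concat (map pl l)) ls)))"
  proof -
    have "mean_tuple (\<lambda>tp. mean_tuple P' (map pl tp)) ls = mean_tuple P' (map (\<lambda>l. concat (map pl l)) ls)" for P'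
      by (rule Cons.IH) (use Cons.prems in auto)
    then show ?thesis by (simp only:)
  qed
  also have "\<dots> = mean (concat (map pl l)) (\<lambda>b. mean_tuple (\<lambda>t. P (b # t)) (map (\<lambda>l. concat (map pl l)) ls))"
    by (rule mean_concat[symmetric, where M = N]) (use Cons.prems in auto)
  finally show ?case by simp
qed simp

lemma sum_list_concat_map: "(\<Sum>x\<leftarrow>concat (map f xs). g x) = (\<Sum>x\<leftarrow>xs. \<Sum>y\<leftarrow>f x. (g y :: real))"
  by (induction xs) auto

text \<open>Drawing a tuple of slots and then a value for each is drawing from concatenated chunks;
  exchanging these for the common list of the variable costs \<open>length (slots cs) / L\<close> at
  each of at most \<open>K\<close> positions.\<close>

lemma satisfied_mean_blowup_le:
  assumes arity: "\<And>p. p \<in> set cs \<Longrightarrow> length (snd p) \<le> K" and L: "L > 0" and N: "N > 0"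
    and pl: "\<And>t. t < length (slots cs) \<Longrightarrow> length (pl t) = N"
    and pool: "\<And>v. occurrences (slots cs) v \<noteq> [] \<Longrightarrow>
       po v = concat (map pl (take L (concat (replicate L (occurrences (slots cs) v)))))"
    and Q: "\<And>i t. 0 \<le> Q i t \<and> Q i t \<le> 1"
  shows "satisfied_mean Q (blowup L K cs) pl \<le>
    real L ^ K * (satisfied_mean Q cs po + real (length cs) * (real K * (real (length (slots cs)) / real L)))"
proof -
  let ?vs = "slots cs"
  let ?ps = "relabel cs [0..<length ?vs]"
  let ?d = "real (length ?vs) / real L"
  have cs: "cs = map (\<lambda>p. (fst p, map ((!) ?vs) (snd p))) ?ps"
    using relabel_map[of cs "(!) ?vs" "[0..<length ?vs]"] by (simp add: map_nth relabel_slots)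
  have pos: "length (snd p) \<le> K" "\<And>t. t \<in> set (snd p) \<Longrightarrow> t < length ?vs" if "p \<in> set ?ps" for p
  proof -
    have "(fst p, map ((!) ?vs) (snd p)) \<in> set cs" using that by (subst cs) force
    from arity[OF this] show "length (snd p) \<le> K" by simp
    show "t < length ?vs" if "t \<in> set (snd p)" for t
      using set_relabel[of "fst p" "snd p" cs "[0..<length ?vs]"] \<open>p \<in> set ?ps\<close> that by auto
  qed
  have chunk: "x < length ?vs" if "x \<in> set (chunk L ?vs t)" for x t using set_chunk that by blast
  have "satisfied_mean Q (blowup L K cs) pl =
      (\<Sum>p\<leftarrow>?ps. \<Sum>tp\<leftarrow>padded_product L K (map (chunk L ?vs) (snd p)). mean_tuple (Q (fst p)) (map pl tp))"
    unfolding satisfied_mean_def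
    by (subst blowup_conv, erule arity) (simp add: sum_list_concat_map comp_def)
  also have "\<dots> = (\<Sum>p\<leftarrow>?ps. real L ^ K * mean_tuple (Q (fst p)) (map (\<lambda>t. concat (map pl (chunk L ?vs t))) (snd p)))"
  proof (intro arg_cong[of _ _ sum_list] map_cong refl)
    fix p assume p: "p \<in> set ?ps"
    have "(\<Sum>tp\<leftarrow>padded_product L K (map (chunk L ?vs) (snd p)). mean_tuple (Q (fst p)) (map pl tp)) =
        real L ^ K * mean_tuple (\<lambda>tp. mean_tuple (Q (fst p)) (map pl tp)) (map (chunk L ?vs) (snd p))"
      by (rule sum_list_padded_product) (use pos[OF p] L in \<open>auto simp: length_chunk\<close>)
    also have "mean_tuple (\<lambda>tp. mean_tuple (Q (fst p)) (map pl tp)) (map (chunk L ?vs) (snd p)) =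
        mean_tuple (Q (fst p)) (map (\<lambda>l. concat (map pl l)) (map (chunk L ?vs) (snd p)))"
      by (rule mean_tuple_concat[where N = N]) (use chunk pl in auto)
    finally show "(\<Sum>tp\<leftarrow>padded_product L K (map (chunk L ?vs) (snd p)). mean_tuple (Q (fst p)) (map pl tp)) =
        real L ^ K * mean_tuple (Q (fst p)) (map (\<lambda>t. concat (map pl (chunk L ?vs t))) (snd p))"
      by (simp add: comp_def)
  qed
  also have "\<dots> \<le> (\<Sum>p\<leftarrow>?ps. real L ^ K * (mean_tuple (Q (fst p)) (map (\<lambda>t. po (?vs ! t)) (snd p)) + real K * ?d))"
  proof (intro sum_list_mono mult_left_mono)
    fix p assume p: "p \<in> set ?ps"
    have m: "mean (concat (map pl (chunk L ?vs t))) h \<le> mean (po (?vs ! t)) h + ?d" "po (?vs ! t) \<noteq> []"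
      if t: "t \<in> set (snd p)" and h: "\<forall>x. 0 \<le> h x \<and> h x \<le> 1" for t h
    proof -
      let ?l = "take L (concat (replicate L (occurrences ?vs (?vs ! t))))"
      have tl: "t < length ?vs" using pos(2)[OF p t] .
      then have ne: "occurrences ?vs (?vs ! t) \<noteq> []" using rank_occurrence(1)[OF tl] by auto
      have l: "x < length ?vs" if "x \<in> set ?l" for x using set_take_replicate_same_var that by blast
      have "mean (concat (map pl (chunk L ?vs t))) h = mean (chunk L ?vs t) (\<lambda>x. mean (pl x) h)"
        by (rule mean_concat[where M = N]) (use chunk pl in auto)
      also have "\<dots> \<le> mean ?l (\<lambda>x. mean (pl x) h) + ?d"
        by (rule mean_chunk_le[OF tl L]) (use mean_bounds h in blast)
      also have "mean ?l (\<lambda>x. mean (pl x) h) = mean (concat (map pl ?l)) h"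
        by (rule mean_concat[symmetric, where M = N]) (use l pl in auto)
      finally show "mean (concat (map pl (chunk L ?vs t))) h \<le> mean (po (?vs ! t)) h + ?d"
        by (simp only: pool[OF ne])
      have "?l \<noteq> []" using ne L by (simp add: take_concat_replicate)
      then have "hd ?l \<in> set ?l" by (rule hd_in_set)
      then have "pl (hd ?l) \<noteq> []" using l pl N by force
      then show "po (?vs ! t) \<noteq> []" unfolding pool[OF ne] using \<open>hd ?l \<in> set ?l\<close> by auto
    qed
    have "mean_tuple (Q (fst p)) (map (\<lambda>t. concat (map pl (chunk L ?vs t))) (snd p)) \<le>
        mean_tuple (Q (fst p)) (map (\<lambda>t. po (?vs ! t)) (snd p)) +
        real (length (map (\<lambda>t. concat (map pl (chunk L ?vs t))) (snd p))) * ?d"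
    proof (rule mean_tuple_perturb)
      show "list_all2 (\<lambda>A B. \<forall>h. (\<forall>x. 0 \<le> h x \<and> h x \<le> 1) \<longrightarrow> mean A h \<le> mean B h + ?d)
          (map (\<lambda>t. concat (map pl (chunk L ?vs t))) (snd p)) (map (\<lambda>t. po (?vs ! t)) (snd p))"
        unfolding list_all2_map1 list_all2_map2 list_all2_same using m(1) by blast
      show "B \<noteq> []" if "B \<in> set (map (\<lambda>t. po (?vs ! t)) (snd p))" for B
        using that m(2)[of _ "\<lambda>_. 0"] by auto
    qed (rule Q)
    also have "real (length (map (\<lambda>t. concat (map pl (chunk L ?vs t))) (snd p))) * ?d \<le> real K * ?d"
      using pos(1)[OF p] by (intro mult_right_mono) auto
    finally show "mean_tuple (Q (fst p)) (map (\<lambda>t. concat (map pl (chunk L ?vs t))) (snd p)) \<le>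
        mean_tuple (Q (fst p)) (map (\<lambda>t. po (?vs ! t)) (snd p)) + real K * ?d" by simp
  qed simp
  also have "\<dots> = real L ^ K * ((\<Sum>p\<leftarrow>?ps. mean_tuple (Q (fst p)) (map (\<lambda>t. po (?vs ! t)) (snd p))) + real (length ?ps) * (real K * ?d))"
    by (simp add: sum_list_const_mult sum_list_addf sum_list_triv)
  also have "(\<Sum>p\<leftarrow>?ps. mean_tuple (Q (fst p)) (map (\<lambda>t. po (?vs ! t)) (snd p))) = satisfied_mean Q cs po"
    unfolding satisfied_mean_def by (subst (2) cs) (simp add: comp_def)
  finally show ?thesis by simp
qed

section \<open>Rounding the lists\<close>

definition holds_real :: "csp \<Rightarrow> nat \<Rightarrow> nat list \<Rightarrow> real" where
  "holds_real \<Lambda> i t = of_bool (holds (\<Lambda> ! i) t)"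

lemma score_eq:
  assumes "valid_pools q n M ls" "M > 0" "\<And>p. p \<in> set cs \<Longrightarrow> length (snd p) \<le> K \<and> set (snd p) \<subseteq> {..<n}"
  shows "real (score \<Lambda> K M cs ls) = real M ^ K * satisfied_mean (holds_real \<Lambda>) cs (\<lambda>v. ls ! v)"
proof -
  have len: "real (length (filter P xs)) = (\<Sum>x\<leftarrow>xs. of_bool (P x))" for P and xs :: "nat list list"
    by (induction xs) auto
  have "real (score \<Lambda> K M cs ls) = (\<Sum>p\<leftarrow>cs. \<Sum>tp\<leftarrow>padded_product M K (map (\<lambda>v. ls ! v) (snd p)). holds_real \<Lambda> (fst p) tp)"
    unfolding score_def length_concat by (simp add: comp_def holds_real_def len[symmetric])
      (induction cs; simp)
  also have "\<dots> = (\<Sum>p\<leftarrow>cs. real M ^ K * mean_tuple (holds_real \<Lambda> (fst p)) (map (\<lambda>v. ls ! v) (snd p)))"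
  proof (intro arg_cong[of _ _ sum_list] map_cong refl sum_list_padded_product)
    fix p l assume p: "p \<in> set cs" and "l \<in> set (map (\<lambda>v. ls ! v) (snd p))"
    then obtain v where "v < n" "l = ls ! v" using assms(3)[OF p] by auto
    then show "length l = M" using assms(1) by (auto simp: valid_pools_def)
  qed (use assms in auto)
  finally show ?thesis by (simp add: satisfied_mean_def sum_list_const_mult)
qed

lemma round_step_conv:
  assumes "v < length ls"
  shows "take v ls @ x # drop (Suc v) ls = list_update ls v x"
  using assms by (simp add: upd_conv_take_nth_drop)

text \<open>The expectation is the average, over the list of \<open>v\<close>, of the expectations
  with \<open>v\<close> fixed. An entry reaching this average lies in \<open>{1..q}\<close>, so the
  search succeeds before its default is reached.\<close>

lemma round_step_score:
  assumes ls: "valid_pools q n M ls" and v: "v < n" and M: "M > 0"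
    and cs: "\<And>p. p \<in> set cs \<Longrightarrow> length (snd p) \<le> K \<and> set (snd p) \<subseteq> {..<n}" and d: "distinct_scopes cs"
  shows "score \<Lambda> K M cs ls \<le> score \<Lambda> K M cs (round_step q \<Lambda> K M cs v ls)"
proof -
  have len: "length ls = n" "length (ls ! v) = M" "set (ls ! v) \<subseteq> {1..q}"
    using ls v by (auto simp: valid_pools_def)
  let ?u = "\<lambda>a. take v ls @ replicate M a # drop (Suc v) ls"
  let ?S = "\<lambda>ls. satisfied_mean (holds_real \<Lambda>) cs (\<lambda>v. ls ! v)"
  have upd: "?S (?u a) = satisfied_mean (holds_real \<Lambda>) cs ((\<lambda>v. ls ! v)(v := replicate M a))" for a
    using v cs len by (intro satisfied_mean_cong) (auto simp: round_step_conv nth_list_update)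
  have "?S ls = mean (ls ! v) (\<lambda>a. ?S (?u a))"
    unfolding upd by (rule satisfied_mean_affine[where pl = "\<lambda>v. ls ! v", OF d len(2) M])
  moreover have "ls ! v \<noteq> []" using len M by auto
  ultimately obtain a where a: "a \<in> set (ls ! v)" "?S ls \<le> ?S (?u a)"
    using ex_mean_le[of "ls ! v" "\<lambda>a. ?S (?u a)"] by auto
  have aq: "a \<in> {1..q}" using a(1) len(3) by blast
  have "real (score \<Lambda> K M cs ls) \<le> real (score \<Lambda> K M cs (?u a))"
    using score_eq[OF ls M, of cs K \<Lambda>] score_eq[OF valid_pools_update[OF ls v aq] M, of cs K \<Lambda>] cs a(2)
    by (simp add: mult_left_mono)
  then have le: "score \<Lambda> K M cs ls \<le> score \<Lambda> K M cs (?u a)" by simp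
  let ?f = "filter (\<lambda>a. score \<Lambda> K M cs ls \<le> score \<Lambda> K M cs (?u a)) [1..<Suc q]"
  have "a \<in> set ?f" using le aq by (simp add: less_Suc_eq_le del: upt_Suc)
  then have "?f \<noteq> []" by (metis empty_iff empty_set)
  then have "hd (?f @ [1]) \<in> set ?f" by (metis hd_append2 hd_in_set)
  then show ?thesis unfolding round_step_def by (simp only: set_filter mem_Collect_eq)
qed

lemma round_fold:
  fixes \<Lambda> :: csp
  assumes ls: "valid_pools q n M ls" and M: "M > 0" and q: "q \<ge> 1"
    and cs: "\<And>p. p \<in> set cs \<Longrightarrow> length (snd p) \<le> K \<and> set (snd p) \<subseteq> {..<n}" and d: "distinct_scopes cs"
  defines "out k \<equiv> fold (round_step q \<Lambda> K M cs) [0..<k] ls"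
  shows "k \<le> n \<Longrightarrow> valid_pools q n M (out k) \<and> score \<Lambda> K M cs ls \<le> score \<Lambda> K M cs (out k) \<and>
    (\<forall>v<k. \<exists>a. out k ! v = replicate M a)"
proof (induction k)
  case 0
  then show ?case using ls by (simp add: out_def)
next
  case (Suc k)
  then have IH: "valid_pools q n M (out k)" "score \<Lambda> K M cs ls \<le> score \<Lambda> K M cs (out k)"
    "\<forall>v<k. \<exists>a. out k ! v = replicate M a" by auto
  have k: "k < n" "k < length (out k)" using Suc.prems IH(1) by (auto simp: valid_pools_def)
  have out: "out (Suc k) = round_step q \<Lambda> K M cs k (out k)" by (simp add: out_def)
  then obtain a where a: "out (Suc k) = list_update (out k) k (replicate M a)"
    unfolding round_step_def round_step_conv[OF k(2)] by blast
  have "\<exists>a. out (Suc k) ! v = replicate M a" if "v < Suc k" for v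
    using IH(3) that k unfolding a by (cases "v = k") (auto simp: nth_list_update)
  moreover have "score \<Lambda> K M cs (out k) \<le> score \<Lambda> K M cs (out (Suc k))"
    unfolding out by (rule round_step_score[OF IH(1) k(1) M cs d])
  moreover have "valid_pools q n M (out (Suc k))"
    unfolding out by (rule valid_pools_round_step[OF IH(1) k(1) q])
  ultimately show ?case using IH(2) by auto
qed

lemma round_satisfied:
  fixes \<Lambda> :: csp
  assumes ls: "valid_pools q n M ls" and M: "M > 0" and q: "q \<ge> 1"
    and cs: "\<And>p. p \<in> set cs \<Longrightarrow> length (snd p) \<le> K \<and> set (snd p) \<subseteq> {..<n}" and d: "distinct_scopes cs"
  defines "\<xi> \<equiv> map hd (fold (round_step q \<Lambda> K M cs) [0..<n] ls)"
  shows "length \<xi> = n" "set \<xi> \<subseteq> {1..q}"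
    "satisfied_mean (holds_real \<Lambda>) cs (\<lambda>v. ls ! v) \<le> satisfied (holds_real \<Lambda>) cs (\<lambda>v. \<xi> ! v)"
proof -
  let ?o = "fold (round_step q \<Lambda> K M cs) [0..<n] ls"
  from round_fold[OF ls M q cs d order_refl, of \<Lambda>] have o: "valid_pools q n M ?o"
    "score \<Lambda> K M cs ls \<le> score \<Lambda> K M cs ?o" "\<forall>v<n. \<exists>a. ?o ! v = replicate M a" by auto
  show "length \<xi> = n" using o(1) by (simp add: \<xi>_def valid_pools_def)
  have "hd l \<in> {1..q}" if "l \<in> set ?o" for l
  proof -
    have "l \<noteq> []" "set l \<subseteq> {1..q}" using o(1) that M by (auto simp: valid_pools_def)
    then show ?thesis by (meson hd_in_set subsetD)
  qed
  then show "set \<xi> \<subseteq> {1..q}" by (auto simp: \<xi>_def)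
  have rep: "?o ! v = replicate M (\<xi> ! v)" if "v < n" for v
  proof -
    from o(3) that obtain a where a: "?o ! v = replicate M a" by blast
    moreover have "length ?o = n" using o(1) by (simp add: valid_pools_def)
    ultimately show ?thesis using that M by (simp add: \<xi>_def)
  qed
  have "satisfied_mean (holds_real \<Lambda>) cs (\<lambda>v. ?o ! v) = satisfied_mean (holds_real \<Lambda>) cs (\<lambda>v. replicate M (\<xi> ! v))"
    using rep cs by (intro satisfied_mean_cong) blast
  also have "\<dots> = satisfied (holds_real \<Lambda>) cs (\<lambda>v. \<xi> ! v)" by (rule satisfied_mean_replicate[OF M])
  finally have eq: "satisfied_mean (holds_real \<Lambda>) cs (\<lambda>v. ?o ! v) = satisfied (holds_real \<Lambda>) cs (\<lambda>v. \<xi> ! v)" .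
  have "real (score \<Lambda> K M cs ls) \<le> real (score \<Lambda> K M cs ?o)" using o(2) by simp
  then have "real M ^ K * satisfied_mean (holds_real \<Lambda>) cs (\<lambda>v. ls ! v) \<le> real M ^ K * satisfied (holds_real \<Lambda>) cs (\<lambda>v. \<xi> ! v)"
    using score_eq[OF ls M, of cs K \<Lambda>] score_eq[OF o(1) M, of cs K \<Lambda>] cs eq by simp
  then show "satisfied_mean (holds_real \<Lambda>) cs (\<lambda>v. ls ! v) \<le> satisfied (holds_real \<Lambda>) cs (\<lambda>v. \<xi> ! v)"
    using M by simp
qed

lemma map_div_halve_iter:
  "s * length xs \<le> length bs \<Longrightarrow> map (\<lambda>y. y div 2 ^ s) (halve_iter s xs bs) = xs"
proof (induction s arbitrary: xs bs)
  case (Suc s)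
  have len: "length xs \<le> length bs" using Suc.prems by simp
  have "map (\<lambda>y. y div 2 ^ Suc s) (halve_iter (Suc s) xs bs) =
      map (\<lambda>y. y div 2) (map (\<lambda>y. y div 2 ^ s) (halve_iter s (halve xs bs) (drop (length xs) bs)))"
    by (simp add: halve_iter_Suc div_mult2_eq[symmetric] mult.commute)
  also have "map (\<lambda>y. y div 2 ^ s) (halve_iter s (halve xs bs) (drop (length xs) bs)) = halve xs bs"
    using Suc.prems len by (intro Suc.IH) (simp add: min_def)
  also have "map (\<lambda>y. y div 2) (halve xs bs) = xs" by (rule halve_div_2[OF len])
  finally show ?case .
qed simp

text \<open>The factor \<open>2 ^ s\<close> in the initial degree keeps the degree even before each
  of the \<open>s\<close> halvings.\<close>

lemma count_list_halve_iter:
  assumes "s * length xs \<le> length bs" "\<And>u. u < N \<Longrightarrow> count_list xs u = d * 2 ^ s" "y < N * 2 ^ s"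
  shows "count_list (halve_iter s xs bs) y = d"
  using assms
proof (induction s arbitrary: xs bs N)
  case (Suc s)
  have len: "length xs \<le> length bs" using Suc.prems(1) by simp
  show ?case unfolding halve_iter_Suc
  proof (rule Suc.IH[where N = "2 * N"])
    show "s * length (halve xs bs) \<le> length (drop (length xs) bs)" using Suc.prems(1) len by (simp add: min_def)
    show "y < 2 * N * 2 ^ s" using Suc.prems(3) by simp
    fix u assume u: "u < 2 * N"
    define b where "b = odd u"
    have "u = 2 * (u div 2) + (if b then 1 else 0)" unfolding b_def by presburger
    moreover have "count_list xs (u div 2) = d * 2 ^ Suc s" using u by (intro Suc.prems(2)) auto
    ultimately show "count_list (halve xs bs) u = d * 2 ^ s"
      using count_list_halve[OF len, of "u div 2" b] by simp
  qed
qed simp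

section \<open>Error and failure probability\<close>

lemma length_slots_le: "(\<And>p. p \<in> set cs \<Longrightarrow> length (snd p) \<le> K) \<Longrightarrow> length (slots cs) \<le> K * length cs"
  by (induction cs) (auto simp: slots_def add_mono)

lemma degree_of_eq_count_list:
  assumes "distinct_scopes (constraints G)"
  shows "degree_of G v = count_list (slots (constraints G)) v"
proof -
  have "length (filter (\<lambda>(i, S). v \<in> set S) cs) = count_list (slots cs) v" if "distinct_scopes cs" for cs
    using that
  proof (induction cs)
    case (Cons p cs)
    then have "count_list (snd p) v = (if v \<in> set (snd p) then 1 else 0)"
      by (auto simp: distinct_scopes_def count_list_0_iff intro: count_list_distinct[unfolded One_nat_def])
    then show ?case using Cons
      by (auto simp: slots_def count_list_append distinct_scopes_def case_prod_beta)
  qed (simp add: slots_def)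
  then show ?thesis using assms by (simp add: degree_of_def)
qed

lemma Val_eq: "Val \<Lambda> F \<xi> = satisfied (holds_real \<Lambda>) (constraints F) \<xi> / real (length (constraints F))"
  by (simp add: Val_def satisfied_def holds_real_def case_prod_unfold)

lemma sum_list_sqrt2_le: "(\<Sum>k<s. sqrt 2 ^ k) \<le> 3 * sqrt 2 ^ s"
proof -
  \<comment> \<open>The factor of the geometric series is \<open>1 / (sqrt 2 - 1)\<close>, rounded
    up to \<open>3\<close>.\<close>
  have r: "sqrt 2 - 1 \<ge> 1 / (3 :: real)"
    using real_le_rsqrt[of "4 / 3" 2] by (simp add: power2_eq_square)
  have "(sqrt 2 - 1) * (\<Sum>k<s. sqrt 2 ^ k) = sqrt 2 ^ s - 1"
    by (rule power_diff_1_eq[symmetric])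
  moreover have "1 / 3 * (\<Sum>k<s. sqrt 2 ^ k) \<le> (sqrt 2 - 1) * (\<Sum>k<s. sqrt 2 ^ k)"
    using r by (intro mult_right_mono sum_nonneg) auto
  ultimately show ?thesis by simp
qed

text \<open>\<open>e\<close> stands for \<open>\<lceil>1 / \<epsilon>\<rceil>\<close>, and the error
  \<open>1 / e\<close> is shared equally by the windows and the halvings. In the assumption on
  \<open>c\<close>, \<open>36 = (2 * 3)\<^sup>2\<close>: the \<open>3\<close> is from the geometric
  series of the levels, the \<open>2\<close> from this sharing.\<close>

locale regularization =
  fixes q :: nat and \<Lambda> :: csp and K c :: nat and F :: csp_instance and e :: nat
  assumes q: "q \<ge> 1" and F: "is_instance \<Lambda> F" and e: "e \<ge> 1"
    and K: "K \<ge> 1" "\<And>i. i < length \<Lambda> \<Longrightarrow> arity (\<Lambda> ! i) \<le> K"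
    and c: "36 * (2 * K * (2 * K * q + 1)) \<le> 2 ^ c"
begin

abbreviation "Q \<equiv> holds_real \<Lambda>"
abbreviation "n \<equiv> nvars F"
abbreviation "m \<equiv> length (constraints F)"
abbreviation "rcs \<equiv> rep_constraints F"
abbreviation "w \<equiv> length (slots rcs)"
abbreviation "L \<equiv> (2 :: nat) ^ log_blowup c F e"
abbreviation "s \<equiv> levels K c F e"
abbreviation "bcs \<equiv> base K c F e"
abbreviation "mtot \<equiv> length bcs"
abbreviation "W \<equiv> length (slots bcs)"

lemma m_pos: "m \<ge> 1"
  using F by (cases "constraints F") (auto simp: is_instance_def)

lemma constraintD:
  assumes "p \<in> set (constraints F)"
  shows "fst p < length \<Lambda>" "length (snd p) = arity (\<Lambda> ! fst p)" "length (snd p) \<le> K" "distinct (snd p)" "set (snd p) \<subseteq> {..<n}"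
  using F assms K(2) by (force simp: is_instance_def)+

lemma set_rcs: "set rcs = set (constraints F)"
  by (auto simp: rep_constraints_def)

lemma length_rcs: "length rcs = (n + 1) * m"
  by (simp add: rep_constraints_def length_concat_replicate)

lemma w_le: "w \<le> K * ((n + 1) * m)"
  using length_slots_le[of rcs K] constraintD(3) by (simp add: set_rcs length_rcs)

lemma project_base:
  "map (\<lambda>p. (fst p, map ((!) (slots rcs)) (snd p))) bcs = concat (map (replicate (L ^ K)) rcs)"
  unfolding base_def by (rule project_blowup) (auto simp: set_rcs intro: constraintD(3))

lemma length_bcs: "mtot = L ^ K * ((n + 1) * m)"
proof -
  have "mtot = length (concat (map (replicate (L ^ K)) rcs))"
    unfolding project_base[symmetric] by simp
  also have "\<dots> = L ^ K * length rcs"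
  proof -
    have "length (concat (map (replicate k) xs)) = k * length xs" for k and xs :: "(nat \<times> nat list) list"
      by (induction xs) auto
    then show ?thesis .
  qed
  finally show ?thesis by (simp add: length_rcs)
qed

lemma mtot_pos: "mtot > 0"
  using m_pos unfolding length_bcs by (intro mult_pos_pos) auto

lemma base_projection:
  assumes "p \<in> set bcs"
  shows "(fst p, map ((!) (slots rcs)) (snd p)) \<in> set (constraints F)"
proof -
  have "(fst p, map ((!) (slots rcs)) (snd p)) \<in> set (concat (map (replicate (L ^ K)) rcs))"
    unfolding project_base[symmetric] using assms by force
  then show ?thesis by (auto simp: set_rcs split: if_splits)
qed

lemma distinct_scopes_base: "distinct_scopes bcs"
  unfolding distinct_scopes_def using constraintD(4)[OF base_projection] by (auto simp: distinct_map)

lemma W_le: "W \<le> K * mtot"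
  by (rule length_slots_le) (use constraintD(3)[OF base_projection] in auto)

lemma L_power: "L ^ K = 2 ^ log_deg c e * 2 ^ s"
proof -
  have "log_blowup c F e * K = log_deg c e + s"
    using K(1) by (cases K) (auto simp: log_blowup_def levels_def algebra_simps)
  then show ?thesis by (simp add: power_mult[symmetric] power_add[symmetric])
qed

lemma e_sq_le: "e\<^sup>2 * 2 ^ c \<le> 2 ^ log_deg c e"
proof -
  have "e \<le> 2 ^ ceil_log e" using less_pow_ceil_log[of e] by simp
  then have "e ^ 2 * 2 ^ c \<le> (2 ^ ceil_log e) ^ 2 * 2 ^ c" by (intro mult_right_mono power_mono) auto
  then show ?thesis by (simp add: log_deg_def power_add power_mult mult.commute)
qed

lemma window_error: "real K * (real w / real L) \<le> 1 / (2 * real e)"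
proof -
  let ?j = "log_size F e"
  have "n + m + e < 2 ^ ?j" unfolding log_size_def by (rule less_pow_ceil_log)
  then have "n + 1 \<le> 2 ^ ?j" "m \<le> 2 ^ ?j" "e \<le> 2 ^ ?j" using m_pos by simp_all
  then have "(n + 1) * m * e \<le> 2 ^ ?j * 2 ^ ?j * 2 ^ ?j" by (intro mult_mono) auto
  moreover have "2 * K * K \<le> 2 ^ log_deg c e"
  proof -
    have "2 * K * K \<le> 36 * (2 * K * (2 * K * q + 1))"
    proof -
      have "1 \<le> 2 * q" using q by simp
      from mult_le_mono2[OF this, of K] have "K \<le> 2 * K * q + 1"
        by (simp only: mult_1_right mult.assoc mult.left_commute[of K 2] trans_le_add1)
      then have "K * K \<le> K * (2 * K * q + 1)" by (rule mult_left_mono) simp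
      then show ?thesis by simp
    qed
    also have "\<dots> \<le> 1 * 2 ^ c" using c by simp
    also have "\<dots> \<le> e\<^sup>2 * 2 ^ c" using e by (intro mult_right_mono) auto
    also have "\<dots> \<le> 2 ^ log_deg c e" by (rule e_sq_le)
    finally show ?thesis .
  qed
  ultimately have "(2 * K * K) * ((n + 1) * m * e) \<le> 2 ^ log_deg c e * (2 ^ ?j * 2 ^ ?j * 2 ^ ?j)"
    by (rule mult_le_mono[rotated])
  also have "\<dots> = L"
    by (simp add: log_blowup_def power_add[symmetric] algebra_simps flip: power_add)
  finally have "2 * e * K * (K * ((n + 1) * m)) \<le> L" by (simp add: algebra_simps)
  moreover have "2 * e * K * w \<le> 2 * e * K * (K * ((n + 1) * m))" using w_le by (intro mult_left_mono) auto
  ultimately have "2 * e * K * w \<le> L" by linarith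
  then have "real (2 * e * K * w) \<le> real L" by (rule of_nat_mono)
  then have "2 * real e * (real K * real w) \<le> real L" by (simp only: of_nat_mult of_nat_numeral mult.assoc)
  then show ?thesis using e by (simp add: field_simps)
qed

text \<open>Chosen so that the tail exponent at level \<open>k\<close> is
  \<open>(2 * K * q + 1) * 2 ^ k * (n + 1) * m\<close>: the summand \<open>2 * K * q\<close> pays
  for the union bound over assignments, and the \<open>1\<close> remains.\<close>

definition "C = real (2 * K * (2 * K * q + 1))"

text \<open>The degree before the halving of level \<open>k\<close> is \<open>L ^ K / 2 ^ k\<close>,
  so this is \<open>mtot * sqrt (C / d)\<close> for that degree \<open>d\<close>.\<close>

definition threshold :: "nat \<Rightarrow> real" where
  "threshold k = real mtot * sqrt (C / real (L ^ K)) * sqrt 2 ^ k"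

lemma C_pos: "C > 0"
  using K(1) by (simp add: C_def add_pos_nonneg)

lemma threshold_nonneg: "threshold k \<ge> 0"
  using C_pos by (simp add: threshold_def)

lemma threshold_sum: "(\<Sum>k<s. threshold k) \<le> real mtot / (2 * real e)"
proof -
  have "(\<Sum>k<s. threshold k) = real mtot * sqrt (C / real (L ^ K)) * (\<Sum>k<s. sqrt 2 ^ k)"
    by (simp add: threshold_def sum_distrib_left)
  also have "\<dots> \<le> real mtot * sqrt (C / real (L ^ K)) * (3 * sqrt 2 ^ s)"
    using C_pos by (intro mult_left_mono sum_list_sqrt2_le) auto
  also have "\<dots> = real mtot * (3 * (sqrt (C / real (L ^ K)) * sqrt (2 ^ s)))"
    by (simp add: real_sqrt_power)
  \<comment> \<open>By \<open>L_power\<close> only the final degree is left in the bound, however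
    large the blow-up was.\<close>
  also have "sqrt (C / real (L ^ K)) * sqrt (2 ^ s) = sqrt (C / 2 ^ log_deg c e)"
    unfolding L_power by (simp add: real_sqrt_mult[symmetric])
  also have "sqrt (C / 2 ^ log_deg c e) \<le> 1 / (6 * real e)"
  proof (rule real_le_lsqrt)
    have "real (e\<^sup>2 * (36 * (2 * K * (2 * K * q + 1)))) \<le> real (2 ^ log_deg c e)"
      using mult_left_mono[OF c, of "e\<^sup>2"] e_sq_le by (intro of_nat_mono) linarith
    then have "(real e)\<^sup>2 * (36 * C) \<le> 2 ^ log_deg c e" unfolding C_def by simp
    then show "C / 2 ^ log_deg c e \<le> (1 / (6 * real e))\<^sup>2"
      using e by (simp add: field_simps power2_eq_square)
  qed (use e in auto)
  finally show ?thesis by (simp add: mult_left_mono)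
qed

lemma level_failure: "real q ^ (2 * (w * 2 ^ k)) * exp (- ((threshold k)\<^sup>2) / (2 * (real K * real mtot))) \<le> (1 / 2) ^ (n + 1 + k)"
proof -
  let ?M = "real ((n + 1) * m)"
  \<comment> \<open>The crude bound \<open>q \<le> exp q\<close> makes the number of assignments
    comparable with the tail bound.\<close>
  have "real q ^ (2 * (w * 2 ^ k)) \<le> exp (real q) ^ (2 * (w * 2 ^ k))"
    by (rule power_mono) (use exp_ge_add_one_self[of "real q"] in linarith, simp)
  also have "\<dots> = exp (real (2 * (w * 2 ^ k)) * real q)" by (simp only: exp_of_nat_mult)
  also have "\<dots> \<le> exp (2 * real K * real q * 2 ^ k * ?M)"
  proof -
    have "real (2 * (w * 2 ^ k)) * real q \<le> real (2 * (K * ((n + 1) * m) * 2 ^ k)) * real q"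
      using w_le by (intro mult_right_mono of_nat_mono mult_left_mono) auto
    then show ?thesis by (simp add: algebra_simps)
  qed
  finally have 1: "real q ^ (2 * (w * 2 ^ k)) \<le> exp (2 * real K * real q * 2 ^ k * ?M)" .
  have "0 < (n + 1) * m" using m_pos by (intro mult_pos_pos) auto
  then have M: "?M > 0" by (simp only: of_nat_0_less_iff)
  have Lp: "real (L ^ K) > 0" by simp
  have mt: "real mtot = real (L ^ K) * ?M" unfolding length_bcs by (rule of_nat_mult)
  have sq: "(sqrt 2 ^ k)\<^sup>2 = (2 :: real) ^ k" by (metis power2_eq_square power_mult_distrib real_sqrt_mult_self abs_numeral)
  have "(threshold k)\<^sup>2 = real mtot * real mtot * (C / real (L ^ K)) * 2 ^ k"
    unfolding threshold_def power_mult_distrib sq using C_pos by (simp add: power2_eq_square)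
  also have "\<dots> = real mtot * ?M * C * 2 ^ k" unfolding mt using Lp by (simp add: field_simps)
  finally have "(threshold k)\<^sup>2 / (2 * (real K * real mtot)) = ?M * (C / (2 * real K)) * 2 ^ k"
    using mtot_pos K(1) by (simp add: field_simps)
  also have "C / (2 * real K) = 2 * real K * real q + 1" using K(1) by (simp add: C_def field_simps)
  finally have 2: "(threshold k)\<^sup>2 / (2 * (real K * real mtot)) = 2 * real K * real q * 2 ^ k * ?M + 2 ^ k * ?M"
    by (simp add: algebra_simps)
  have "real q ^ (2 * (w * 2 ^ k)) * exp (- ((threshold k)\<^sup>2) / (2 * (real K * real mtot))) \<le>
      exp (2 * real K * real q * 2 ^ k * ?M) * exp (- (2 * real K * real q * 2 ^ k * ?M + 2 ^ k * ?M))"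
    using 1 2 by (intro mult_mono) auto
  also have "\<dots> = exp (- (2 ^ k * ?M))" by (simp add: exp_add[symmetric])
  also have "\<dots> \<le> exp (- real (n + 1 + k))"
  proof -
    \<comment> \<open>Here the \<open>n + 1\<close> copies of the constraints are used: without them
      the exponent would only be \<open>2 ^ k * m\<close>.\<close>
    have "n + 1 + k \<le> 2 ^ k * ((n + 1) * m)"
    proof -
      have "k + 1 \<le> 2 ^ k" by (rule Suc_leI[OF less_exp, unfolded Suc_eq_plus1])
      moreover have "(n + 1) * 1 \<le> (n + 1) * m" using m_pos by (intro mult_left_mono) auto
      ultimately have "(k + 1) * ((n + 1) * 1) \<le> 2 ^ k * ((n + 1) * m)" by (rule mult_le_mono)
      moreover have "n + 1 + k \<le> (k + 1) * ((n + 1) * 1)" by simp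
      ultimately show ?thesis by linarith
    qed
    then have "real (n + 1 + k) \<le> real (2 ^ k * ((n + 1) * m))" by (rule of_nat_mono)
    then show ?thesis by (simp add: algebra_simps)
  qed
  also have "\<dots> = (exp (- 1)) ^ (n + 1 + k)" 
    using exp_of_nat_mult[of "n + 1 + k" "- 1 :: real"] by (simp only: mult_minus_right mult_1_right)
  also have "\<dots> \<le> (1 / 2) ^ (n + 1 + k)"
  proof (rule power_mono)
    show "exp (- 1) \<le> 1 / (2 :: real)"
      using exp_ge_add_one_self[of 1] by (simp add: exp_minus field_simps)
  qed simp
  finally show ?thesis .
qed

abbreviation "good \<equiv> levels_ok Q q bcs threshold s 0 w (slots bcs)"

lemma Q_bounds: "0 \<le> Q i t \<and> Q i t \<le> 1"
  by (simp add: holds_real_def)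

text \<open>The failure bounds of the levels form a geometric series with sum at most
  \<open>2 * (1 / 2) ^ (n + 1)\<close>.\<close>

lemma bad_probability: "real (card {bs \<in> coins (num_coins K c F e). \<not> good bs}) / 2 ^ num_coins K c F e \<le> (1 / 2) ^ n"
proof -
  have "real (card {bs \<in> coins (s * W). \<not> good bs}) / 2 ^ (s * W) \<le>
      (\<Sum>k<s. real q ^ (2 * (w * 2 ^ k)) * exp (- ((threshold (0 + k))\<^sup>2) / (2 * (real K * real mtot))))"
  proof (rule levels_ok_probability)
    show "distinct_scopes (relabel bcs (slots bcs))" by (simp add: relabel_slots distinct_scopes_base)
    show "real W \<le> real K * real mtot" using W_le by (simp flip: of_nat_mult)
    show "real K * real mtot > 0" using K(1) mtot_pos by simp
  qed (auto intro: Q_bounds[THEN conjunct1] Q_bounds[THEN conjunct2] threshold_nonneg)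
  also have "\<dots> \<le> (\<Sum>k<s. (1 / 2) ^ (n + 1 + k))" by (intro sum_mono) (use level_failure in simp)
  also have "\<dots> = (1 / 2) ^ (n + 1) * (\<Sum>k<s. (1 / 2) ^ k)" by (simp add: power_add sum_distrib_left)
  also have "(\<Sum>k<s. (1 / 2) ^ k) \<le> (2 :: real)"
  proof -
    have "(\<Sum>k<s. (1 / 2 :: real) ^ k) = 2 * (1 - (1 / 2) ^ s)" by (simp add: sum_gp_strict)
    then show ?thesis by simp
  qed
  finally show ?thesis unfolding num_coins_def by simp
qed

section \<open>The final instance for a fixed list of coins\<close>

context
  fixes bs :: "bool list"
  assumes bs: "length bs = num_coins K c F e"
begin

abbreviation "G \<equiv> regularized K c F e bs"

lemma bs_le: "s * W \<le> length bs"
  using bs by (simp add: num_coins_def)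

text \<open>A variable \<open>y\<close> of the final instance descends from the slot
  \<open>y div 2 ^ s\<close>, hence from a variable of \<open>F\<close>; undoing the splitting gives
  copies of the original constraints, all with the same multiplicity.\<close>

lemma project_G:
  "map (\<lambda>p. (fst p, map (\<lambda>y. slots rcs ! (y div 2 ^ s)) (snd p))) (constraints G) = concat (map (replicate (L ^ K)) rcs)"
proof -
  have "map (\<lambda>p. (fst p, map (\<lambda>y. y div 2 ^ s) (snd p))) (constraints G) = bcs"
    unfolding regularized_def csp_instance.simps relabel_map[symmetric] map_div_halve_iter[OF bs_le] relabel_slots ..
  then have "map (\<lambda>p. (fst p, map ((!) (slots rcs)) (snd p))) (map (\<lambda>p. (fst p, map (\<lambda>y. y div 2 ^ s) (snd p))) (constraints G)) =
      concat (map (replicate (L ^ K)) rcs)" by (simp only: project_base)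
  then show ?thesis by (simp add: comp_def)
qed

lemma nvars_G: "nvars G = w * 2 ^ s"
  by (simp add: regularized_def)

lemma length_constraints_G: "length (constraints G) = mtot"
  by (simp add: regularized_def)

lemma G_projection:
  assumes "p \<in> set (constraints G)"
  shows "(fst p, map (\<lambda>y. slots rcs ! (y div 2 ^ s)) (snd p)) \<in> set (constraints F)"
proof -
  have "(fst p, map (\<lambda>y. slots rcs ! (y div 2 ^ s)) (snd p)) \<in> set (concat (map (replicate (L ^ K)) rcs))"
    unfolding project_G[symmetric] using assms by force
  then show ?thesis by (auto simp: set_rcs split: if_splits)
qed

lemma distinct_scopes_G: "distinct_scopes (constraints G)"
  unfolding distinct_scopes_def using constraintD(4)[OF G_projection] by (auto simp: distinct_map)

lemma length_halve_iter_G: "length (halve_iter s (slots bcs) bs) = W"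
  using arg_cong[OF map_div_halve_iter[OF bs_le], of length] by simp

lemma slots_G: "slots (constraints G) = halve_iter s (slots bcs) bs"
  unfolding regularized_def csp_instance.simps by (rule slots_relabel) (rule length_halve_iter_G)

lemma slots_G_less: "y \<in> set (slots (constraints G)) \<Longrightarrow> y < w * 2 ^ s"
  unfolding slots_G
proof -
  assume "y \<in> set (halve_iter s (slots bcs) bs)"
  then have "y div 2 ^ s \<in> set (map (\<lambda>y. y div 2 ^ s) (halve_iter s (slots bcs) bs))" by auto
  then have "y div 2 ^ s < w" unfolding map_div_halve_iter[OF bs_le] by (auto simp: base_def dest: slots_blowup_less)
  then show "y < w * 2 ^ s" by (simp add: div_less_iff_less_mult)
qed

lemma is_instance_G: "is_instance \<Lambda> G"
  unfolding is_instance_def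
proof (intro conjI ballI, goal_cases)
  case 1
  then show ?case using mtot_pos length_constraints_G by auto
next
  case (2 p)
  have "set (snd p) \<subseteq> {..<nvars G}"
    using 2 slots_G_less unfolding nvars_G by (force simp: slots_def[of "constraints _"])
  then show ?case
    using constraintD(1,2)[OF G_projection[OF 2]] distinct_scopes_G 2
    by (auto simp: distinct_scopes_def case_prod_beta)
qed

lemma degree_G: "v < nvars G \<Longrightarrow> degree_of G v = 2 ^ log_deg c e"
  unfolding degree_of_eq_count_list[OF distinct_scopes_G] slots_G nvars_G
proof (rule count_list_halve_iter[OF bs_le])
  fix u assume "u < w"
  then have "count_list (slots bcs) u = L ^ K"
    unfolding base_def by (intro count_list_slots_blowup) (auto simp: set_rcs intro: constraintD(3))
  then show "count_list (slots bcs) u = 2 ^ log_deg c e * 2 ^ s" by (simp only: L_power)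
qed

lemma regular_G: "regular G"
  by (simp add: regular_def degree_G)

lemma satisfied_rep: "(\<Sum>p\<leftarrow>concat (map (replicate k) xs). f p) = real k * (\<Sum>p\<leftarrow>xs. f p)"
  by (induction xs) (auto simp: algebra_simps sum_list_replicate)

lemma sum_rcs: "(\<Sum>p\<leftarrow>rcs. f p) = real (n + 1) * (\<Sum>p\<leftarrow>constraints F. f p)"
proof -
  have "(\<Sum>p\<leftarrow>concat (replicate k xs). f p) = real k * (\<Sum>p\<leftarrow>xs. f p)" for k xs
    by (induction k) (auto simp: algebra_simps)
  then show ?thesis unfolding rep_constraints_def by (simp only: Suc_eq_plus1)
qed

text \<open>Uniform multiplicities cancel in the quotient. The identity holds for all coins, so the
  comparison of the optima involves no error.\<close>

lemma Val_lift: "Val \<Lambda> G (\<lambda>y. \<xi> (slots rcs ! (y div 2 ^ s))) = Val \<Lambda> F \<xi>"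
proof -
  have "satisfied Q (constraints G) (\<lambda>y. \<xi> (slots rcs ! (y div 2 ^ s))) =
      satisfied Q (map (\<lambda>p. (fst p, map (\<lambda>y. slots rcs ! (y div 2 ^ s)) (snd p))) (constraints G)) \<xi>"
    by (simp add: satisfied_def comp_def)
  also have "\<dots> = real (L ^ K) * (real (n + 1) * satisfied Q (constraints F) \<xi>)"
    unfolding project_G satisfied_def satisfied_rep sum_rcs ..
  finally have "Val \<Lambda> G (\<lambda>y. \<xi> (slots rcs ! (y div 2 ^ s))) =
      real (L ^ K) * (real (n + 1) * satisfied Q (constraints F) \<xi>) / (real (L ^ K) * (real (n + 1) * real m))"
    unfolding Val_eq length_constraints_G length_bcs by (simp only: of_nat_mult)
  also have "\<dots> = Val \<Lambda> F \<xi>"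
  proof -
    have "real (L ^ K) \<noteq> 0" "real (n + 1) \<noteq> 0" by simp_all
    moreover have "x * (y * u) / (x * (y * v)) = u / v" if "x \<noteq> 0" "y \<noteq> 0" for x y u v :: real
      using that by simp
    ultimately show ?thesis unfolding Val_eq by blast
  qed
  finally show ?thesis .
qed

lemma Opt_F_le: "Opt q \<Lambda> F \<le> Opt q \<Lambda> G"
proof -
  have fin: "finite (assignments q H)" for H by (auto simp: assignments_def intro: finite_PiE)
  have ne: "assignments q F \<noteq> {}" using q by (auto simp: assignments_def PiE_eq_empty_iff)
  have "Val \<Lambda> F \<xi> \<le> Opt q \<Lambda> G" if \<xi>: "\<xi> \<in> assignments q F" for \<xi>
  proof -
    let ?\<zeta> = "\<lambda>y. \<xi> (slots rcs ! (y div 2 ^ s))"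
    define \<zeta> where "\<zeta> = restrict ?\<zeta> {..<nvars G}"
    have "slots rcs ! (y div 2 ^ s) < n" if "y < nvars G" for y
    proof -
      have "y div 2 ^ s < w" using that unfolding nvars_G by (simp add: div_less_iff_less_mult)
      then have "slots rcs ! (y div 2 ^ s) \<in> set (slots rcs)" by (rule nth_mem)
      then show ?thesis using constraintD(5) by (force simp: slots_def[of "rep_constraints F"] set_rcs)
    qed
    then have "\<zeta> \<in> assignments q G" using \<xi> by (auto simp: \<zeta>_def assignments_def PiE_iff)
    moreover have "Val \<Lambda> G \<zeta> = Val \<Lambda> G ?\<zeta>"
    proof -
      have "map \<zeta> (snd p) = map ?\<zeta> (snd p)" if "p \<in> set (constraints G)" for p
        using that is_instance_G by (fastforce simp: \<zeta>_def is_instance_def)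
      then show ?thesis unfolding Val_eq satisfied_def by (simp cong: map_cong)
    qed
    ultimately have "Val \<Lambda> F \<xi> \<in> Val \<Lambda> G ` assignments q G" unfolding Val_lift by force
    then show ?thesis unfolding Opt_def by (intro Max_ge finite_imageI fin)
  qed
  then show ?thesis unfolding Opt_def[of q \<Lambda> F] using ne by (subst Max_le_iff) (auto intro: finite_imageI fin)
qed

section \<open>An assignment of the final instance\<close>

context
  fixes \<zeta> :: "nat \<Rightarrow> nat"
  assumes \<zeta>: "\<zeta> \<in> assignments q G"
begin

abbreviation "z \<equiv> map \<zeta> [0..<nvars G]"
abbreviation "pl \<equiv> \<lambda>u. map \<zeta> [u * 2 ^ s..<Suc u * 2 ^ s]"
abbreviation "po \<equiv> pool L (2 ^ s) (slots rcs) z 1"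

lemma assignment_value: "v < nvars G \<Longrightarrow> \<zeta> v \<in> {1..q}"
  by (rule PiE_mem[OF \<zeta>[unfolded assignments_def]]) simp

lemma set_z: "set z \<subseteq> {1..q}"
proof
  fix x assume "x \<in> set z"
  then obtain v where v: "v \<in> {0..<nvars G}" "x = \<zeta> v" unfolding set_map set_upt by blast
  then have "v < nvars G" by (simp only: atLeastLessThan_iff)
  then show "x \<in> {1..q}" unfolding v(2) by (rule assignment_value)
qed

lemma length_z: "length z = w * 2 ^ s"
  by (simp add: nvars_G)

lemma pool_conv:
  assumes "occurrences (slots rcs) v \<noteq> []"
  shows "po v = concat (map pl (take L (concat (replicate L (occurrences (slots rcs) v)))))"
proof -
  let ?ts = "take L (concat (replicate L (occurrences (slots rcs) v)))"
  have "take (2 ^ s) (drop (t * 2 ^ s) z) = pl t" if "t \<in> set ?ts" for t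
  proof -
    have "t < w" using that set_take_replicate_same_var by blast
    then have "Suc t * 2 ^ s \<le> w * 2 ^ s" by (intro mult_right_mono) auto
    then have "take (2 ^ s) (drop (t * 2 ^ s) [0..<w * 2 ^ s]) = [t * 2 ^ s..<Suc t * 2 ^ s]"
      by (simp add: add.commute)
    then show ?thesis unfolding nvars_G by (simp only: drop_map take_map)
  qed
  then have "map (\<lambda>t. take (2 ^ s) (drop (t * 2 ^ s) z)) ?ts = map pl ?ts" by (intro map_cong refl)
  then show ?thesis using assms unfolding pool_def by (simp only: if_False)
qed

text \<open>Halving loses at most \<open>mtot / (2 * e)\<close> satisfied constraints and the
  windows lose at most as many again; dividing by \<open>mtot\<close> gives the total error.\<close>

lemma Val_G_le:
  assumes "good bs"
  shows "Val \<Lambda> G \<zeta> \<le> satisfied_mean Q (constraints F) po / real m + 1 / real e"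
proof -
  have "satisfied Q (relabel bcs (halve_iter s (slots bcs) bs)) \<zeta> \<le>
      satisfied_mean Q (relabel bcs (slots bcs)) pl + (\<Sum>k<s. threshold (0 + k))"
  proof (rule satisfied_halve_iter[OF assms])
    show "length bs = s * W" using bs by (simp add: num_coins_def)
    show "distinct_scopes (relabel bcs (slots bcs))" by (simp add: relabel_slots distinct_scopes_base)
    show "\<forall>x\<in>set (slots bcs). x < w" by (auto simp: base_def dest: slots_blowup_less)
    show "\<zeta> v \<in> {1..q}" if "v < w * 2 ^ s" for v by (rule assignment_value) (simp only: nvars_G that)
  qed
  then have 1: "satisfied Q (constraints G) \<zeta> \<le> satisfied_mean Q bcs pl + real mtot / (2 * real e)"
    using threshold_sum by (simp add: relabel_slots regularized_def)
  have 2: "satisfied_mean Q bcs pl \<le> real L ^ K * (satisfied_mean Q rcs po + real (length rcs) * (real K * (real w / real L)))"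
    unfolding base_def
  proof (rule satisfied_mean_blowup_le[where N = "2 ^ s"])
    show "length (snd p) \<le> K" if "p \<in> set rcs" for p using that constraintD(3) by (simp add: set_rcs)
    show "po v = concat (map pl (take L (concat (replicate L (occurrences (slots rcs) v)))))"
      if "occurrences (slots rcs) v \<noteq> []" for v using that by (rule pool_conv)
  qed (auto intro: Q_bounds[THEN conjunct1] Q_bounds[THEN conjunct2])
  have 3: "real (length rcs) * (real K * (real w / real L)) \<le> real (length rcs) * (1 / (2 * real e))"
    by (rule mult_left_mono[OF window_error]) simp
  have 4: "satisfied_mean Q rcs po = real (n + 1) * satisfied_mean Q (constraints F) po"
    unfolding satisfied_mean_def by (rule sum_rcs)
  let ?S = "satisfied_mean Q (constraints F) po"
  have "real L ^ K * (satisfied_mean Q rcs po + real (length rcs) * (real K * (real w / real L))) \<le>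
      real L ^ K * (real (n + 1) * ?S + real (length rcs) * (1 / (2 * real e)))"
    unfolding 4 using 3 by (intro mult_left_mono) auto
  then have "satisfied Q (constraints G) \<zeta> \<le>
      real L ^ K * (real (n + 1) * ?S + real (length rcs) * (1 / (2 * real e))) + real mtot / (2 * real e)"
    using 1 2 by linarith
  also have "\<dots> = real mtot * (?S / real m + 1 / real e)"
  proof -
    have "A * (B * S + B * M * (1 / (2 * E))) + A * (B * M) / (2 * E) = A * (B * M) * (S / M + 1 / E)"
      if "M > 0" "E > 0" for A B M E S :: real
      using that by (simp add: field_simps)
    moreover have "real mtot = real L ^ K * (real (n + 1) * real m)"
      unfolding length_bcs by (simp only: of_nat_mult of_nat_power)
    moreover have "real (length rcs) = real (n + 1) * real m" unfolding length_rcs by (rule of_nat_mult)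
    moreover have "real m > 0" "real e > 0" using m_pos e by (simp_all only: of_nat_0_less_iff)
    ultimately show ?thesis by (simp only:)
  qed
  finally show ?thesis
    unfolding Val_eq length_constraints_G using mtot_pos by (simp add: divide_le_eq mult.commute)
qed

lemma recovered_good:
  assumes "good bs"
  shows "\<exists>\<xi> \<in> assignments q F. enc_assignment F \<xi> = enc_list enc_nat (recovered q \<Lambda> K c F e z) \<and>
    Val \<Lambda> F \<xi> \<ge> Val \<Lambda> G \<zeta> - 1 / real e"
proof -
  let ?ls = "map po [0..<n]"
  have valid: "valid_pools q n (L * 2 ^ s) ?ls"
    using length_pool[OF length_z] set_pool[OF set_z] q by (fastforce simp: valid_pools_def)
  define x where "x = recovered q \<Lambda> K c F e z"
  have x: "x = map hd (fold (round_step q \<Lambda> K (L * 2 ^ s) (constraints F)) [0..<n] ?ls)"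
    by (simp add: x_def recovered_def Let_def)
  have M: "0 < L * 2 ^ s" by simp
  have cs: "length (snd p) \<le> K \<and> set (snd p) \<subseteq> {..<n}" if "p \<in> set (constraints F)" for p
    using constraintD(3,5)[OF that] by blast
  have d: "distinct_scopes (constraints F)" using constraintD(4) by (auto simp: distinct_scopes_def)
  note r = round_satisfied[OF valid M q cs d, of \<Lambda>, folded x]
  define \<xi> where "\<xi> = restrict (\<lambda>v. x ! v) {..<n}"
  have "x ! v \<in> {1..q}" if "v < n" for v using r(1,2) that by (metis nth_mem subsetD)
  then have \<xi>: "\<xi> \<in> assignments q F" by (simp add: \<xi>_def assignments_def PiE_iff)
  have "map \<xi> [0..<n] = x" using r(1) by (auto simp: \<xi>_def intro!: nth_equalityI)
  moreover have "enc_list (\<lambda>v. f (g v)) vs = enc_list f (map g vs)" for f :: "nat \<Rightarrow> btree" and g :: "nat \<Rightarrow> nat" and vs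
    by (induction vs) auto
  ultimately have enc: "enc_assignment F \<xi> = enc_list enc_nat x" by (simp add: enc_assignment_def)
  have "satisfied_mean Q (constraints F) po = satisfied_mean Q (constraints F) (\<lambda>v. ?ls ! v)"
    using cs by (intro satisfied_mean_cong) (auto simp: subset_iff)
  also have "\<dots> \<le> satisfied Q (constraints F) (\<lambda>v. x ! v)" by (rule r(3))
  also have "\<dots> = satisfied Q (constraints F) \<xi>"
    unfolding satisfied_def using cs
    by (intro arg_cong[of _ _ sum_list] map_cong refl arg_cong[of _ _ "Q _"]) (auto simp: \<xi>_def)
  finally have "satisfied_mean Q (constraints F) po / real m \<le> Val \<Lambda> F \<xi>"
    unfolding Val_eq by (rule divide_right_mono) simp
  then have "Val \<Lambda> G \<zeta> - 1 / real e \<le> Val \<Lambda> F \<xi>" using Val_G_le[OF assms] by linarith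
  then show ?thesis using \<xi> enc by (auto simp: x_def)
qed

end

end

end

section \<open>Sizes, probabilities and degrees for the final statement\<close>

lemma size_enc_instance_le:
  assumes F: "is_instance \<Lambda> F" and K: "\<And>i. i < length \<Lambda> \<Longrightarrow> arity (\<Lambda> ! i) \<le> K"
    and x: "nvars F \<le> x" "length (constraints F) \<le> x"
  shows "size (enc_instance F) \<le> poly [:1, length \<Lambda> + K + 4, K:] x"
proof -
  let ?p = "enc_prod enc_nat (enc_list enc_nat)"
  have "size (?p p) + 1 \<le> length \<Lambda> + K * (x + 1) + 2" if p: "p \<in> set (constraints F)" for p
  proof -
    have p': "fst p < length \<Lambda>" "length (snd p) \<le> K" "set (snd p) \<subseteq> {..<nvars F}"
      using F p K by (force simp: is_instance_def)+
    have "(\<Sum>v\<leftarrow>snd p. size (enc_nat v) + 1) \<le> (\<Sum>v\<leftarrow>snd p. x + 1)"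
      using p'(3) x(1) by (intro sum_list_mono) (auto simp: subset_iff)
    also have "\<dots> = length (snd p) * (x + 1)" by (simp add: sum_list_triv)
    also have "\<dots> \<le> K * (x + 1)" using p'(2) by (rule mult_le_mono1)
    finally have "size (enc_list enc_nat (snd p)) \<le> K * (x + 1)" by (simp add: size_enc_list)
    then show ?thesis using p'(1) by (simp add: enc_prod_def)
  qed
  then have "(\<Sum>p\<leftarrow>constraints F. size (?p p) + 1) \<le> (\<Sum>p\<leftarrow>constraints F. length \<Lambda> + K * (x + 1) + 2)"
    by (rule sum_list_mono)
  also have "\<dots> = length (constraints F) * (length \<Lambda> + K * (x + 1) + 2)" by (simp add: sum_list_triv)
  also have "\<dots> \<le> x * (length \<Lambda> + K * (x + 1) + 2)" using x(2) by (rule mult_le_mono1)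
  finally have "size (enc_list ?p (constraints F)) \<le> x * (length \<Lambda> + K * (x + 1) + 2)"
    by (simp add: size_enc_list[of ?p])
  then show ?thesis using x(1) by (simp add: enc_instance_conv algebra_simps)
qed

text \<open>A run has \<open>T\<close> coins at its disposal but the event depends only on the first
  \<open>n\<close>, read in reverse; neither the surplus coins nor the reversal, a bijection,
  changes the probability.\<close>

lemma card_good_coins:
  assumes "n \<le> T" "real (card {bs \<in> coins n. \<not> P bs}) / 2 ^ n \<le> d"
  shows "measure_pmf.prob (pmf_of_set (coins T)) {\<omega>. length \<omega> = T \<and> P (rev (take n \<omega>))} \<ge> 1 - d"
proof -
  let ?G = "{\<omega>. length \<omega> = T \<and> P (rev (take n \<omega>))}" and ?B = "{\<omega> \<in> coins T. \<not> P (rev (take n \<omega>))}"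
  have "card {\<omega> \<in> coins (n + (T - n)). \<not> P (rev (take n \<omega>))} = (\<Sum>\<beta>\<in>coins n. card {\<gamma> \<in> coins (T - n). \<not> P (rev \<beta>)})"
    by (rule card_coins_add[where R = "\<lambda>\<beta> \<gamma>. \<not> P (rev \<beta>)"])
  also have "\<dots> = (\<Sum>\<beta>\<in>coins n. if \<not> P (rev \<beta>) then 2 ^ (T - n) else 0)"
    by (intro sum.cong refl) (simp add: card_coins)
  also have "\<dots> = card {\<beta> \<in> coins n. \<not> P (rev \<beta>)} * 2 ^ (T - n)"
    by (simp add: sum.If_cases Int_def)
  also have "card {\<beta> \<in> coins n. \<not> P (rev \<beta>)} = card {bs \<in> coins n. \<not> P bs}"
    by (rule bij_betw_same_card[of rev], rule bij_betw_byWitness[where f' = rev]) (auto simp: coins_def)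
  finally have B: "card ?B = card {bs \<in> coins n. \<not> P bs} * 2 ^ (T - n)" using assms(1) by simp
  have "measure_pmf.prob (pmf_of_set (coins T)) ?G = real (card (coins T \<inter> ?G)) / real (card (coins T))"
    by (rule measure_pmf_of_set) auto
  also have "coins T \<inter> ?G = coins T - ?B" by (auto simp: coins_def)
  also have "real (card (coins T - ?B)) = real (card (coins T)) - real (card ?B)"
  proof -
    have "card ?B \<le> card (coins T)" by (intro card_mono) auto
    then show ?thesis by (subst card_Diff_subset) (auto simp: of_nat_diff)
  qed
  also have "(real (card (coins T)) - real (card ?B)) / real (card (coins T)) = 1 - real (card ?B) / 2 ^ T"
    by (simp add: card_coins diff_divide_distrib)
  also have "real (card ?B) / 2 ^ T = real (card {bs \<in> coins n. \<not> P bs}) / 2 ^ n"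
  proof -
    have "(2 :: real) ^ T = 2 ^ n * 2 ^ (T - n)" using assms(1) by (simp flip: power_add)
    then show ?thesis unfolding B by simp
  qed
  finally show ?thesis using assms(2) by linarith
qed

text \<open>\<open>\<lceil>1 / \<epsilon>\<rceil> \<le> 2 / \<epsilon>\<close> for \<epsilon> at
  most 1, and the logarithmic factor \<open>- ln \<epsilon>\<close> is at least 1 for \<epsilon>
  below \<open>exp (- 1)\<close>.\<close>

lemma degree_bound_bigo:
  "(\<lambda>\<epsilon> :: real. C * (real (nat \<lceil>1 / \<epsilon>\<rceil>))\<^sup>2) \<in> O[at_right 0](\<lambda>\<epsilon>. - ln \<epsilon> / \<epsilon>\<^sup>2)"
proof (rule bigoI)
  have "norm (C * (real (nat \<lceil>1 / \<epsilon>\<rceil>))\<^sup>2) \<le> 4 * \<bar>C\<bar> * norm (- ln \<epsilon> / \<epsilon>\<^sup>2)" if \<epsilon>: "0 < \<epsilon>" "\<epsilon> < exp (- 1)" for \<epsilon> :: real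
  proof -
    have "ln \<epsilon> < ln (exp (- 1))" using \<epsilon> by (subst ln_less_cancel_iff) auto
    then have ln: "1 \<le> - ln \<epsilon>" by simp
    have "\<epsilon> \<le> 1" using \<epsilon> by (smt (verit) exp_le_one_iff)
    then have "real (nat \<lceil>1 / \<epsilon>\<rceil>) \<le> 2 / \<epsilon>" using \<epsilon>
      by (smt (verit) divide_right_mono le_divide_eq_1_pos of_int_ceiling_le_add_one of_nat_nat zero_le_ceiling add_divide_distrib zero_less_divide_iff)
    then have "(real (nat \<lceil>1 / \<epsilon>\<rceil>))\<^sup>2 \<le> (2 / \<epsilon>)\<^sup>2" by (intro power_mono) auto
    also have "\<dots> = 4 * (1 / \<epsilon>\<^sup>2)" by (simp add: power_divide)
    also have "\<dots> \<le> 4 * (- ln \<epsilon> / \<epsilon>\<^sup>2)" using ln \<epsilon> by (intro mult_left_mono divide_right_mono) auto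
    finally have "(real (nat \<lceil>1 / \<epsilon>\<rceil>))\<^sup>2 \<le> 4 * (- ln \<epsilon> / \<epsilon>\<^sup>2)" .
    moreover have "norm (- ln \<epsilon> / \<epsilon>\<^sup>2) = - ln \<epsilon> / \<epsilon>\<^sup>2"
      unfolding real_norm_def using ln by (intro abs_of_nonneg divide_nonneg_nonneg) auto
    moreover have "norm (C * (real (nat \<lceil>1 / \<epsilon>\<rceil>))\<^sup>2) = \<bar>C\<bar> * (real (nat \<lceil>1 / \<epsilon>\<rceil>))\<^sup>2" by (simp add: abs_mult)
    ultimately show ?thesis using mult_left_mono[of "(real (nat \<lceil>1 / \<epsilon>\<rceil>))\<^sup>2" "4 * (- ln \<epsilon> / \<epsilon>\<^sup>2)" "\<bar>C\<bar>"] by (simp add: mult.assoc mult.left_commute)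
  qed
  then show "\<forall>\<^sub>F \<epsilon> in at_right (0 :: real). norm (C * (real (nat \<lceil>1 / \<epsilon>\<rceil>))\<^sup>2) \<le> 4 * \<bar>C\<bar> * norm (- ln \<epsilon> / \<epsilon>\<^sup>2)"
    by (intro eventually_at_rightI[of 0 "exp (- 1)"]) auto
qed

lemma regularize_program:
  obtains p T where "\<And>F e. num_coins K c F e \<le> poly T (size (Bin (enc_instance F) (enc_nat e)))"
    "\<And>F e bs \<omega>. length bs = num_coins K c F e \<Longrightarrow>
      \<exists>t \<le> poly T (size (Bin (enc_instance F) (enc_nat e))).
        eval p (Bin (enc_instance F) (enc_nat e)) (bs @ \<omega>) t (enc_instance (regularized K c F e (rev bs))) \<omega>"
proof -
  let ?e = "\<lambda>a. Bin (enc_instance (fst a)) (enc_nat (snd a))"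
  interpret i: polytime_instance UNIV ?e fst snd
  proof
    show "polytime UNIV ?e (\<lambda>a. enc_instance (fst a))" using polytime_head[OF polytime_input[of UNIV ?e]] by simp
    show "polytime UNIV ?e (\<lambda>a. enc_nat (snd a))" using polytime_tail[OF polytime_input[of UNIV ?e]] by simp
  qed
  let ?D = "{y. fst y \<in> UNIV \<and> length (snd y) = num_coins K c (fst (fst y)) (snd (fst y))}"
  let ?e2 = "\<lambda>y. Bin (enc_list enc_bool (snd y)) (?e (fst y))"
  interpret j: polytime_instance ?D ?e2 "\<lambda>y. fst (fst y)" "\<lambda>y. snd (fst y)"
  proof
    have "polytime ?D ?e2 (\<lambda>y. ?e (fst y))" by (rule polytime_inner)
    from polytime_head[OF this] polytime_tail[OF this]
    show "polytime ?D ?e2 (\<lambda>a. enc_instance (fst (fst a)))" "polytime ?D ?e2 (\<lambda>a. enc_nat (snd (fst a)))" by simp_all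
  qed
  have "polytime ?D ?e2 (\<lambda>y. enc_list enc_bool (snd y))"
    using polytime_head[OF polytime_input[of ?D ?e2]] by simp
  note f = j.polytime_regularized[OF this, of K c]
  from randomized_program[OF i.polytime_num_coins[of K c], where f = "\<lambda>a bs. enc_instance (regularized K c (fst a) (snd a) bs)", OF f]
  obtain p T where
    "\<And>a. a \<in> UNIV \<Longrightarrow> num_coins K c (fst a) (snd a) \<le> poly T (size (?e a))"
    "\<And>a bs \<omega>. a \<in> UNIV \<Longrightarrow> length bs = num_coins K c (fst a) (snd a) \<Longrightarrow>
       \<exists>t \<le> poly T (size (?e a)). eval p (?e a) (bs @ \<omega>) t (enc_instance (regularized K c (fst a) (snd a) (rev bs))) \<omega>"
    by metis
  then show ?thesis by (intro that[of T p]) (force, metis UNIV_I fst_conv snd_conv)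
qed

lemma recover_program:
  assumes q: "q \<ge> 1"
  obtains p S where "\<And>F e G z \<omega>. is_instance \<Lambda> F \<Longrightarrow>
      length z = length (slots (rep_constraints F)) * 2 ^ levels K c F e \<Longrightarrow> set z \<subseteq> {1..q} \<Longrightarrow>
      \<exists>t \<le> poly S (size (Bin (Bin (enc_instance F) (enc_nat e)) (Bin (enc_instance G) (enc_list enc_nat z)))).
        eval p (Bin (Bin (enc_instance F) (enc_nat e)) (Bin (enc_instance G) (enc_list enc_nat z))) \<omega> t
          (enc_list enc_nat (recovered q \<Lambda> K c F e z)) \<omega>"
proof -
  let ?e = "\<lambda>(F, e, G, z). Bin (Bin (enc_instance F) (enc_nat e)) (Bin (enc_instance G) (enc_list enc_nat z))"
  let ?F = "\<lambda>(F, e :: nat, G :: csp_instance, z :: nat list). F :: csp_instance" and ?E = "\<lambda>(F :: csp_instance, e, G :: csp_instance, z :: nat list). e :: nat"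
    and ?z = "\<lambda>(F :: csp_instance, e :: nat, G :: csp_instance, z). z :: nat list"
  let ?D = "{a. is_instance \<Lambda> (?F a) \<and> length (?z a) = length (slots (rep_constraints (?F a))) * 2 ^ levels K c (?F a) (?E a) \<and> set (?z a) \<subseteq> {1..q}}"
  interpret i: polytime_instance ?D ?e ?F ?E
  proof
    show "polytime ?D ?e (\<lambda>a. enc_instance (?F a))"
      by (rule polytime_cong[OF polytime_head[OF polytime_head[OF polytime_input]]]) auto
    show "polytime ?D ?e (\<lambda>a. enc_nat (?E a))"
      by (rule polytime_cong[OF polytime_tail[OF polytime_head[OF polytime_input]]]) auto
  qed
  have "polytime ?D ?e (\<lambda>a. enc_list enc_nat (recovered q \<Lambda> K c (?F a) (?E a) (?z a)))"
  proof (rule i.polytime_recovered)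
    show "polytime ?D ?e (\<lambda>a. enc_list enc_nat (?z a))"
      by (rule polytime_cong[OF polytime_tail[OF polytime_tail[OF polytime_input]]]) auto
    show "i < length \<Lambda> \<and> set S \<subseteq> {..<nvars (?F a)}" if "a \<in> ?D" "(i, S) \<in> set (constraints (?F a))" for a i S
      using that by (force simp: is_instance_def)
  qed (use q in auto)
  then obtain p S where pS: "\<forall>a\<in>?D. \<forall>\<omega>. \<exists>t \<le> poly S (size (?e a)). eval p (?e a) \<omega> t (enc_list enc_nat (recovered q \<Lambda> K c (?F a) (?E a) (?z a))) \<omega>"
    unfolding polytime_def by blast
  show ?thesis
  proof (rule that[of S p])
    fix F e G z \<omega>
    assume "is_instance \<Lambda> F" "length z = length (slots (rep_constraints F)) * 2 ^ levels K c F e" "set z \<subseteq> {1..q}"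
    then have "(F, e, G, z) \<in> ?D" by simp
    from pS[rule_format, OF this, of \<omega>]
    show "\<exists>t \<le> poly S (size (Bin (Bin (enc_instance F) (enc_nat e)) (Bin (enc_instance G) (enc_list enc_nat z)))).
        eval p (Bin (Bin (enc_instance F) (enc_nat e)) (Bin (enc_instance G) (enc_list enc_nat z))) \<omega> t
          (enc_list enc_nat (recovered q \<Lambda> K c F e z)) \<omega>" by simp
  qed
qed

theorem theorem7:
  fixes q :: nat and \<Lambda> :: csp
  assumes "q \<ge> 1"
  shows "\<exists>(regularize :: prog) (T :: nat poly) (recover :: prog) (S :: nat poly)
            (D :: real \<Rightarrow> real) (\<delta> :: nat \<Rightarrow> real).
     D \<in> O[at_right 0](\<lambda>\<epsilon>. - ln \<epsilon> / \<epsilon>\<^sup>2) \<and>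
     \<delta> \<in> O(\<lambda>n. 1 / 2 ^ n) \<and>
     (\<forall>F \<epsilon>. is_instance \<Lambda> F \<longrightarrow> \<epsilon> > 0 \<longrightarrow>
       (let e = nat \<lceil>1 / \<epsilon>\<rceil>;
            time = poly T (inst_size F + e);
            output = (\<lambda>\<omega> G. halts_within time regularize
                        (Bin (enc_instance F) (enc_nat e)) \<omega> (enc_instance G))
        in
          (\<forall>\<omega> \<in> coins time. \<exists>G. output \<omega> G \<and> is_instance \<Lambda> G \<and> regular G \<and>
             (\<forall>v < nvars G. real (degree_of G v) \<le> D \<epsilon>)) \<and>
          measure_pmf.prob (pmf_of_set (coins time))
            {\<omega>. \<exists>G. output \<omega> G \<and>
               (\<forall>\<zeta> \<in> assignments q G. \<exists>\<xi> \<in> assignments q F.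
                  halts_within (poly S (inst_size F + e + inst_size G)) recover
                    (Bin (Bin (enc_instance F) (enc_nat e))
                         (Bin (enc_instance G) (enc_assignment G \<zeta>)))
                    [] (enc_assignment F \<xi>) \<and>
                  Val \<Lambda> F \<xi> \<ge> Val \<Lambda> G \<zeta> - \<epsilon>) \<and>
               Opt q \<Lambda> F \<le> Opt q \<Lambda> G + \<epsilon>}
          \<ge> 1 - \<delta> (nvars F)))"
proof -
  \<comment> \<open>The sum bounds every single arity; \<open>Suc\<close> makes \<open>K\<close>
    positive even if all arities are 0.\<close>
  define K where "K = Suc (sum_list (map arity \<Lambda>))"
  \<comment> \<open>A crude choice that works because \<open>x < 2 ^ x\<close>.\<close>
  define c where "c = 36 * (2 * K * (2 * K * q + 1))"
  have K: "K \<ge> 1" "arity (\<Lambda> ! i) \<le> K" if "i < length \<Lambda>" for i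
    using member_le_sum_list[of "arity (\<Lambda> ! i)" "map arity \<Lambda>"] that by (auto simp: K_def)
  have K1: "K \<ge> 1" by (simp add: K_def)
  have c: "36 * (2 * K * (2 * K * q + 1)) \<le> 2 ^ c"
    using less_exp[of c] unfolding c_def by linarith
  obtain p T where T: "\<And>F e. num_coins K c F e \<le> poly T (size (Bin (enc_instance F) (enc_nat e)))"
    and p: "\<And>F e bs \<omega>. length bs = num_coins K c F e \<Longrightarrow>
      \<exists>t \<le> poly T (size (Bin (enc_instance F) (enc_nat e))).
        eval p (Bin (enc_instance F) (enc_nat e)) (bs @ \<omega>) t (enc_instance (regularized K c F e (rev bs))) \<omega>"
    using regularize_program[of K c] by metis
  obtain r S where r: "\<And>F e G z \<omega>. is_instance \<Lambda> F \<Longrightarrow>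
      length z = length (slots (rep_constraints F)) * 2 ^ levels K c F e \<Longrightarrow> set z \<subseteq> {1..q} \<Longrightarrow>
      \<exists>t \<le> poly S (size (Bin (Bin (enc_instance F) (enc_nat e)) (Bin (enc_instance G) (enc_list enc_nat z)))).
        eval r (Bin (Bin (enc_instance F) (enc_nat e)) (Bin (enc_instance G) (enc_list enc_nat z))) \<omega> t
          (enc_list enc_nat (recovered q \<Lambda> K c F e z)) \<omega>"
    using recover_program[OF assms, of \<Lambda> K c] by metis
  define U where "U = [:1, length \<Lambda> + K + 4, K:]"
  \<comment> \<open>\<open>U\<close> bounds the encoding of an instance of size at most
    \<open>x\<close>; the unary \<open>e\<close> and a pairing node add at most
    \<open>x + 1\<close>. In \<open>S'\<close>, two instances, three pairing nodes, \<open>e\<close>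
    and an assignment of size at most \<open>(q + 1) * x\<close> are accounted for.\<close>
  define T' where "T' = T \<circ>\<^sub>p (U + [:1, 1:])"
  define S' where "S' = S \<circ>\<^sub>p (U + U + [:3, q + 2:])"
  \<comment> \<open>The factor \<open>9\<close> comes from
    \<open>2 ^ ceil_log e \<le> 2 * e + 1 \<le> 3 * e\<close>.\<close>
  define D where "D = (\<lambda>\<epsilon> :: real. 2 ^ c * 9 * (real (nat \<lceil>1 / \<epsilon>\<rceil>))\<^sup>2)"
  have main: "(\<forall>\<omega> \<in> coins (poly T' (inst_size F + e)). \<exists>G.
        halts_within (poly T' (inst_size F + e)) p (Bin (enc_instance F) (enc_nat e)) \<omega> (enc_instance G) \<and>
        is_instance \<Lambda> G \<and> regular G \<and> (\<forall>v < nvars G. real (degree_of G v) \<le> D \<epsilon>)) \<and>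
      measure_pmf.prob (pmf_of_set (coins (poly T' (inst_size F + e))))
        {\<omega>. \<exists>G. halts_within (poly T' (inst_size F + e)) p (Bin (enc_instance F) (enc_nat e)) \<omega> (enc_instance G) \<and>
           (\<forall>\<zeta> \<in> assignments q G. \<exists>\<xi> \<in> assignments q F.
              halts_within (poly S' (inst_size F + e + inst_size G)) r
                (Bin (Bin (enc_instance F) (enc_nat e)) (Bin (enc_instance G) (enc_assignment G \<zeta>)))
                [] (enc_assignment F \<xi>) \<and>
              Val \<Lambda> F \<xi> \<ge> Val \<Lambda> G \<zeta> - \<epsilon>) \<and>
           Opt q \<Lambda> F \<le> Opt q \<Lambda> G + \<epsilon>} \<ge> 1 - 1 / 2 ^ nvars F"
    if F: "is_instance \<Lambda> F" and \<epsilon>: "\<epsilon> > 0" and e_def: "e = nat \<lceil>1 / \<epsilon>\<rceil>" for F \<epsilon> e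
  proof -
    have "0 < 1 / \<epsilon>" using \<epsilon> by simp
    then have e: "e \<ge> 1" unfolding e_def by linarith
    have "1 / \<epsilon> \<le> real e" unfolding e_def by linarith
    then have eps: "1 / real e \<le> \<epsilon>" using \<epsilon> e by (simp add: field_simps)
    interpret regularization q \<Lambda> K c F e
      by unfold_locales (use assms F e K K1 c in auto)
    define time where "time = poly T' (inst_size F + e)"
    let ?in = "Bin (enc_instance F) (enc_nat e)"
    let ?N = "num_coins K c F e"
    have "size ?in \<le> poly (U + [:1, 1:]) (inst_size F + e)"
    proof -
      have "size (enc_instance F) \<le> poly U (inst_size F + e)"
        unfolding U_def by (rule size_enc_instance_le[OF F K(2)]) (auto simp: inst_size_def)
      then show ?thesis by simp
    qed
    then have time: "poly T (size ?in) \<le> time"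
      unfolding time_def T'_def poly_pcompose by (rule poly_mono_nat)
    have N_le: "?N \<le> time" using T[of F e] time by linarith
    have out: "halts_within time p ?in \<omega> (enc_instance (regularized K c F e (rev (take ?N \<omega>))))"
      if "length \<omega> = time" for \<omega>
    proof -
      have "length (take ?N \<omega>) = ?N" using that N_le by simp
      from p[OF this, of "drop ?N \<omega>"] show ?thesis
        unfolding halts_within_def using time by (auto intro: order_trans)
    qed
    have len: "length (rev (take ?N \<omega>)) = ?N" if "length \<omega> = time" for \<omega> using that N_le by simp
    have deg: "real (2 ^ log_deg c e) \<le> D \<epsilon>"
    proof -
      have "(2 :: nat) ^ log_deg c e = (2 ^ ceil_log e) ^ 2 * 2 ^ c"
        unfolding log_deg_def power_add mult.commute[of 2] power_mult ..
      also have "\<dots> \<le> (3 * e) ^ 2 * 2 ^ c"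
        using pow_ceil_log_le[of e] e by (intro mult_le_mono1 power_mono) auto
      finally have "real (2 ^ log_deg c e) \<le> real ((3 * e) ^ 2 * 2 ^ c)" by (rule of_nat_mono)
      then show ?thesis by (simp add: D_def e_def[symmetric] power_mult_distrib mult.commute mult.left_commute)
    qed
    have 1: "\<exists>G. halts_within time p ?in \<omega> (enc_instance G) \<and> is_instance \<Lambda> G \<and> regular G \<and>
        (\<forall>v < nvars G. real (degree_of G v) \<le> D \<epsilon>)" if "\<omega> \<in> coins time" for \<omega>
    proof -
      have l: "length \<omega> = time" using that by (simp add: coins_def)
      show ?thesis
        using out[OF l] is_instance_G[OF len[OF l]] regular_G[OF len[OF l]] degree_G[OF len[OF l]] deg by metis
    qed
    let ?target = "{\<omega>. \<exists>G. halts_within time p ?in \<omega> (enc_instance G) \<and>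
           (\<forall>\<zeta> \<in> assignments q G. \<exists>\<xi> \<in> assignments q F.
              halts_within (poly S' (inst_size F + e + inst_size G)) r
                (Bin ?in (Bin (enc_instance G) (enc_assignment G \<zeta>))) [] (enc_assignment F \<xi>) \<and>
              Val \<Lambda> F \<xi> \<ge> Val \<Lambda> G \<zeta> - \<epsilon>) \<and>
           Opt q \<Lambda> F \<le> Opt q \<Lambda> G + \<epsilon>}"
    \<comment> \<open>The single event \<open>good\<close> serves all assignments \<zeta> at once,
      because the union bound was already taken for \<open>level_ok\<close>.\<close>
    have "{\<omega>. length \<omega> = time \<and> good (rev (take ?N \<omega>))} \<subseteq> ?target"
    proof (rule subsetI, elim CollectE conjE, rule CollectI)
      fix \<omega> assume l: "length \<omega> = time" and gd: "good (rev (take ?N \<omega>))"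
      define bs where "bs = rev (take ?N \<omega>)"
      have bs: "length bs = ?N" using len[OF l] by (simp add: bs_def)
      have gd': "good bs" unfolding bs_def by (rule gd)
      let ?G = "regularized K c F e bs"
      have rec: "\<exists>\<xi> \<in> assignments q F.
              halts_within (poly S' (inst_size F + e + inst_size ?G)) r
                (Bin ?in (Bin (enc_instance ?G) (enc_assignment ?G \<zeta>))) [] (enc_assignment F \<xi>) \<and>
              Val \<Lambda> F \<xi> \<ge> Val \<Lambda> ?G \<zeta> - \<epsilon>" if \<zeta>: "\<zeta> \<in> assignments q ?G" for \<zeta>
      proof -
        let ?z = "map \<zeta> [0..<nvars ?G]"
        let ?x = "inst_size F + e + inst_size ?G"
        obtain \<xi> where \<xi>: "\<xi> \<in> assignments q F" "enc_assignment F \<xi> = enc_list enc_nat (recovered q \<Lambda> K c F e ?z)"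
          "Val \<Lambda> F \<xi> \<ge> Val \<Lambda> ?G \<zeta> - 1 / real e"
          using recovered_good[OF bs \<zeta> gd'] by blast
        have enc: "enc_assignment ?G \<zeta> = enc_list enc_nat ?z"
        proof -
          have "enc_list (\<lambda>v. f (g v)) vs = enc_list f (map g vs)" for f :: "nat \<Rightarrow> btree" and g :: "nat \<Rightarrow> nat" and vs
            by (induction vs) auto
          then show ?thesis by (simp add: enc_assignment_def)
        qed
        let ?i = "Bin ?in (Bin (enc_instance ?G) (enc_list enc_nat ?z))"
        obtain t where t: "t \<le> poly S (size ?i)" "eval r ?i [] t (enc_list enc_nat (recovered q \<Lambda> K c F e ?z)) []"
          using r[OF F length_z[OF bs \<zeta>] set_z[OF bs \<zeta>], of ?G "[]"] by blast
        have "size ?i \<le> poly (U + U + [:3, q + 2:]) ?x"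
        proof -
          have "size (enc_instance F) \<le> poly U ?x" "size (enc_instance ?G) \<le> poly U ?x"
            unfolding U_def by (rule size_enc_instance_le[OF F K(2)] size_enc_instance_le[OF is_instance_G[OF bs] K(2)];
                simp add: inst_size_def)+
          moreover have "size (enc_list enc_nat ?z) \<le> ?x * (q + 1)"
          proof -
            have "(\<Sum>x\<leftarrow>?z. size (enc_nat x) + 1) \<le> (\<Sum>x\<leftarrow>?z. q + 1)"
              using set_z[OF bs \<zeta>] by (intro sum_list_mono) (auto simp: subset_iff)
            also have "\<dots> = nvars ?G * (q + 1)" by (simp add: sum_list_triv)
            also have "\<dots> \<le> ?x * (q + 1)" by (rule mult_le_mono1) (simp add: inst_size_def)
            finally show ?thesis by (simp only: size_enc_list)
          qed
          ultimately show ?thesis by (simp add: algebra_simps)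
        qed
        then have "poly S (size ?i) \<le> poly S' ?x"
          unfolding S'_def poly_pcompose by (rule poly_mono_nat)
        then have "halts_within (poly S' ?x) r ?i [] (enc_assignment F \<xi>)"
          unfolding halts_within_def \<xi>(2) using t order_trans by blast
        moreover have "Val \<Lambda> F \<xi> \<ge> Val \<Lambda> ?G \<zeta> - \<epsilon>" using \<xi>(3) eps by linarith
        ultimately show ?thesis using \<xi>(1) unfolding enc by blast
      qed
      have "Opt q \<Lambda> F \<le> Opt q \<Lambda> ?G + \<epsilon>" using Opt_F_le[OF bs] \<epsilon> by linarith
      then show "\<exists>G. halts_within time p ?in \<omega> (enc_instance G) \<and>
           (\<forall>\<zeta> \<in> assignments q G. \<exists>\<xi> \<in> assignments q F.
              halts_within (poly S' (inst_size F + e + inst_size G)) r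
                (Bin ?in (Bin (enc_instance G) (enc_assignment G \<zeta>))) [] (enc_assignment F \<xi>) \<and>
              Val \<Lambda> F \<xi> \<ge> Val \<Lambda> G \<zeta> - \<epsilon>) \<and>
           Opt q \<Lambda> F \<le> Opt q \<Lambda> G + \<epsilon>"
        using out[OF l] rec unfolding bs_def by blast
    qed
    then have "measure_pmf.prob (pmf_of_set (coins time)) {\<omega>. length \<omega> = time \<and> good (rev (take ?N \<omega>))} \<le>
        measure_pmf.prob (pmf_of_set (coins time)) ?target"
      by (intro measure_pmf.finite_measure_mono) auto
    moreover have "1 - (1 / 2) ^ n \<le> measure_pmf.prob (pmf_of_set (coins time)) {\<omega>. length \<omega> = time \<and> good (rev (take ?N \<omega>))}"
      by (rule card_good_coins[OF N_le bad_probability])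
    ultimately have "1 - 1 / 2 ^ n \<le> measure_pmf.prob (pmf_of_set (coins time)) ?target"
      by (simp add: power_one_over)
    then show ?thesis using 1 unfolding time_def by blast
  qed
  show ?thesis
  proof (rule exI[of _ p], rule exI[of _ T'], rule exI[of _ r], rule exI[of _ S'], rule exI[of _ D],
      rule exI[of _ "\<lambda>n. 1 / 2 ^ n"], intro conjI allI impI)
    show "D \<in> O[at_right 0](\<lambda>\<epsilon>. - ln \<epsilon> / \<epsilon>\<^sup>2)" unfolding D_def by (rule degree_bound_bigo)
    show "(\<lambda>n. 1 / 2 ^ n :: real) \<in> O(\<lambda>n. 1 / 2 ^ n)" by (rule landau_o.big_refl)
  next
    fix F and \<epsilon> :: real assume "is_instance \<Lambda> F" "\<epsilon> > 0"
    from main[OF this refl] show "let e = nat \<lceil>1 / \<epsilon>\<rceil>; time = poly T' (inst_size F + e);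
        output = (\<lambda>\<omega> G. halts_within time p (Bin (enc_instance F) (enc_nat e)) \<omega> (enc_instance G))
      in (\<forall>\<omega> \<in> coins time. \<exists>G. output \<omega> G \<and> is_instance \<Lambda> G \<and> regular G \<and>
             (\<forall>v < nvars G. real (degree_of G v) \<le> D \<epsilon>)) \<and>
          measure_pmf.prob (pmf_of_set (coins time))
            {\<omega>. \<exists>G. output \<omega> G \<and>
               (\<forall>\<zeta> \<in> assignments q G. \<exists>\<xi> \<in> assignments q F.
                  halts_within (poly S' (inst_size F + e + inst_size G)) r
                    (Bin (Bin (enc_instance F) (enc_nat e))
                         (Bin (enc_instance G) (enc_assignment G \<zeta>)))
                    [] (enc_assignment F \<xi>) \<and>
                  Val \<Lambda> F \<xi> \<ge> Val \<Lambda> G \<zeta> - \<epsilon>) \<and>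
               Opt q \<Lambda> F \<le> Opt q \<Lambda> G + \<epsilon>}
          \<ge> 1 - 1 / 2 ^ nvars F"
      unfolding Let_def .
  qed
qed

end
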